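(* Let $p$ be a prime and $n\ge0$ an integer. (i) Let $B$ be a perfect $\mathbb F_p$-algebra, $B_{n+1}:=\mathrm W_{n+1}(B)$, $C=B[t]$, $C_{n+1}=B_{n+1}[t]$. For $r\ge0$ let $\partial_{n+1}^{[r]}\in\mathcal D(\mathbb A^1_{B_{n+1}})$ be the $r$-th differential operator with respect to the variable $t$. Then $\partial_{n+1}^{[r]}\circ\tilde w_n$ factorizes through $\tilde w_n$, i.e. there is a unique $\mathrm W_{n+1}(B)$-linear $r$-th order differential operator, still denoted $\partial_{n+1}^{[r]}:\mathrm W_{n+1}(C)\to\mathrm W_{n+1}(C)$, such that $$\tilde w_n\circ\partial_{n+1}^{[r]}=\partial_{n+1}^{[r]}\circ\tilde w_n:\ \mathrm W_{n+1}(C)\to C_{n+1}.$$ (ii) Let $k$ be a perfect field of characteristic $p$, $d\ge1$, $A=k[t_1,\dots,t_d]$, $A_{n+1}=\mathrm W_{n+1}(k)[t_1,\dots,t_d]$. For any $r\ge0$ and $1\le i\le d$, the operator $\partial_{i,n+1}^{[r]}:A_{n+1}\to A_{n+1}$ factorizes through $\tilde w_n$, i.e. there is a unique $\mathrm W_{n+1}(k)$-linear $r$-th order differential operator, still denoted $\partial_{i,n+1}^{[r]}:\mathrm W_{n+1}(A)\to\mathrm W_{n+1}(A)$, such that $$\tilde w_n\circ\partial_{i,n+1}^{[r]}=\partial_{i,n+1}^{[r]}\circ\tilde w_n:\ \mathrm W_{n+1}(A)\to A_{n+1}.$$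
   Context: $\mathrm W_{n+1}(-)$ denotes $p$-typical Witt vectors of length $n+1$. For a polynomial algebra $S$ over a perfect ring $R$ (here $(R,S)=(B,C)$ or $(k,A)$) with lift $S_{n+1}$, the polynomial algebra over $\mathrm W_{n+1}(R)$ in the same variables, the map $$\tilde w_n:\mathrm W_{n+1}(S)\to S_{n+1},\qquad(f_1,\dots,f_{n+1})\mapsto\tilde f_1^{\,p^n}+p\tilde f_2^{\,p^{n-1}}+\dots+p^n\tilde f_{n+1},$$ with $\tilde f_i\in S_{n+1}$ arbitrary lifts of $f_i$, is a well-defined injective ring homomorphism; it is $\Phi^n$-semilinear, $\Phi$ the Frobenius of $\mathrm W_{n+1}(R)$. Differential operators are in the sense of Grothendieck. $\partial_{n+1}^{[r]}$ on $C_{n+1}=B_{n+1}[t]$ is the $B_{n+1}$-linear map $\frac1{r!}\partial_t^r$, i.e. $t^s\mapsto\binom srt^{s-r}$ (zero if $s<r$). Similarly $\partial_{i,n+1}^{[r]}$ on $A_{n+1}$ is the operator $\frac1{r!}\partial_{t_i}^r$, i.e. $t_i^s\mapsto\binom srt_i^{s-r}$, linear over $\mathrm W_{n+1}(k)$ and the variables $t_l$, $l\ne i$. *)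

theory Defs
  imports
    "HOL-Library.Multiset"
    "HOL-Library.Poly_Mapping"
    "HOL-Computational_Algebra.Primes"
    "HOL-Algebra.UnivPoly"
begin

section \<open>Witt vectors of finite length\<close>

text \<open>
  Integer polynomials in the variables \<open>X\<^sub>0, X\<^sub>1, \<dots>\<close> (indexed by \<^term>\<open>Inl i\<close>) and
  \<open>Y\<^sub>0, Y\<^sub>1, \<dots>\<close> (indexed by \<^term>\<open>Inr i\<close>).
\<close>

type_synonym int_mpoly = "((nat + nat) \<Rightarrow>\<^sub>0 nat) \<Rightarrow>\<^sub>0 int"

definition X_var :: "nat \<Rightarrow> int_mpoly" where
  "X_var i = Poly_Mapping.single (Poly_Mapping.single (Inl i) 1) 1"

definition Y_var :: "nat \<Rightarrow> int_mpoly" where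
  "Y_var i = Poly_Mapping.single (Poly_Mapping.single (Inr i) 1) 1"

definition ghost :: "nat \<Rightarrow> (nat \<Rightarrow> int_mpoly) \<Rightarrow> nat \<Rightarrow> int_mpoly" where
  "ghost p Z m = (\<Sum>i\<le>m. of_nat (p ^ i) * Z i ^ (p ^ (m - i)))"

text \<open>
  By Witt's theorem, for \<open>p\<close> prime there is exactly one sequence of integer polynomials with the
  ghost components prescribed below.
\<close>

definition witt_sum_poly :: "nat \<Rightarrow> nat \<Rightarrow> int_mpoly" where
  "witt_sum_poly p = (THE S. \<forall>m. ghost p S m = ghost p X_var m + ghost p Y_var m)"

definition witt_prod_poly :: "nat \<Rightarrow> nat \<Rightarrow> int_mpoly" where
  "witt_prod_poly p = (THE P. \<forall>m. ghost p P m = ghost p X_var m * ghost p Y_var m)"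

definition eval_int_mpoly ::
  "('a, 'm) ring_scheme \<Rightarrow> (nat \<Rightarrow> 'a) \<Rightarrow> (nat \<Rightarrow> 'a) \<Rightarrow> int_mpoly \<Rightarrow> 'a" where
  "eval_int_mpoly R x y P =
    (\<Oplus>\<^bsub>R\<^esub>e \<in> Poly_Mapping.keys P. [Poly_Mapping.lookup P e] \<cdot>\<^bsub>R\<^esub>
      (\<Otimes>\<^bsub>R\<^esub>v \<in> Poly_Mapping.keys e. case_sum x y v [^]\<^bsub>R\<^esub> Poly_Mapping.lookup e v))"

text \<open>
  \<open>witt p n R\<close> is the ring \<open>W\<^sub>n\<^sub>+\<^sub>1(R)\<close> of \<open>p\<close>-typical Witt vectors of length \<open>n + 1\<close>.  The entries
  are numbered from \<open>0\<close> to \<open>n\<close>.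
\<close>

definition witt :: "nat \<Rightarrow> nat \<Rightarrow> ('a, 'm) ring_scheme \<Rightarrow> (nat \<Rightarrow> 'a) ring" where
  "witt p n R =
    \<lparr>carrier = {..n} \<rightarrow>\<^sub>E carrier R,
     mult = (\<lambda>x y. \<lambda>i\<in>{..n}. eval_int_mpoly R x y (witt_prod_poly p i)),
     one = (\<lambda>i\<in>{..n}. if i = 0 then \<one>\<^bsub>R\<^esub> else \<zero>\<^bsub>R\<^esub>),
     zero = (\<lambda>i\<in>{..n}. \<zero>\<^bsub>R\<^esub>),
     add = (\<lambda>x y. \<lambda>i\<in>{..n}. eval_int_mpoly R x y (witt_sum_poly p i))\<rparr>"

definition witt_map :: "nat \<Rightarrow> ('a \<Rightarrow> 'b) \<Rightarrow> (nat \<Rightarrow> 'a) \<Rightarrow> nat \<Rightarrow> 'b" where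
  "witt_map n f x = (\<lambda>i\<in>{..n}. f (x i))"

definition perfect_Fp_algebra :: "nat \<Rightarrow> ('a, 'm) ring_scheme \<Rightarrow> bool" where
  "perfect_Fp_algebra p R \<longleftrightarrow> cring R \<and> [p] \<cdot>\<^bsub>R\<^esub> \<one>\<^bsub>R\<^esub> = \<zero>\<^bsub>R\<^esub> \<and>
    bij_betw (\<lambda>x. x [^]\<^bsub>R\<^esub> p) (carrier R) (carrier R)"


section \<open>Polynomials in several variables\<close>

text \<open>
  The polynomial ring over \<open>R\<close> in the variables \<open>t\<^sub>i\<close>, \<open>i \<in> I\<close>.  Like the univariate \<^const>\<open>UP\<close>,
  its elements are coefficient functions; the monomial \<open>\<Prod>i. t\<^sub>i ^ e\<^sub>i\<close> is the multiset
  containing each \<open>i\<close> exactly \<open>e\<^sub>i\<close> times.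
\<close>

definition MP :: "('a, 'm) ring_scheme \<Rightarrow> 'i set \<Rightarrow> ('i multiset \<Rightarrow> 'a) ring" where
  "MP R I =
    \<lparr>carrier = {f. range f \<subseteq> carrier R \<and> finite {e. f e \<noteq> \<zero>\<^bsub>R\<^esub>} \<and>
                   (\<forall>e. f e \<noteq> \<zero>\<^bsub>R\<^esub> \<longrightarrow> set_mset e \<subseteq> I)},
     mult = (\<lambda>f g e. \<Oplus>\<^bsub>R\<^esub>e' \<in> {e'. e' \<subseteq># e}. f e' \<otimes>\<^bsub>R\<^esub> g (e - e')),
     one = (\<lambda>e. if e = {#} then \<one>\<^bsub>R\<^esub> else \<zero>\<^bsub>R\<^esub>),
     zero = (\<lambda>e. \<zero>\<^bsub>R\<^esub>),
     add = (\<lambda>f g e. f e \<oplus>\<^bsub>R\<^esub> g e)\<rparr>"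

definition MP_const :: "('a, 'm) ring_scheme \<Rightarrow> 'a \<Rightarrow> 'i multiset \<Rightarrow> 'a" where
  "MP_const R a = (\<lambda>e. if e = {#} then a else \<zero>\<^bsub>R\<^esub>)"

definition UP_const :: "('a, 'm) ring_scheme \<Rightarrow> 'a \<Rightarrow> nat \<Rightarrow> 'a" where
  "UP_const R a = monom (UP R) a 0"


section \<open>The divided power derivations\<close>

text \<open>
  The \<open>R\<close>-linear map \<open>t ^ s \<mapsto> (s choose r) * t ^ (s - r)\<close>, written out on coefficient functions:
  the coefficient at \<open>t ^ j\<close> of the image comes from the coefficient at \<open>t ^ (j + r)\<close>.
\<close>

definition UP_dpd :: "('a, 'm) ring_scheme \<Rightarrow> nat \<Rightarrow> (nat \<Rightarrow> 'a) \<Rightarrow> nat \<Rightarrow> 'a" where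
  "UP_dpd R r f = (\<lambda>j. [((j + r) choose r)] \<cdot>\<^bsub>R\<^esub> f (j + r))"

definition MP_dpd ::
  "('a, 'm) ring_scheme \<Rightarrow> 'i \<Rightarrow> nat \<Rightarrow> ('i multiset \<Rightarrow> 'a) \<Rightarrow> 'i multiset \<Rightarrow> 'a" where
  "MP_dpd R i r f = (\<lambda>e. [((count e i + r) choose r)] \<cdot>\<^bsub>R\<^esub> f (e + replicate_mset r i))"

lemma (in ring) UP_dpd_monom:
  assumes "a \<in> carrier R"
  shows "UP_dpd R r (monom (UP R) a s) =
    (if s < r then \<zero>\<^bsub>UP R\<^esub> else monom (UP R) ([(s choose r)] \<cdot> a) (s - r))"
  using assms by (auto simp: UP_dpd_def UP_def fun_eq_iff)

lemma (in ring) MP_dpd_monom: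
  fixes e :: "'i multiset"
  shows "MP_dpd R i r (\<lambda>e'. if e' = e then a else \<zero>) =
    (if count e i < r then \<zero>\<^bsub>MP R I\<^esub>
     else (\<lambda>e'. if e' = e - replicate_mset r i then [(count e i choose r)] \<cdot> a else \<zero>))"
proof (cases "count e i < r")
  case True
  have "e' + replicate_mset r i \<noteq> e" for e'
    using True by (auto simp: multiset_eq_iff)
  with True show ?thesis
    by (simp add: MP_dpd_def MP_def)
next
  case False
  then have "replicate_mset r i \<subseteq># e"
    by (simp add: subseteq_mset_def)
  then have "e' + replicate_mset r i = e \<longleftrightarrow> e' = e - replicate_mset r i" for e'
    by auto
  with False show ?thesis
    by (auto simp: MP_dpd_def fun_eq_iff)
qed


section \<open>Differential operators\<close>

text \<open>
  Let \<open>S\<close> be an \<open>R\<close>-algebra via \<open>\<phi>\<close>.  Operators are taken extensional, so that equality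
  of operators is equality on the carrier of \<open>S\<close>.
\<close>

definition linear_operators ::
  "('a, 'm) ring_scheme \<Rightarrow> ('a \<Rightarrow> 'b) \<Rightarrow> ('b, 'l) ring_scheme \<Rightarrow> ('b \<Rightarrow> 'b) set" where
  "linear_operators R \<phi> S = {D \<in> carrier S \<rightarrow>\<^sub>E carrier S.
    (\<forall>x\<in>carrier S. \<forall>y\<in>carrier S. D (x \<oplus>\<^bsub>S\<^esub> y) = D x \<oplus>\<^bsub>S\<^esub> D y) \<and>
    (\<forall>a\<in>carrier R. \<forall>x\<in>carrier S. D (\<phi> a \<otimes>\<^bsub>S\<^esub> x) = \<phi> a \<otimes>\<^bsub>S\<^esub> D x)}"

definition commutator :: "('b, 'l) ring_scheme \<Rightarrow> ('b \<Rightarrow> 'b) \<Rightarrow> 'b \<Rightarrow> 'b \<Rightarrow> 'b" where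
  "commutator S D s = (\<lambda>x\<in>carrier S. D (s \<otimes>\<^bsub>S\<^esub> x) \<ominus>\<^bsub>S\<^esub> s \<otimes>\<^bsub>S\<^esub> D x)"

text \<open>
  Grothendieck's definition: the \<open>R\<close>-linear differential operators on \<open>S\<close> of order at most \<open>r\<close>.
\<close>

fun diff_operators ::
  "('a, 'm) ring_scheme \<Rightarrow> ('a \<Rightarrow> 'b) \<Rightarrow> ('b, 'l) ring_scheme \<Rightarrow> nat \<Rightarrow> ('b \<Rightarrow> 'b) set" where
  "diff_operators R \<phi> S 0 = {D \<in> linear_operators R \<phi> S.
     \<forall>s\<in>carrier S. commutator S D s = (\<lambda>x\<in>carrier S. \<zero>\<^bsub>S\<^esub>)}"
| "diff_operators R \<phi> S (Suc r) = {D \<in> linear_operators R \<phi> S.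
     \<forall>s\<in>carrier S. commutator S D s \<in> diff_operators R \<phi> S r}"


section \<open>The map from Witt vectors to the lift\<close>

text \<open>
  For a polynomial ring over \<open>W\<^sub>n\<^sub>+\<^sub>1(R)\<close>, given by coefficient functions, reduction to the polynomial
  ring over \<open>R\<close> takes the entry with index \<open>0\<close> of each coefficient.
\<close>

definition reduction :: "('e \<Rightarrow> nat \<Rightarrow> 'a) \<Rightarrow> 'e \<Rightarrow> 'a" where
  "reduction g = (\<lambda>e. g e 0)"

text \<open>
  \<open>L\<close> is the lift \<open>S\<^sub>n\<^sub>+\<^sub>1\<close>.  The value does not depend on the chosen lifts of the entries.
\<close>

definition w_tilde ::
  "nat \<Rightarrow> nat \<Rightarrow> ('e \<Rightarrow> nat \<Rightarrow> 'a, 'm) ring_scheme \<Rightarrow> (nat \<Rightarrow> 'e \<Rightarrow> 'a) \<Rightarrow> 'e \<Rightarrow> nat \<Rightarrow> 'a" where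
  "w_tilde p n L x =
    (\<Oplus>\<^bsub>L\<^esub>i \<in> {..n}. [(p ^ i)] \<cdot>\<^bsub>L\<^esub>
      ((SOME g. g \<in> carrier L \<and> reduction g = x i) [^]\<^bsub>L\<^esub> (p ^ (n - i))))"

end

theory Submission
  imports Defs "HOL-Algebra.Multiplicative_Group"
begin

text \<open>
  Write \<open>W\<close> for the ring of Witt vectors of length \<open>n + 1\<close> over the perfect base ring and \<open>L\<close> for the
  polynomial ring over \<open>W\<close>.  The map \<^const>\<open>w_tilde\<close> is an injective ring homomorphism to \<open>L\<close>, and its
  image is the additive span of the elements \<open>p ^ i * c * X ^ (p ^ (n - i) * e)\<close> with \<open>i \<le> n\<close>, \<open>c\<close> in
  \<open>W\<close> and \<open>X ^ e\<close> a monomial (lemma \<open>image_eq_span\<close>).  The \<open>r\<close>-th divided power derivation multiplies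
  \<open>X ^ e\<close> by a binomial coefficient \<open>s choose r\<close>, where \<open>s\<close> is the exponent of the variable in question,
  and divides it by the \<open>r\<close>-th power of that variable.  Since \<open>p ^ N dvd s\<close> and the absorption identity
  \<open>r * (s choose r) = s * ((s - 1) choose (r - 1))\<close> give a \<open>k \<le> N\<close> with \<open>p ^ k dvd r\<close> and
  \<open>p ^ (N - k) dvd (s choose r)\<close>, what the exponent loses in divisibility the coefficient gains, and
  the span is stable (lemma \<open>dpd_span\<close>).  So the operator restricts to the image and can be carried
  back along the injection, in exactly one way.  The Leibniz rule makes it a differential operator of
  order at most \<open>r\<close> on \<open>L\<close>; commutators correspond under an injective ring homomorphism, so the operator
  carried back has order at most \<open>r\<close> too (lemma \<open>diff_operators_restrict\<close>).  It is linear because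
  constant Witt vectors map to constant polynomials.

  The facts on Witt vectors rest on Dwork's lemma (\<open>dwork_gh\<close>, \<open>gh_unghost\<close>): a sequence of integer
  polynomials is the sequence of ghost components of some sequence \<open>Z\<close>, necessarily unique, if and only
  if its terms satisfy congruences that are stable under sums, products and negatives.  This yields the
  Witt polynomials, and also the ring laws, since any three Witt vectors over a ring are images of
  sequences of integer polynomials.  In characteristic \<open>p\<close> it shows that multiplication by \<open>p\<close> shifts the
  entries and raises them to the \<open>p\<close>-th power (\<open>witt_add_pow_p\<close>), so that for a perfect base ring the
  elements of \<open>W\<close> whose entry with index \<open>0\<close> vanishes are the multiples of \<open>p\<close>.  Injectivity
  and the description of the image follow by comparing leading terms with respect to powers of \<open>p\<close>.

  Polynomials in one and in several variables are treated together, as functions on a monoid of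
  exponents.
\<close>


section \<open>Congruences between powers\<close>

lemma freshman_dvd:
  fixes a b :: "'a::comm_ring_1"
  assumes "prime p"
  shows "of_nat p dvd (a + b) ^ p - (a ^ p + b ^ p)"
proof -
  have p: "p > 1" using assms prime_gt_1_nat by blast
  have "(a + b) ^ p = (\<Sum>k\<le>p. of_nat (p choose k) * a ^ k * b ^ (p - k))"
    by (rule binomial_ring)
  also have "{..p} = insert 0 (insert p {0<..<p})" using p by auto
  also have "(\<Sum>k\<in>\<dots>. of_nat (p choose k) * a ^ k * b ^ (p - k)) =
     b ^ p + (a ^ p + (\<Sum>k\<in>{0<..<p}. of_nat (p choose k) * a ^ k * b ^ (p - k)))"
    using p by simp
  finally have eq: "(a + b) ^ p - (a ^ p + b ^ p) =
     (\<Sum>k\<in>{0<..<p}. of_nat (p choose k) * a ^ k * b ^ (p - k))" by simp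
  have "of_nat p dvd (of_nat (p choose k) :: 'a)" if "k \<in> {0<..<p}" for k
  proof -
    have "p dvd p choose k" using that assms by (intro dvd_choose_prime) auto
    then show ?thesis by (metis dvdE dvd_triv_left of_nat_mult)
  qed
  then show ?thesis unfolding eq
    by (intro dvd_sum dvd_mult2) auto
qed

text \<open>
  Raising to the \<open>p\<close>-th power improves a congruence by one power of \<open>p\<close>.
\<close>

lemma power_dvd_power_diff:
  fixes a b :: "'a::comm_ring_1"
  assumes "of_nat (p ^ Suc k) dvd a - b"
  shows "of_nat (p ^ Suc (Suc k)) dvd a ^ p - b ^ p"
proof -
  have pab: "of_nat p dvd a - b"
    using assms by (metis dvd_mult_left of_nat_mult power_Suc)
  have pow: "of_nat p dvd a ^ j - b ^ j" for j
    using pab by (simp add: power_diff_sumr2)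
  \<comment> \<open>The cofactor of \<open>a - b\<close> in \<open>a ^ p - b ^ p\<close>: each of its \<open>p\<close> terms is congruent to \<open>b ^ (p - 1)\<close>.\<close>
  have "of_nat p dvd (\<Sum>i<p. b ^ (p - Suc i) * a ^ i)"
  proof -
    have "(\<Sum>i<p. b ^ (p - Suc i) * a ^ i) =
        (\<Sum>i<p. b ^ (p - Suc i) * (a ^ i - b ^ i)) + of_nat p * b ^ (p - 1)"
    proof -
      have "(\<Sum>i<p. b ^ (p - Suc i) * a ^ i) =
          (\<Sum>i<p. b ^ (p - Suc i) * (a ^ i - b ^ i) + b ^ (p - 1))"
        by (intro sum.cong refl) (simp add: right_diff_distrib flip: power_add)
      then show ?thesis by (simp add: sum.distrib)
    qed
    also have "of_nat p dvd \<dots>"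
      by (intro dvd_add dvd_triv_left dvd_sum dvd_mult[OF pow])
    finally show ?thesis .
  qed
  then have "of_nat (p ^ Suc k) * of_nat p dvd (a - b) * (\<Sum>i<p. b ^ (p - Suc i) * a ^ i)"
    using assms by (intro mult_dvd_mono)
  then show ?thesis by (simp add: power_diff_sumr2 mult.commute)
qed

lemma prime_power_dvd_power_diff:
  fixes a b :: "'a::comm_ring_1"
  assumes "of_nat p dvd a - b"
  shows "of_nat (p ^ Suc m) dvd a ^ (p ^ m) - b ^ (p ^ m)"
proof (induction m)
  case (Suc m)
  then have "of_nat (p ^ Suc (Suc m)) dvd (a ^ (p ^ m)) ^ p - (b ^ (p ^ m)) ^ p"
    by (rule power_dvd_power_diff)
  then show ?case by (simp add: mult.commute flip: power_mult)
qed (use assms in simp)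

lemma freshman_dvd_iterated:
  fixes a b :: "'a::comm_ring_1"
  assumes "prime p"
  shows "of_nat p dvd (a + b) ^ (p ^ m) - (a ^ (p ^ m) + b ^ (p ^ m))"
proof (induction m)
  case (Suc m)
  define A B where "A = a ^ (p ^ m)" and "B = b ^ (p ^ m)"
  have "of_nat p dvd ((a + b) ^ (p ^ m)) ^ p - (A + B) ^ p"
    using Suc power_dvd_power_diff[of p 0 "(a + b) ^ (p ^ m)" "A + B"]
      prime_power_dvd_power_diff[of p "(a + b) ^ (p ^ m)" "A + B" 1]
    unfolding A_def B_def by (metis dvd_mult_left of_nat_mult power_Suc power_one_right)
  moreover have "of_nat p dvd (A + B) ^ p - (A ^ p + B ^ p)"
    by (rule freshman_dvd[OF assms])
  ultimately have "of_nat p dvd ((a + b) ^ (p ^ m)) ^ p - (A + B) ^ p + ((A + B) ^ p - (A ^ p + B ^ p))"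
    by (rule dvd_add)
  moreover have "((a + b) ^ (p ^ m)) ^ p - (A + B) ^ p + ((A + B) ^ p - (A ^ p + B ^ p)) =
      ((a + b) ^ (p ^ m)) ^ p - (A ^ p + B ^ p)" by simp
  ultimately have "of_nat p dvd ((a + b) ^ (p ^ m)) ^ p - (A ^ p + B ^ p)" by (simp only:)
  then show ?case unfolding A_def B_def by (simp only: power_Suc2 flip: power_mult)
qed simp


section \<open>Ghost components\<close>

text \<open>
  The ghost polynomials evaluated in an arbitrary commutative ring; \<^const>\<open>ghost\<close> is the instance
  at integer polynomials.
\<close>

definition gh :: "nat \<Rightarrow> (nat \<Rightarrow> 'a::comm_ring_1) \<Rightarrow> nat \<Rightarrow> 'a" where
  "gh p Z m = (\<Sum>i\<le>m. of_nat (p ^ i) * Z i ^ (p ^ (m - i)))"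

lemma gh_split: "gh p Z m = (\<Sum>i<m. of_nat (p ^ i) * Z i ^ (p ^ (m - i))) + of_nat (p ^ m) * Z m"
  by (simp add: gh_def lessThan_Suc_atMost[symmetric])

text \<open>
  The congruence behind the independence of the lifts: entries that agree modulo \<open>p\<close> give ghost
  components that agree modulo \<open>p ^ Suc m\<close>.
\<close>

lemma gh_cong:
  assumes "\<And>i. i \<le> m \<Longrightarrow> of_nat p dvd a i - b i"
  shows "of_nat (p ^ Suc m) dvd gh p a m - gh p b m"
proof -
  have "of_nat (p ^ Suc m) dvd of_nat (p ^ i) * (a i ^ (p ^ (m - i)) - b i ^ (p ^ (m - i)))"
    if "i \<le> m" for i
  proof -
    have "of_nat (p ^ i) * of_nat (p ^ Suc (m - i)) dvd
        of_nat (p ^ i) * (a i ^ (p ^ (m - i)) - b i ^ (p ^ (m - i)))"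
      by (intro mult_dvd_mono prime_power_dvd_power_diff assms that) simp
    moreover have "p ^ i * p ^ Suc (m - i) = p ^ Suc m"
      using that by (simp flip: power_add)
    ultimately show ?thesis by (metis of_nat_mult)
  qed
  then have "of_nat (p ^ Suc m) dvd (\<Sum>i\<le>m. of_nat (p ^ i) * (a i ^ (p ^ (m - i)) - b i ^ (p ^ (m - i))))"
    by (intro dvd_sum) auto
  then show ?thesis by (simp add: gh_def right_diff_distrib sum_subtractf)
qed

lemma gh_Suc:
  "gh p Z (Suc m) = gh p (\<lambda>i. Z i ^ p) m + of_nat (p ^ Suc m) * Z (Suc m)"
proof -
  have "of_nat (p ^ i) * Z i ^ (p ^ (Suc m - i)) = of_nat (p ^ i) * (Z i ^ p) ^ (p ^ (m - i))"
    if "i \<le> m" for i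
    using that by (simp add: Suc_diff_le flip: power_mult)
  then show ?thesis unfolding gh_def by simp
qed

text \<open>
  Prepending \<open>0\<close> and raising the entries to the \<open>p\<close>-th power (Verschiebung after Frobenius)
  multiplies the ghost components by \<open>p\<close>, up to a multiple of \<open>p ^ Suc m\<close>.
\<close>

lemma gh_shift_power:
  fixes Z :: "nat \<Rightarrow> 'a::comm_ring_1"
  assumes "p > 0"
  shows "gh p (\<lambda>i. case i of 0 \<Rightarrow> 0 | Suc j \<Rightarrow> Z j ^ p) m = of_nat p * gh p Z m - of_nat (p ^ Suc m) * Z m"
    (is "gh p ?V m = _")
proof -
  show ?thesis
  proof (cases m)
    case 0
    then show ?thesis by (simp add: gh_def)
  next
    case (Suc k)
    have "gh p ?V m = of_nat (p ^ 0) * ?V 0 ^ (p ^ m) +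
        (\<Sum>i\<le>k. of_nat (p ^ Suc i) * ?V (Suc i) ^ (p ^ (m - Suc i)))"
      unfolding gh_def Suc by (subst sum.atMost_Suc_shift) simp
    also have "\<dots> = (\<Sum>i\<le>k. of_nat (p ^ Suc i) * (Z i ^ p) ^ (p ^ (k - i)))"
      using assms Suc by (simp add: zero_power)
    also have "\<dots> = of_nat p * gh p (\<lambda>i. Z i ^ p) k"
      by (simp add: gh_def sum_distrib_left mult.assoc)
    also have "\<dots> = of_nat p * gh p Z m - of_nat (p ^ Suc m) * Z m"
      using gh_Suc[of p Z k] Suc by (simp add: algebra_simps)
    finally show ?thesis .
  qed
qed


section \<open>Integer polynomials and their evaluation\<close>

text \<open>
  Integer polynomials in variables of an arbitrary type, so that any number of Witt vectors can be
  given independent variables.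
\<close>

type_synonym 'v ipoly = "('v \<Rightarrow>\<^sub>0 nat) \<Rightarrow>\<^sub>0 int"

definition Var :: "'v \<Rightarrow> 'v ipoly" where
  "Var v = Poly_Mapping.single (Poly_Mapping.single v 1) 1"

lemma of_nat_mult_ipoly:
  fixes f :: "'v ipoly"
  shows "of_nat k * f = frag_cmul (int k) f"
proof -
  have "of_nat k * f = Poly_Mapping.single 0 (int k) * f"
    by (metis single_of_nat)
  also have "\<dots> = Poly_Mapping.map ((*) (int k)) f"
    by (simp add: mult_map_scale_conv_mult)
  also have "\<dots> = frag_cmul (int k) f"
    by (intro poly_mapping_eqI) (simp add: Poly_Mapping.map.rep_eq when_def)
  finally show ?thesis .
qed

lemma ipoly_torsion_free:
  fixes f :: "'v ipoly"
  assumes "of_nat k * f = 0" "k > 0"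
  shows "f = 0"
  using assms by (simp add: of_nat_mult_ipoly)

lemma ipoly_dvd_cancel:
  fixes f :: "'v ipoly"
  assumes "of_nat (k * l) dvd of_nat k * f" "k > 0"
  shows "of_nat l dvd f"
proof -
  obtain g where "of_nat k * f = of_nat (k * l) * g" using assms(1) by blast
  then have "of_nat k * (f - of_nat l * g) = 0"
    by (simp add: algebra_simps)
  then have "f - of_nat l * g = 0"
    using assms(2) ipoly_torsion_free by blast
  then show ?thesis by simp
qed

text \<open>
  The converse of the congruence above, for all ghost components at once and over a ring without
  \<open>p\<close>-torsion.
\<close>

lemma gh_cong_conv:
  fixes a b :: "nat \<Rightarrow> 'v ipoly"
  assumes "p > 0" "\<And>m. of_nat (p ^ Suc m) dvd gh p a m - gh p b m"
  shows "of_nat p dvd a m - b m"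
proof (induction m rule: less_induct)
  case (less m)
  have "of_nat (p ^ Suc m) dvd gh p (\<lambda>i. if i = m then 0 else a i) m - gh p (\<lambda>i. if i = m then 0 else b i) m"
    using less by (intro gh_cong) auto
  moreover have "gh p a m - gh p b m = of_nat (p ^ m) * (a m - b m) +
      (gh p (\<lambda>i. if i = m then 0 else a i) m - gh p (\<lambda>i. if i = m then 0 else b i) m)"
    by (simp add: gh_split algebra_simps)
  ultimately have "of_nat (p ^ Suc m) dvd of_nat (p ^ m) * (a m - b m)"
    using assms(2)[of m] by (simp only: dvd_add_left_iff)
  then have "of_nat (p ^ m * p) dvd of_nat (p ^ m) * (a m - b m)"
    by (simp add: mult.commute)
  then show ?case using assms(1) ipoly_dvd_cancel by (metis zero_less_power)
qed

lemma gh_inj: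
  fixes a b :: "nat \<Rightarrow> 'v ipoly"
  assumes "p > 0" "\<And>m. gh p a m = gh p b m"
  shows "a = b"
proof
  fix m show "a m = b m"
  proof (induction m rule: less_induct)
    case (less m)
    have "(\<Sum>i<m. of_nat (p ^ i) * a i ^ (p ^ (m - i))) = (\<Sum>i<m. of_nat (p ^ i) * b i ^ (p ^ (m - i)))"
      using less by simp
    then have "of_nat (p ^ m) * (a m - b m) = 0"
      using assms(2)[of m] by (simp add: gh_split algebra_simps)
    then show ?case using assms(1) ipoly_torsion_free[of "p ^ m" "a m - b m"] by simp
  qed
qed

lemma ipoly_induct [case_names zero monom diff]:
  assumes "P 0" "\<And>e. P (frag_of e)" "\<And>a b. P a \<Longrightarrow> P b \<Longrightarrow> P (a - b)"
  shows "P (c :: 'v ipoly)"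
  using assms by (rule frag_induction[OF subset_UNIV])

text \<open>
  A commutative ring given by a type, as a ring with carrier.  A homomorphism from it turns
  identities between integer polynomials into identities in a ring with carrier.
\<close>

definition tcring :: "'a::comm_ring_1 ring" where
  "tcring = \<lparr>carrier = UNIV, mult = (*), one = 1, zero = 0, add = (+)\<rparr>"

lemma tcring_simps [simp]:
  "carrier tcring = UNIV" "x \<otimes>\<^bsub>tcring\<^esub> y = x * y" "\<one>\<^bsub>tcring\<^esub> = 1" "\<zero>\<^bsub>tcring\<^esub> = 0" "x \<oplus>\<^bsub>tcring\<^esub> y = x + y"
  by (simp_all add: tcring_def)

lemma cring_tcring: "cring (tcring :: 'a::comm_ring_1 ring)"
proof (rule cringI)
  show "abelian_group (tcring :: 'a ring)"
    by (rule abelian_groupI) (auto simp: algebra_simps intro: exI[of _ "- _"])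
  show "Group.comm_monoid (tcring :: 'a ring)"
    by (rule comm_monoidI) (auto simp: algebra_simps)
qed (auto simp: algebra_simps)

interpretation tc: cring tcring
  by (rule cring_tcring)

lemma minus_tcring [simp]: "x \<ominus>\<^bsub>tcring\<^esub> y = x - y"
  by (metis UNIV_I add_diff_cancel_right' tc.a_inv_closed tc.add.inv_solve_right tc.minus_closed a_minus_def tcring_simps(1,5))

lemma power_tcring [simp]: "x [^]\<^bsub>tcring\<^esub> (k::nat) = x ^ k"
  by (induction k) (simp_all add: mult.commute)

lemma finprod_tcring [simp]: "finprod tcring f A = prod f A"
  by (induction A rule: infinite_finite_induct) simp_all

lemma finsum_tcring [simp]: "finsum tcring f A = sum f A"
  by (induction A rule: infinite_finite_induct) simp_all

text \<open>
  Homomorphisms from a ring given by a type to a ring with carrier.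
\<close>

locale tc_hom = cring R for R (structure) +
  fixes h :: "'t::comm_ring_1 \<Rightarrow> 'a"
  assumes hom: "h \<in> ring_hom tcring R"
begin

sublocale rh: ring_hom_cring tcring R h
  by unfold_locales (rule hom)

lemma h_closed [simp]: "h x \<in> carrier R" using rh.hom_closed by simp
lemma h_add: "h (x + y) = h x \<oplus> h y" using rh.hom_add[of x y] by simp
lemma h_mult: "h (x * y) = h x \<otimes> h y" using rh.hom_mult[of x y] by simp
lemma h_one: "h 1 = \<one>" using rh.hom_one by simp
lemma h_zero: "h 0 = \<zero>" using rh.hom_zero by simp

lemma h_diff: "h (x - y) = h x \<ominus> h y"
proof -
  have "h (x - y) \<oplus> h y = h x" by (simp flip: h_add)
  then show ?thesis
    by (metis a_assoc a_closed a_inv_closed a_minus_def h_closed r_neg r_zero)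
qed

lemma h_of_nat_mult: "h (of_nat k * x) = [k] \<cdot> h x"
  by (induction k) (simp_all add: h_zero h_add distrib_right a_comm)

lemma h_power: "h (x ^ k) = h x [^] k"
  by (induction k) (simp_all add: h_one h_mult m_comm)

lemma h_sum: "h (\<Sum>i\<in>A. f i) = (\<Oplus>i\<in>A. h (f i))"
  by (induction A rule: infinite_finite_induct) (simp_all add: h_zero h_add)

lemma h_prod: "h (\<Prod>i\<in>A. f i) = (\<Otimes>i\<in>A. h (f i))"
  by (induction A rule: infinite_finite_induct) (simp_all add: h_one h_mult)

end

text \<open>
  The values at \<open>x\<close> of a monomial and of an integer polynomial; the constant \<^const>\<open>eval_int_mpoly\<close> is the
  case of variables of a sum type.
\<close>

definition mon_eval :: "('a, 'm) ring_scheme \<Rightarrow> ('v \<Rightarrow> 'a) \<Rightarrow> ('v \<Rightarrow>\<^sub>0 nat) \<Rightarrow> 'a" where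
  "mon_eval R x e = (\<Otimes>\<^bsub>R\<^esub>v \<in> Poly_Mapping.keys e. x v [^]\<^bsub>R\<^esub> Poly_Mapping.lookup e v)"

definition ipoly_eval :: "('a, 'm) ring_scheme \<Rightarrow> ('v \<Rightarrow> 'a) \<Rightarrow> 'v ipoly \<Rightarrow> 'a" where
  "ipoly_eval R x P = (\<Oplus>\<^bsub>R\<^esub>e \<in> Poly_Mapping.keys P. [Poly_Mapping.lookup P e] \<cdot>\<^bsub>R\<^esub> mon_eval R x e)"

lemma eval_int_mpoly_eq: "eval_int_mpoly R x y = ipoly_eval R (case_sum x y)"
  by (simp add: fun_eq_iff eval_int_mpoly_def ipoly_eval_def mon_eval_def)

context cring
begin

lemma add_pow_int_closed [simp]: "x \<in> carrier R \<Longrightarrow> [(k::int)] \<cdot> x \<in> carrier R"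
  by (simp add: add_pow_def group.int_pow_closed[OF a_group, simplified])

lemma add_pow_int_add: "x \<in> carrier R \<Longrightarrow> [(k + l::int)] \<cdot> x = [k] \<cdot> x \<oplus> [l] \<cdot> x"
  using group.int_pow_mult[OF a_group, of x k l] by (simp add: add_pow_def)

lemma add_pow_int_0 [simp]: "[(0::int)] \<cdot> x = \<zero>"
  by (simp add: add_pow_def)

lemma add_pow_int_1 [simp]: "x \<in> carrier R \<Longrightarrow> [(1::int)] \<cdot> x = x"
  using group.int_pow_1[OF a_group, of x] by (simp add: add_pow_def)

lemma mon_eval_closed [simp]: "x \<in> UNIV \<rightarrow> carrier R \<Longrightarrow> mon_eval R x e \<in> carrier R"
  by (auto simp: mon_eval_def intro!: finprod_closed)

lemma mon_eval_superset:
  assumes "x \<in> UNIV \<rightarrow> carrier R" "finite V" "Poly_Mapping.keys e \<subseteq> V"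
  shows "mon_eval R x e = (\<Otimes>v\<in>V. x v [^] Poly_Mapping.lookup e v)"
  unfolding mon_eval_def using assms
  by (intro finprod_mono_neutral_cong_left) (auto simp: in_keys_iff)

lemma mon_eval_add:
  assumes "x \<in> UNIV \<rightarrow> carrier R"
  shows "mon_eval R x (d + e) = mon_eval R x d \<otimes> mon_eval R x e"
proof -
  let ?V = "Poly_Mapping.keys d \<union> Poly_Mapping.keys e"
  have "mon_eval R x (d + e) = (\<Otimes>v\<in>?V. x v [^] Poly_Mapping.lookup d v \<otimes> x v [^] Poly_Mapping.lookup e v)"
    using assms keys_add[of d e]
    by (subst mon_eval_superset[where V = ?V])
      (auto simp: lookup_add nat_pow_mult Pi_iff intro!: finprod_cong')
  also have "\<dots> = mon_eval R x d \<otimes> mon_eval R x e"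
    using assms by (simp add: mon_eval_superset[where V = ?V] Pi_iff)
  finally show ?thesis .
qed

lemma mon_eval_0 [simp]: "mon_eval R x 0 = \<one>"
  by (simp add: mon_eval_def)

lemma mon_eval_single:
  "x \<in> UNIV \<rightarrow> carrier R \<Longrightarrow> mon_eval R x (Poly_Mapping.single v k) = x v [^] k"
  by (cases "k = 0") (auto simp: mon_eval_def Pi_iff)

lemma ipoly_eval_closed [simp]: "x \<in> UNIV \<rightarrow> carrier R \<Longrightarrow> ipoly_eval R x P \<in> carrier R"
  by (auto simp: ipoly_eval_def)

lemma ipoly_eval_superset:
  assumes "x \<in> UNIV \<rightarrow> carrier R" "finite E" "Poly_Mapping.keys P \<subseteq> E"
  shows "ipoly_eval R x P = (\<Oplus>e\<in>E. [Poly_Mapping.lookup P e] \<cdot> mon_eval R x e)"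
  unfolding ipoly_eval_def using assms
  by (intro add.finprod_mono_neutral_cong_left) (auto simp: in_keys_iff)

lemma ipoly_eval_add:
  assumes "x \<in> UNIV \<rightarrow> carrier R"
  shows "ipoly_eval R x (P + Q) = ipoly_eval R x P \<oplus> ipoly_eval R x Q"
proof -
  let ?E = "Poly_Mapping.keys P \<union> Poly_Mapping.keys Q"
  have "ipoly_eval R x (P + Q) =
      (\<Oplus>e\<in>?E. [Poly_Mapping.lookup P e] \<cdot> mon_eval R x e \<oplus> [Poly_Mapping.lookup Q e] \<cdot> mon_eval R x e)"
    using assms keys_add[of P Q]
    by (subst ipoly_eval_superset[where E = ?E])
      (auto simp: lookup_add add_pow_int_add Pi_iff intro!: finsum_cong')
  also have "\<dots> = ipoly_eval R x P \<oplus> ipoly_eval R x Q"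
    using assms by (simp add: ipoly_eval_superset[where E = ?E] finsum_addf Pi_iff)
  finally show ?thesis .
qed

lemma ipoly_eval_0 [simp]: "ipoly_eval R x 0 = \<zero>"
  by (simp add: ipoly_eval_def)

lemma ipoly_eval_diff:
  assumes "x \<in> UNIV \<rightarrow> carrier R"
  shows "ipoly_eval R x (P - Q) = ipoly_eval R x P \<ominus> ipoly_eval R x Q"
proof -
  have "ipoly_eval R x (P - Q) \<oplus> ipoly_eval R x Q = ipoly_eval R x P"
    using assms by (simp flip: ipoly_eval_add)
  then show ?thesis using assms
    by (metis a_assoc a_closed a_inv_closed a_minus_def ipoly_eval_closed r_neg r_zero)
qed

lemma ipoly_eval_frag_of:
  assumes "x \<in> UNIV \<rightarrow> carrier R"
  shows "ipoly_eval R x (frag_of e) = mon_eval R x e"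
  using assms by (simp add: ipoly_eval_def)

lemma frag_of_mult: "frag_of d * frag_of e = (frag_of (d + e) :: 'v ipoly)"
  by (simp add: mult_single)

lemma ipoly_eval_mult:
  assumes x: "x \<in> UNIV \<rightarrow> carrier R"
  shows "ipoly_eval R x (P * Q) = ipoly_eval R x P \<otimes> ipoly_eval R x Q"
proof -
  have mon: "ipoly_eval R x (frag_of d * Q) = mon_eval R x d \<otimes> ipoly_eval R x Q" for d
  proof (induction Q rule: ipoly_induct)
    case zero
    then show ?case using x by simp
  next
    case (monom e)
    then show ?case using x by (simp add: frag_of_mult ipoly_eval_frag_of mon_eval_add del: mult_single)
  next
    case (diff a b)
    then show ?case using x
      by (simp add: right_diff_distrib ipoly_eval_diff a_minus_def r_distr r_minus)
  qed
  show ?thesis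
  proof (induction P rule: ipoly_induct)
    case zero
    then show ?case using x by simp
  next
    case (monom e)
    then show ?case using x by (simp add: mon ipoly_eval_frag_of)
  next
    case (diff a b)
    then show ?case using x
      by (simp add: left_diff_distrib ipoly_eval_diff a_minus_def l_distr l_minus)
  qed
qed

lemma ipoly_eval_1:
  assumes "x \<in> UNIV \<rightarrow> carrier R"
  shows "ipoly_eval R x 1 = \<one>"
  using ipoly_eval_frag_of[OF assms, of 0] by simp

lemma ipoly_eval_hom:
  assumes "x \<in> UNIV \<rightarrow> carrier R"
  shows "ipoly_eval R x \<in> ring_hom tcring R"
  using assms by (intro ring_hom_memI) (auto simp: ipoly_eval_add ipoly_eval_mult ipoly_eval_1)

lemma tc_hom_ipoly_eval: "x \<in> UNIV \<rightarrow> carrier R \<Longrightarrow> tc_hom R (ipoly_eval R x)"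
  by (intro tc_hom.intro tc_hom_axioms.intro ipoly_eval_hom) unfold_locales

lemma ipoly_eval_Var:
  "x \<in> UNIV \<rightarrow> carrier R \<Longrightarrow> ipoly_eval R x (Var v) = x v"
  using ipoly_eval_frag_of[of x "Poly_Mapping.single v 1"]
  by (auto simp: Var_def mon_eval_single Pi_iff)

end

lemma (in tc_hom) h_ipoly_eval:
  "h (ipoly_eval tcring a P) = ipoly_eval R (\<lambda>v. h (a v)) P"
proof (induction P rule: ipoly_induct)
  case zero
  then show ?case by (simp add: h_zero)
next
  case (monom e)
  have "h (mon_eval tcring a e) = mon_eval R (\<lambda>v. h (a v)) e"
    by (simp add: mon_eval_def h_prod h_power)
  then show ?case by (simp add: ipoly_eval_frag_of tc.ipoly_eval_frag_of Pi_iff)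
next
  case (diff P Q)
  then show ?case
    by (simp add: ipoly_eval_diff h_diff tc.ipoly_eval_diff Pi_iff)
qed


section \<open>Dwork's lemma\<close>

text \<open>The lift of Frobenius to integer polynomials that sends each variable to its \<open>p\<close>-th power.\<close>

definition frob_lift :: "nat \<Rightarrow> 'v ipoly \<Rightarrow> 'v ipoly" where
  "frob_lift p = ipoly_eval tcring (\<lambda>v. Var v ^ p)"

interpretation frob: tc_hom tcring "frob_lift p"
  unfolding frob_lift_def by (rule tc.tc_hom_ipoly_eval) simp

lemma single_prod_power:
  "finite V \<Longrightarrow> (\<Prod>v\<in>V. Var v ^ f v) = (frag_of (\<Sum>v\<in>V. Poly_Mapping.single v (f v)) :: 'v ipoly)"
proof (induction V rule: finite_induct)
  case (insert v V)
  have "Var v ^ k = (frag_of (Poly_Mapping.single v k) :: 'v ipoly)" for k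
    by (induction k) (simp_all add: Var_def mult_single flip: single_add)
  with insert show ?case by (simp add: mult_single)
qed simp

lemma poly_mapping_sum_single:
  fixes e :: "'v \<Rightarrow>\<^sub>0 nat"
  shows "(\<Sum>v\<in>Poly_Mapping.keys e. Poly_Mapping.single v (Poly_Mapping.lookup e v)) = e"
  by (intro poly_mapping_eqI) (auto simp: lookup_sum lookup_single when_def in_keys_iff)

lemma prod_Var_power:
  "(\<Prod>v\<in>Poly_Mapping.keys e. Var v ^ Poly_Mapping.lookup e v) = (frag_of e :: 'v ipoly)"
  by (simp add: single_prod_power poly_mapping_sum_single)

lemma frob_lift_cong:
  fixes f :: "'v ipoly"
  assumes "prime p"
  shows "of_nat p dvd f ^ p - frob_lift p f"
proof (induction f rule: ipoly_induct)
  case zero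
  then show ?case using prime_gt_0_nat[OF assms] by (simp add: frob.h_zero zero_power)
next
  case (monom e)
  have "frob_lift p (frag_of e) = (\<Prod>v\<in>Poly_Mapping.keys e. (Var v ^ p) ^ Poly_Mapping.lookup e v)"
    by (simp add: frob_lift_def tc.ipoly_eval_frag_of mon_eval_def)
  also have "\<dots> = (\<Prod>v\<in>Poly_Mapping.keys e. Var v ^ Poly_Mapping.lookup e v) ^ p"
    by (simp add: prod_power_distrib mult.commute flip: power_mult)
  finally show ?case by (simp add: prod_Var_power)
next
  case (diff a b)
  have "of_nat p dvd (a - b + b) ^ p - ((a - b) ^ p + b ^ p)"
    by (rule freshman_dvd[OF assms])
  then have "of_nat p dvd (a ^ p - frob_lift p a) - (b ^ p - frob_lift p b) - (a ^ p - ((a - b) ^ p + b ^ p))"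
    using diff by (intro dvd_diff[OF dvd_diff]) simp_all
  then show ?case by (simp add: frob.h_diff algebra_simps)
qed

lemma frob_lift_gh:
  fixes Z :: "nat \<Rightarrow> 'v ipoly"
  shows "frob_lift p (gh q Z m) = gh q (\<lambda>i. frob_lift p (Z i)) m"
proof -
  have "frob_lift p (of_nat k * x) = of_nat k * frob_lift p x" for k and x :: "'v ipoly"
    by (induction k) (simp_all add: distrib_right frob.h_add frob.h_zero)
  then show ?thesis by (simp add: gh_def frob.h_sum frob.h_power del: of_nat_power)
qed

text \<open>
  The congruences that characterize the sequences of ghost components of integer polynomials.
\<close>

definition dwork :: "nat \<Rightarrow> (nat \<Rightarrow> 'v ipoly) \<Rightarrow> bool" where
  "dwork p w \<longleftrightarrow> (\<forall>m. of_nat (p ^ Suc m) dvd w (Suc m) - frob_lift p (w m))"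

lemma dwork_gh:
  assumes "prime p"
  shows "dwork p (gh p Z)"
  unfolding dwork_def
proof
  fix m
  have "of_nat (p ^ Suc m) dvd gh p (\<lambda>i. Z i ^ p) m - gh p (\<lambda>i. frob_lift p (Z i)) m"
    by (intro gh_cong frob_lift_cong assms)
  then have "of_nat (p ^ Suc m) dvd
      gh p (\<lambda>i. Z i ^ p) m - gh p (\<lambda>i. frob_lift p (Z i)) m + of_nat (p ^ Suc m) * Z (Suc m)"
    by (rule dvd_add) (rule dvd_triv_left)
  then show "of_nat (p ^ Suc m) dvd gh p Z (Suc m) - frob_lift p (gh p Z m)"
    unfolding gh_Suc frob_lift_gh by (simp only: add_diff_eq diff_add_eq)
qed

lemma dwork_add: "dwork p v \<Longrightarrow> dwork p w \<Longrightarrow> dwork p (\<lambda>m. v m + w m)"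
  unfolding dwork_def
proof
  fix m
  assume "\<forall>m. of_nat (p ^ Suc m) dvd v (Suc m) - frob_lift p (v m)"
    "\<forall>m. of_nat (p ^ Suc m) dvd w (Suc m) - frob_lift p (w m)"
  then have "of_nat (p ^ Suc m) dvd (v (Suc m) - frob_lift p (v m)) + (w (Suc m) - frob_lift p (w m))"
    by (intro dvd_add) auto
  then show "of_nat (p ^ Suc m) dvd v (Suc m) + w (Suc m) - frob_lift p (v m + w m)"
    by (simp add: frob.h_add algebra_simps)
qed

lemma dwork_mult: "dwork p v \<Longrightarrow> dwork p w \<Longrightarrow> dwork p (\<lambda>m. v m * w m)"
  unfolding dwork_def
proof
  fix m
  assume "\<forall>m. of_nat (p ^ Suc m) dvd v (Suc m) - frob_lift p (v m)"
    "\<forall>m. of_nat (p ^ Suc m) dvd w (Suc m) - frob_lift p (w m)"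
  then have "of_nat (p ^ Suc m) dvd (v (Suc m) - frob_lift p (v m)) * w (Suc m) +
      frob_lift p (v m) * (w (Suc m) - frob_lift p (w m))"
    by (intro dvd_add dvd_mult dvd_mult2) auto
  then show "of_nat (p ^ Suc m) dvd v (Suc m) * w (Suc m) - frob_lift p (v m * w m)"
    by (simp add: frob.h_mult algebra_simps)
qed

lemma dwork_uminus: "dwork p v \<Longrightarrow> dwork p (\<lambda>m. - v m)"
  unfolding dwork_def
proof
  fix m
  assume "\<forall>m. of_nat (p ^ Suc m) dvd v (Suc m) - frob_lift p (v m)"
  then have "of_nat (p ^ Suc m) dvd - (v (Suc m) - frob_lift p (v m))"
    by (simp only: dvd_minus_iff)
  then show "of_nat (p ^ Suc m) dvd - v (Suc m) - frob_lift p (- v m)"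
    using frob.h_diff[of p 0 "v m"] by (simp add: frob.h_zero)
qed

text \<open>The only possible sequence with given ghost components, solved for one entry at a time.\<close>

fun unghost :: "nat \<Rightarrow> (nat \<Rightarrow> 'v ipoly) \<Rightarrow> nat \<Rightarrow> 'v ipoly" where
  "unghost p w m = (SOME z. of_nat (p ^ m) * z =
     w m - (\<Sum>i\<in>{..<m}. of_nat (p ^ i) * unghost p w i ^ (p ^ (m - i))))"

declare unghost.simps [simp del]

text \<open>
  The nontrivial half of Dwork's lemma: the congruences make the division by \<open>p ^ m\<close> possible at
  each step.
\<close>

lemma gh_unghost:
  assumes p: "prime p" and w: "dwork p w"
  shows "gh p (unghost p w) m = w m"
proof (induction m)
  case 0
  have "unghost p w 0 = (SOME z. z = w 0)"
    by (subst unghost.simps) simp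
  then show ?case by (simp add: gh_def)
next
  case (Suc m)
  let ?Z = "unghost p w"
  define s where "s = (\<Sum>i\<in>{..<Suc m}. of_nat (p ^ i) * ?Z i ^ (p ^ (Suc m - i)))"
  have s: "s = gh p (\<lambda>i. ?Z i ^ p) m"
    using gh_Suc[of p ?Z m] unfolding gh_split[of p ?Z "Suc m"] s_def by simp
  have "of_nat (p ^ Suc m) dvd s - gh p (\<lambda>i. frob_lift p (?Z i)) m"
    unfolding s by (intro gh_cong frob_lift_cong p)
  moreover have "gh p (\<lambda>i. frob_lift p (?Z i)) m = frob_lift p (w m)"
    by (simp add: Suc flip: frob_lift_gh)
  moreover have "of_nat (p ^ Suc m) dvd w (Suc m) - frob_lift p (w m)"
    using w unfolding dwork_def by blast
  ultimately have "of_nat (p ^ Suc m) dvd (w (Suc m) - frob_lift p (w m)) - (s - frob_lift p (w m))"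
    using dvd_diff by metis
  then have "of_nat (p ^ Suc m) dvd w (Suc m) - s" by simp
  then obtain z where "w (Suc m) - s = of_nat (p ^ Suc m) * z" by (elim dvdE)
  then have "\<exists>z. of_nat (p ^ Suc m) * z = w (Suc m) - s" by metis
  then have "of_nat (p ^ Suc m) * ?Z (Suc m) = w (Suc m) - s"
    by (subst unghost.simps) (unfold s_def, rule someI_ex)
  then show ?case by (simp add: gh_split[of p ?Z "Suc m"] s_def)
qed


section \<open>The Witt polynomials\<close>

lemma ghost_eq_gh: "ghost p Z m = gh p Z m"
  by (simp add: ghost_def gh_def)

lemma X_var_eq: "X_var i = Var (Inl i)" and Y_var_eq: "Y_var i = Var (Inr i)"
  by (simp_all add: X_var_def Y_var_def Var_def)

lemma the_unghost:
  assumes "prime p" "dwork p w"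
  shows "gh p (THE S. \<forall>m. gh p S m = w m) = w"
proof -
  have "\<exists>!S. \<forall>m. gh p S m = w m"
  proof (rule ex1I)
    show "\<forall>m. gh p (unghost p w) m = w m" using gh_unghost[OF assms] by blast
    show "S = unghost p w" if "\<forall>m. gh p S m = w m" for S
      using that gh_unghost[OF assms] prime_gt_0_nat[OF assms(1)] by (intro gh_inj) auto
  qed
  from theI'[OF this] show ?thesis by blast
qed

lemma gh_witt_sum_poly:
  assumes "prime p"
  shows "gh p (witt_sum_poly p) m = gh p X_var m + gh p Y_var m"
  unfolding witt_sum_poly_def ghost_eq_gh
  by (rule fun_cong[OF the_unghost[OF assms dwork_add[OF dwork_gh[OF assms] dwork_gh[OF assms]]]])

lemma gh_witt_prod_poly:
  assumes "prime p"
  shows "gh p (witt_prod_poly p) m = gh p X_var m * gh p Y_var m"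
  unfolding witt_prod_poly_def ghost_eq_gh
  by (rule fun_cong[OF the_unghost[OF assms dwork_mult[OF dwork_gh[OF assms] dwork_gh[OF assms]]]])

text \<open>
  Polynomials that involve only the variables in \<open>V\<close>.  Entries of a Witt vector of length \<open>n + 1\<close>
  with index above \<open>n\<close> are unspecified, so it matters that the \<open>m\<close>-th Witt polynomials involve only
  variables with index at most \<open>m\<close>.
\<close>

definition ipoly_over :: "'v set \<Rightarrow> 'v ipoly set" where
  "ipoly_over V = {P. \<forall>e\<in>Poly_Mapping.keys P. Poly_Mapping.keys e \<subseteq> V}"

lemma ipoly_over_add: "P \<in> ipoly_over V \<Longrightarrow> Q \<in> ipoly_over V \<Longrightarrow> P + Q \<in> ipoly_over V"
  using keys_add[of P Q] unfolding ipoly_over_def by blast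

lemma ipoly_over_diff: "P \<in> ipoly_over V \<Longrightarrow> Q \<in> ipoly_over V \<Longrightarrow> P - Q \<in> ipoly_over V"
  using keys_diff[of P Q] unfolding ipoly_over_def by blast

lemma ipoly_over_mult:
  fixes P Q :: "'a ipoly"
  shows "P \<in> ipoly_over V \<Longrightarrow> Q \<in> ipoly_over V \<Longrightarrow> P * Q \<in> ipoly_over V"
  unfolding ipoly_over_def
proof (clarify)
  fix e v
  assume P: "\<forall>e\<in>Poly_Mapping.keys P. Poly_Mapping.keys e \<subseteq> V"
    and Q: "\<forall>e\<in>Poly_Mapping.keys Q. Poly_Mapping.keys e \<subseteq> V"
    and e: "e \<in> Poly_Mapping.keys (P * Q)" and v: "v \<in> Poly_Mapping.keys e"
  from e obtain a b where "e = a + b" "a \<in> Poly_Mapping.keys P" "b \<in> Poly_Mapping.keys Q"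
    using keys_mult[of P Q] by blast
  with P Q v keys_add[of a b] show "v \<in> V" by blast
qed

lemma ipoly_over_1: "1 \<in> ipoly_over V"
  by (simp add: ipoly_over_def)

lemma ipoly_over_power: "P \<in> ipoly_over V \<Longrightarrow> P ^ k \<in> ipoly_over V"
  by (induction k) (simp_all add: ipoly_over_1 ipoly_over_mult)

lemma ipoly_over_sum: "(\<And>i. i \<in> A \<Longrightarrow> f i \<in> ipoly_over V) \<Longrightarrow> sum f A \<in> ipoly_over V"
  by (induction A rule: infinite_finite_induct) (auto simp: ipoly_over_add, simp_all add: ipoly_over_def)

lemma ipoly_over_of_nat_mult: "k > 0 \<Longrightarrow> of_nat k * P \<in> ipoly_over V \<longleftrightarrow> P \<in> ipoly_over V"
  by (auto simp: ipoly_over_def of_nat_mult_ipoly)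

lemma ipoly_over_Var: "v \<in> V \<Longrightarrow> Var v \<in> ipoly_over V"
  by (simp add: ipoly_over_def Var_def)

lemma ipoly_over_mono: "P \<in> ipoly_over V \<Longrightarrow> V \<subseteq> V' \<Longrightarrow> P \<in> ipoly_over V'"
  unfolding ipoly_over_def by blast

lemma ipoly_over_gh:
  assumes "p > 0" "\<And>i. i \<le> m \<Longrightarrow> Z i \<in> ipoly_over V"
  shows "gh p Z m \<in> ipoly_over V"
  unfolding gh_def using assms by (intro ipoly_over_sum) (simp add: ipoly_over_of_nat_mult ipoly_over_power flip: of_nat_power)

lemma ipoly_over_gh_solution:
  assumes p: "p > 0" and w: "\<And>m. gh p Z m \<in> ipoly_over (V m)" and V: "\<And>i m. i \<le> m \<Longrightarrow> V i \<subseteq> V m"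
  shows "Z m \<in> ipoly_over (V m)"
proof (induction m rule: less_induct)
  case (less m)
  have "(\<Sum>i<m. of_nat (p ^ i) * Z i ^ (p ^ (m - i))) \<in> ipoly_over (V m)"
  proof (rule ipoly_over_sum)
    fix i assume "i \<in> {..<m}"
    then have "Z i \<in> ipoly_over (V m)"
      using less[of i] V[of i m] ipoly_over_mono by auto
    then show "of_nat (p ^ i) * Z i ^ (p ^ (m - i)) \<in> ipoly_over (V m)"
      using p by (simp add: ipoly_over_of_nat_mult ipoly_over_power flip: of_nat_power)
  qed
  from ipoly_over_diff[OF w[of m] this] have "of_nat (p ^ m) * Z m \<in> ipoly_over (V m)"
    by (simp add: gh_split)
  then show ?case using p by (simp add: ipoly_over_of_nat_mult flip: of_nat_power)
qed

lemma witt_polys_over: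
  assumes "prime p"
  defines "V \<equiv> (\<lambda>m. Inl ` {..m} \<union> Inr ` {..m})"
  shows "witt_sum_poly p m \<in> ipoly_over (V m)" "witt_prod_poly p m \<in> ipoly_over (V m)"
proof -
  have p: "p > 0" using assms prime_gt_0_nat by blast
  have XY: "gh p X_var m \<in> ipoly_over (V m)" "gh p Y_var m \<in> ipoly_over (V m)" for m
    by (intro ipoly_over_gh p; auto simp: X_var_eq Y_var_eq V_def intro!: ipoly_over_Var)+
  have V: "V i \<subseteq> V m" if "i \<le> m" for i m
    using that by (auto simp: V_def)
  have "gh p (witt_sum_poly p) m \<in> ipoly_over (V m)" for m
    unfolding gh_witt_sum_poly[OF assms(1)] by (intro ipoly_over_add XY)
  then show "witt_sum_poly p m \<in> ipoly_over (V m)"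
    by (rule ipoly_over_gh_solution[OF p, where V = V]) (rule V)
  have "gh p (witt_prod_poly p) m \<in> ipoly_over (V m)" for m
    unfolding gh_witt_prod_poly[OF assms(1)] by (intro ipoly_over_mult XY)
  then show "witt_prod_poly p m \<in> ipoly_over (V m)"
    by (rule ipoly_over_gh_solution[OF p, where V = V]) (rule V)
qed

lemma (in cring) ipoly_eval_cong:
  assumes "P \<in> ipoly_over V" "y \<in> UNIV \<rightarrow> carrier R" "\<And>v. v \<in> V \<Longrightarrow> x v = y v"
  shows "ipoly_eval R x P = ipoly_eval R y P"
proof -
  have "mon_eval R x e = mon_eval R y e" if "e \<in> Poly_Mapping.keys P" for e
  proof -
    have "Poly_Mapping.keys e \<subseteq> V" using that assms(1) by (auto simp: ipoly_over_def)
    then show ?thesis unfolding mon_eval_def using assms(2,3)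
      by (intro finprod_cong') (auto simp: subset_iff)
  qed
  then show ?thesis unfolding ipoly_eval_def using assms(2)
    by (intro finsum_cong') auto
qed


section \<open>The ring of Witt vectors\<close>

text \<open>The ghost polynomials in a ring with carrier.\<close>

definition rgh :: "('a, 'm) ring_scheme \<Rightarrow> nat \<Rightarrow> (nat \<Rightarrow> 'a) \<Rightarrow> nat \<Rightarrow> 'a" where
  "rgh R p Z m = (\<Oplus>\<^bsub>R\<^esub>i \<in> {..m}. [(p ^ i)] \<cdot>\<^bsub>R\<^esub> (Z i [^]\<^bsub>R\<^esub> (p ^ (m - i))))"

lemma (in tc_hom) h_gh: "h (gh p Z m) = rgh R p (\<lambda>i. h (Z i)) m"
  by (simp add: gh_def rgh_def h_sum h_of_nat_mult h_power del: of_nat_power)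

lemma add_pow_tcring [simp]: "[(k::nat)] \<cdot>\<^bsub>tcring\<^esub> x = of_nat k * x"
  by (induction k) (simp_all add: add_pow_def nat_pow_def algebra_simps)

lemma rgh_tcring [simp]: "rgh tcring p Z m = gh p Z m"
  by (simp add: gh_def rgh_def)

text \<open>Witt vector addition and multiplication on infinite sequences.\<close>

definition seq_add :: "nat \<Rightarrow> (nat \<Rightarrow> 'a::comm_ring_1) \<Rightarrow> (nat \<Rightarrow> 'a) \<Rightarrow> nat \<Rightarrow> 'a" where
  "seq_add p a b = (\<lambda>i. ipoly_eval tcring (case_sum a b) (witt_sum_poly p i))"

definition seq_mult :: "nat \<Rightarrow> (nat \<Rightarrow> 'a::comm_ring_1) \<Rightarrow> (nat \<Rightarrow> 'a) \<Rightarrow> nat \<Rightarrow> 'a" where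
  "seq_mult p a b = (\<lambda>i. ipoly_eval tcring (case_sum a b) (witt_prod_poly p i))"

text \<open>
  The unit Witt vector, as an infinite sequence.
\<close>

definition seq_one :: "nat \<Rightarrow> 'a::comm_ring_1" where
  "seq_one = (\<lambda>i. if i = 0 then 1 else 0)"

text \<open>
  The defining property of the Witt polynomials, evaluated in a commutative ring.
\<close>

lemma (in cring) rgh_witt_polys:
  assumes p: "prime p" and x: "x \<in> UNIV \<rightarrow> carrier R" and y: "y \<in> UNIV \<rightarrow> carrier R"
  defines "h \<equiv> ipoly_eval R (case_sum x y)"
  shows "rgh R p (\<lambda>i. h (witt_sum_poly p i)) m = rgh R p x m \<oplus> rgh R p y m"
    and "rgh R p (\<lambda>i. h (witt_prod_poly p i)) m = rgh R p x m \<otimes> rgh R p y m"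
proof -
  have xy: "case_sum x y \<in> UNIV \<rightarrow> carrier R" using x y by (auto simp: Pi_iff split: sum.splits)
  interpret tc_hom R h unfolding h_def by (rule tc_hom_ipoly_eval[OF xy])
  have "(\<lambda>i. h (X_var i)) = x" "(\<lambda>i. h (Y_var i)) = y"
    using xy by (simp_all add: h_def X_var_eq Y_var_eq ipoly_eval_Var)
  then have XY: "h (gh p X_var m) = rgh R p x m" "h (gh p Y_var m) = rgh R p y m"
    by (simp_all add: h_gh)
  show "rgh R p (\<lambda>i. h (witt_sum_poly p i)) m = rgh R p x m \<oplus> rgh R p y m"
    by (simp add: gh_witt_sum_poly[OF p] h_add XY flip: h_gh)
  show "rgh R p (\<lambda>i. h (witt_prod_poly p i)) m = rgh R p x m \<otimes> rgh R p y m"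
    by (simp add: gh_witt_prod_poly[OF p] h_mult XY flip: h_gh)
qed

lemma gh_seq_add: "prime p \<Longrightarrow> gh p (seq_add p a b) m = gh p a m + gh p b m"
  and gh_seq_mult: "prime p \<Longrightarrow> gh p (seq_mult p a b) m = gh p a m * gh p b m"
  using tc.rgh_witt_polys[of p a b m] by (simp_all add: seq_add_def seq_mult_def)

lemma gh_zero: "p > 0 \<Longrightarrow> gh p (\<lambda>_. 0) m = 0"
  by (simp add: gh_def zero_power)

lemma gh_single:
  assumes "p > 0" "i \<le> m"
  shows "gh p (\<lambda>j. if j = i then a else 0) m = of_nat (p ^ i) * a ^ (p ^ (m - i))"
proof -
  have "gh p (\<lambda>j. if j = i then a else 0) m =
      (\<Sum>j\<le>m. if j = i then of_nat (p ^ i) * a ^ (p ^ (m - i)) else 0)"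
    unfolding gh_def using assms by (intro sum.cong) (auto simp: zero_power)
  then show ?thesis using assms by simp
qed

lemma gh_seq_one: "p > 0 \<Longrightarrow> gh p seq_one m = 1"
  using gh_single[of p 0 m 1] by (simp add: seq_one_def)

text \<open>
  The Witt vector obtained by applying a ring homomorphism to the entries of a sequence and cutting
  off after index \<open>n\<close>.  Any three Witt vectors arise in this way from sequences of integer
  polynomials, by the same homomorphism, and between such sequences identities can be checked on
  ghost components.
\<close>

definition witt_image :: "nat \<Rightarrow> ('t \<Rightarrow> 'a) \<Rightarrow> (nat \<Rightarrow> 't) \<Rightarrow> nat \<Rightarrow> 'a" where
  "witt_image n h a = (\<lambda>i\<in>{..n}. h (a i))"

lemma witt_image_apply: "witt_image n h a i = (if i \<le> n then h (a i) else undefined)"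
  by (simp add: witt_image_def)

lemma carrier_witt: "carrier (witt p n R) = {..n} \<rightarrow>\<^sub>E carrier R"
  by (simp add: witt_def)

context tc_hom
begin

lemma witt_image_closed [simp]: "witt_image n h a \<in> carrier (witt p n R)"
  by (simp add: carrier_witt witt_image_def)

lemma h_seq:
  assumes "P \<in> ipoly_over (Inl ` {..i} \<union> Inr ` {..i})" "i \<le> n"
  shows "ipoly_eval R (case_sum (witt_image n h a) (witt_image n h b)) P = h (ipoly_eval tcring (case_sum a b) P)"
proof -
  have "ipoly_eval R (case_sum (witt_image n h a) (witt_image n h b)) P =
      ipoly_eval R (\<lambda>v. h (case_sum a b v)) P"
    using assms(2) by (intro ipoly_eval_cong[OF assms(1)]) (auto simp: witt_image_def)
  then show ?thesis by (simp add: h_ipoly_eval)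
qed

lemma witt_image_add:
  assumes "prime p"
  shows "witt_image n h a \<oplus>\<^bsub>witt p n R\<^esub> witt_image n h b = witt_image n h (seq_add p a b)"
  by (rule ext) (simp add: witt_def eval_int_mpoly_eq h_seq[OF witt_polys_over(1)[OF assms]] seq_add_def witt_image_apply)

lemma witt_image_mult:
  assumes "prime p"
  shows "witt_image n h a \<otimes>\<^bsub>witt p n R\<^esub> witt_image n h b = witt_image n h (seq_mult p a b)"
  by (rule ext) (simp add: witt_def eval_int_mpoly_eq h_seq[OF witt_polys_over(2)[OF assms]] seq_mult_def witt_image_apply)

lemma witt_image_zero: "\<zero>\<^bsub>witt p n R\<^esub> = witt_image n h (\<lambda>_. 0)"
  by (simp add: witt_def witt_image_def h_zero)

lemma witt_image_one: "\<one>\<^bsub>witt p n R\<^esub> = witt_image n h seq_one"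
  by (auto simp: witt_def witt_image_def h_zero h_one seq_one_def fun_eq_iff restrict_def)

end

context cring
begin

lemma witt_image_cover:
  assumes "x \<in> carrier (witt p n R)" "y \<in> carrier (witt p n R)" "z \<in> carrier (witt p n R)"
  obtains h :: "(nat \<times> nat) ipoly \<Rightarrow> 'a" and a b c where "tc_hom R h"
    "x = witt_image n h a" "y = witt_image n h b" "z = witt_image n h c"
proof
  define v where "v = (\<lambda>(j, i). if i \<le> n then (if j = 0 then x i else if j = (1::nat) then y i else z i) else \<zero>)"
  have v: "v \<in> UNIV \<rightarrow> carrier R"
    using assms by (auto simp: v_def carrier_witt)
  show "tc_hom R (ipoly_eval R v)" by (rule tc_hom_ipoly_eval[OF v])
  show "x = witt_image n (ipoly_eval R v) (\<lambda>i. Var (0, i))"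
    "y = witt_image n (ipoly_eval R v) (\<lambda>i. Var (1, i))"
    "z = witt_image n (ipoly_eval R v) (\<lambda>i. Var (2, i))"
    unfolding witt_image_def ipoly_eval_Var[OF v]
    using assms by (auto simp: carrier_witt fun_eq_iff v_def restrict_def)
qed

lemma cring_witt:
  assumes p: "prime p"
  shows "cring (witt p n R)"
proof -
  let ?W = "witt p n R"
  have p0: "p > 0" using p prime_gt_0_nat by blast
  note gh_simps = gh_seq_add[OF p] gh_seq_mult[OF p] gh_zero[OF p0] gh_seq_one[OF p0]
  have sa: "seq_add p a b = seq_add p a' b'" if "\<And>m. gh p a m + gh p b m = gh p a' m + gh p b' m"
    for a b a' b' :: "nat \<Rightarrow> (nat \<times> nat) ipoly"
    using that by (intro gh_inj[OF p0]) (simp add: gh_simps)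
  have add_closed: "x \<oplus>\<^bsub>?W\<^esub> y \<in> carrier ?W" if "x \<in> carrier ?W" "y \<in> carrier ?W" for x y
    by (rule witt_image_cover[OF that(1) that]) (simp add: tc_hom.witt_image_add[OF _ p] tc_hom.witt_image_closed)
  have mult_closed: "x \<otimes>\<^bsub>?W\<^esub> y \<in> carrier ?W" if "x \<in> carrier ?W" "y \<in> carrier ?W" for x y
    by (rule witt_image_cover[OF that(1) that]) (simp add: tc_hom.witt_image_mult[OF _ p] tc_hom.witt_image_closed)
  have zero: "\<zero>\<^bsub>?W\<^esub> \<in> carrier ?W" and one: "\<one>\<^bsub>?W\<^esub> \<in> carrier ?W"
    by (auto simp: witt_def)
  have add_assoc: "x \<oplus>\<^bsub>?W\<^esub> y \<oplus>\<^bsub>?W\<^esub> z = x \<oplus>\<^bsub>?W\<^esub> (y \<oplus>\<^bsub>?W\<^esub> z)"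
    if xyz: "x \<in> carrier ?W" "y \<in> carrier ?W" "z \<in> carrier ?W" for x y z
  proof (rule witt_image_cover[OF xyz])
    fix h :: "(nat \<times> nat) ipoly \<Rightarrow> 'a" and a b c
    assume "tc_hom R h" and eq: "x = witt_image n h a" "y = witt_image n h b" "z = witt_image n h c"
    then interpret tc_hom R h by simp
    have "seq_add p (seq_add p a b) c = seq_add p a (seq_add p b c)"
      by (intro gh_inj[OF p0]) (simp add: gh_simps)
    then show ?thesis by (simp add: eq witt_image_add[OF p])
  qed
  have mult_assoc: "x \<otimes>\<^bsub>?W\<^esub> y \<otimes>\<^bsub>?W\<^esub> z = x \<otimes>\<^bsub>?W\<^esub> (y \<otimes>\<^bsub>?W\<^esub> z)"
    if xyz: "x \<in> carrier ?W" "y \<in> carrier ?W" "z \<in> carrier ?W" for x y z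
  proof (rule witt_image_cover[OF xyz])
    fix h :: "(nat \<times> nat) ipoly \<Rightarrow> 'a" and a b c
    assume "tc_hom R h" and eq: "x = witt_image n h a" "y = witt_image n h b" "z = witt_image n h c"
    then interpret tc_hom R h by simp
    have "seq_mult p (seq_mult p a b) c = seq_mult p a (seq_mult p b c)"
      by (intro gh_inj[OF p0]) (simp add: gh_simps)
    then show ?thesis by (simp add: eq witt_image_mult[OF p])
  qed
  have distr: "(x \<oplus>\<^bsub>?W\<^esub> y) \<otimes>\<^bsub>?W\<^esub> z = x \<otimes>\<^bsub>?W\<^esub> z \<oplus>\<^bsub>?W\<^esub> y \<otimes>\<^bsub>?W\<^esub> z"
    if xyz: "x \<in> carrier ?W" "y \<in> carrier ?W" "z \<in> carrier ?W" for x y z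
  proof (rule witt_image_cover[OF xyz])
    fix h :: "(nat \<times> nat) ipoly \<Rightarrow> 'a" and a b c
    assume "tc_hom R h" and eq: "x = witt_image n h a" "y = witt_image n h b" "z = witt_image n h c"
    then interpret tc_hom R h by simp
    have "seq_mult p (seq_add p a b) c = seq_add p (seq_mult p a c) (seq_mult p b c)"
      by (intro gh_inj[OF p0]) (simp add: gh_simps distrib_right)
    then show ?thesis by (simp add: eq witt_image_mult[OF p] witt_image_add[OF p])
  qed
  have comm: "x \<oplus>\<^bsub>?W\<^esub> y = y \<oplus>\<^bsub>?W\<^esub> x" "x \<otimes>\<^bsub>?W\<^esub> y = y \<otimes>\<^bsub>?W\<^esub> x"
    if xy: "x \<in> carrier ?W" "y \<in> carrier ?W" for x y
  proof -
    obtain h :: "(nat \<times> nat) ipoly \<Rightarrow> 'a" and a b where "tc_hom R h"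
      and eq: "x = witt_image n h a" "y = witt_image n h b"
      using witt_image_cover[OF xy xy(1)] by metis
    then interpret tc_hom R h by simp
    have "seq_add p a b = seq_add p b a" "seq_mult p a b = seq_mult p b a"
      by (intro gh_inj[OF p0]; simp add: gh_simps add.commute mult.commute)+
    then show "x \<oplus>\<^bsub>?W\<^esub> y = y \<oplus>\<^bsub>?W\<^esub> x" "x \<otimes>\<^bsub>?W\<^esub> y = y \<otimes>\<^bsub>?W\<^esub> x"
      by (simp_all add: eq witt_image_mult[OF p] witt_image_add[OF p])
  qed
  have unit: "\<zero>\<^bsub>?W\<^esub> \<oplus>\<^bsub>?W\<^esub> x = x" "\<one>\<^bsub>?W\<^esub> \<otimes>\<^bsub>?W\<^esub> x = x" "\<exists>y\<in>carrier ?W. y \<oplus>\<^bsub>?W\<^esub> x = \<zero>\<^bsub>?W\<^esub>"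
    if x: "x \<in> carrier ?W" for x
  proof -
    obtain h :: "(nat \<times> nat) ipoly \<Rightarrow> 'a" and a where "tc_hom R h" and eq: "x = witt_image n h a"
      using witt_image_cover[OF x x x] by metis
    then interpret tc_hom R h by simp
    have "seq_add p (\<lambda>_. 0) a = a" "seq_mult p seq_one a = a"
      by (intro gh_inj[OF p0]; simp add: gh_simps)+
    then show "\<zero>\<^bsub>?W\<^esub> \<oplus>\<^bsub>?W\<^esub> x = x" "\<one>\<^bsub>?W\<^esub> \<otimes>\<^bsub>?W\<^esub> x = x"
      by (simp_all add: eq witt_image_zero witt_image_one witt_image_mult[OF p] witt_image_add[OF p])
    have "seq_add p (unghost p (\<lambda>m. - gh p a m)) a = (\<lambda>_. 0)"
      by (intro gh_inj[OF p0]) (simp add: gh_simps gh_unghost[OF p dwork_uminus[OF dwork_gh[OF p]]])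
    then have "witt_image n h (unghost p (\<lambda>m. - gh p a m)) \<oplus>\<^bsub>?W\<^esub> x = \<zero>\<^bsub>?W\<^esub>"
      by (simp add: eq witt_image_zero witt_image_add[OF p])
    then show "\<exists>y\<in>carrier ?W. y \<oplus>\<^bsub>?W\<^esub> x = \<zero>\<^bsub>?W\<^esub>"
      by (intro bexI) auto
  qed
  show ?thesis
  proof (rule cringI)
    show "abelian_group ?W"
      using add_closed zero add_assoc comm unit by (intro abelian_groupI) auto
    show "Group.comm_monoid ?W"
      using mult_closed one mult_assoc comm unit by (intro comm_monoidI) auto
  qed (use distr in auto)
qed

lemma witt_zeroth_hom:
  assumes p: "prime p"
  shows "(\<lambda>x. x 0) \<in> ring_hom (witt p n R) R"
proof (rule ring_hom_memI)
  fix x y assume xy: "x \<in> carrier (witt p n R)" "y \<in> carrier (witt p n R)"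
  then obtain h :: "(nat \<times> nat) ipoly \<Rightarrow> 'a" and a b where "tc_hom R h"
      and eq: "x = witt_image n h a" "y = witt_image n h b"
    using witt_image_cover[OF xy xy(1)] by metis
  then interpret tc_hom R h by simp
  show "x 0 \<in> carrier R" by (simp add: eq witt_image_def)
  have "seq_mult p a b 0 = a 0 * b 0" "seq_add p a b 0 = a 0 + b 0"
    using gh_seq_mult[OF p, of a b 0] gh_seq_add[OF p, of a b 0] by (simp_all add: gh_def)
  then show "(x \<otimes>\<^bsub>witt p n R\<^esub> y) 0 = x 0 \<otimes> y 0" "(x \<oplus>\<^bsub>witt p n R\<^esub> y) 0 = x 0 \<oplus> y 0"
    by (simp_all add: eq witt_image_mult[OF p] witt_image_add[OF p] witt_image_apply h_mult h_add)
qed (auto simp: witt_def)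

end


section \<open>Multiplication by \<open>p\<close> on Witt vectors in characteristic \<open>p\<close>\<close>

lemma (in tc_hom) add_pow_witt_image:
  assumes p: "prime p"
  obtains c where "\<And>m. gh p c m = of_nat k * gh p a m"
    "[(k::nat)] \<cdot>\<^bsub>witt p n R\<^esub> witt_image n h a = witt_image n h c"
proof -
  interpret W: cring "witt p n R" by (rule cring_witt[OF p])
  have p0: "p > 0" using p prime_gt_0_nat by blast
  have "\<exists>c. (\<forall>m. gh p c m = of_nat k * gh p a m) \<and>
      [k] \<cdot>\<^bsub>witt p n R\<^esub> witt_image n h a = witt_image n h c"
  proof (induction k)
    case 0
    show ?case
      by (rule exI[of _ "\<lambda>_. 0"]) (simp add: gh_zero[OF p0] witt_image_zero)
  next
    case (Suc k)
    then obtain c where "\<And>m. gh p c m = of_nat k * gh p a m"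
      "[k] \<cdot>\<^bsub>witt p n R\<^esub> witt_image n h a = witt_image n h c" by blast
    then show ?case
      by (intro exI[of _ "seq_add p c a"]) (simp add: gh_seq_add[OF p] witt_image_add[OF p] algebra_simps)
  qed
  then show ?thesis using that by blast
qed

context cring
begin

text \<open>
  In characteristic \<open>p\<close>, multiplication by \<open>p\<close> shifts the entries by one place and raises them to the
  \<open>p\<close>-th power.
\<close>

lemma witt_add_pow_p:
  assumes p: "prime p" and char: "[p] \<cdot> \<one> = \<zero>" and x: "x \<in> carrier (witt p n R)"
  shows "[p] \<cdot>\<^bsub>witt p n R\<^esub> x = (\<lambda>i\<in>{..n}. case i of 0 \<Rightarrow> \<zero> | Suc j \<Rightarrow> x j [^] p)"
proof -
  have p0: "p > 0" using p prime_gt_0_nat by blast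
  obtain h :: "(nat \<times> nat) ipoly \<Rightarrow> 'a" and a where "tc_hom R h" and eq: "x = witt_image n h a"
    using witt_image_cover[OF x x x] by metis
  then interpret tc_hom R h by simp
  \<comment> \<open>The sequences \<open>c\<close> and \<open>V\<close> agree modulo \<open>p\<close>, and \<open>h\<close> annihilates the multiples of \<open>p\<close>.\<close>
  obtain c where c: "\<And>m. gh p c m = of_nat p * gh p a m"
    and eqc: "[p] \<cdot>\<^bsub>witt p n R\<^esub> witt_image n h a = witt_image n h c"
    using add_pow_witt_image[OF p] by blast
  define V where "V = (\<lambda>i. case i of 0 \<Rightarrow> 0 | Suc j \<Rightarrow> a j ^ p)"
  have "of_nat p dvd c m - V m" for m
  proof (rule gh_cong_conv[OF p0])
    fix m show "of_nat (p ^ Suc m) dvd gh p c m - gh p V m"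
      unfolding c V_def gh_shift_power[OF p0] by simp
  qed
  have kill: "h (of_nat p * y) = \<zero>" for y
  proof -
    have "h (of_nat p * y) = ([p] \<cdot> \<one>) \<otimes> h y"
      by (simp add: h_of_nat_mult add_pow_ldistr)
    then show ?thesis by (simp add: char)
  qed
  have "h (c m) = h (V m)" for m
  proof -
    obtain y where "c m = V m + of_nat p * y"
      using \<open>of_nat p dvd c m - V m\<close> by (metis add.commute diff_add_cancel dvdE)
    then show ?thesis by (simp add: h_add kill)
  qed
  then show ?thesis
    by (auto simp: eq eqc witt_image_apply V_def h_zero h_power fun_eq_iff restrict_def split: nat.splits)
qed

lemma witt_add_pow_p_power:
  assumes p: "prime p" and char: "[p] \<cdot> \<one> = \<zero>" and x: "x \<in> carrier (witt p n R)"
  shows "[(p ^ k)] \<cdot>\<^bsub>witt p n R\<^esub> x = (\<lambda>i\<in>{..n}. if i < k then \<zero> else x (i - k) [^] (p ^ k))"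
proof -
  interpret W: cring "witt p n R" by (rule cring_witt[OF p])
  show ?thesis
  proof (induction k)
    case 0
    then show ?case using x by (auto simp: carrier_witt fun_eq_iff restrict_def PiE_def extensional_def Pi_iff)
  next
    case (Suc k)
    have "[(p ^ Suc k)] \<cdot>\<^bsub>witt p n R\<^esub> x = [p] \<cdot>\<^bsub>witt p n R\<^esub> ([(p ^ k)] \<cdot>\<^bsub>witt p n R\<^esub> x)"
      using x by (simp add: W.add.nat_pow_pow mult.commute)
    also have "\<dots> = (\<lambda>i\<in>{..n}. case i of 0 \<Rightarrow> \<zero> | Suc j \<Rightarrow> ([(p ^ k)] \<cdot>\<^bsub>witt p n R\<^esub> x) j [^] p)"
      using x by (intro witt_add_pow_p p char) simp
    also have "\<dots> = (\<lambda>i\<in>{..n}. if i < Suc k then \<zero> else x (i - Suc k) [^] (p ^ Suc k))"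
      unfolding Suc using x prime_gt_0_nat[OF p]
      by (auto simp: fun_eq_iff restrict_def nat_pow_pow carrier_witt PiE_def Pi_def nat_pow_zero mult.commute split: nat.splits)
    finally show ?case .
  qed
qed

end


section \<open>Polynomial rings over a monoid of exponents\<close>

text \<open>
  Multiples of an exponent; for monomials these are powers.
\<close>

primrec nmult :: "nat \<Rightarrow> 'e::comm_monoid_add \<Rightarrow> 'e" where
  "nmult 0 e = 0"
| "nmult (Suc k) e = e + nmult k e"

lemma nmult_add: "nmult (k + l) e = nmult k e + nmult l e"
  by (induction k) (simp_all add: add.assoc)

lemma nmult_add_right: "nmult k (d + e) = nmult k d + nmult k e"
  by (induction k) (simp_all add: ac_simps)

lemma nmult_mult: "nmult (k * l) e = nmult k (nmult l e)"
  by (induction k) (simp_all add: nmult_add)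

text \<open>
  A set \<open>M\<close> of exponents, written additively, with a distinguished exponent \<open>u\<close>, that of the variable
  for which derivations are taken, and with \<open>cnt e\<close> the multiplicity of this variable in \<open>e\<close>.  The
  set \<open>M\<close> restricts which variables may occur.  The instances below are natural numbers, for one
  variable, and finite multisets of variables.
\<close>

locale monomials =
  fixes M :: "'e::cancel_comm_monoid_add set" and u :: 'e and cnt :: "'e \<Rightarrow> nat"
  assumes finite_dec: "finite {x. fst x + snd x = (e::'e)}"
    and M_zero: "0 \<in> M"
    and M_add: "a + b \<in> M \<longleftrightarrow> a \<in> M \<and> b \<in> M"
    and M_u: "u \<in> M"
    and cnt_add: "cnt (a + b) = cnt a + cnt b"
    and cnt_u: "cnt u = 1"
    and cnt_pos: "cnt a > 0 \<Longrightarrow> \<exists>b. a = b + u"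
    and nmult_inj: "k > 0 \<Longrightarrow> nmult k a = nmult k b \<Longrightarrow> a = (b :: 'e)"
begin

lemma cnt_zero: "cnt 0 = 0"
  using cnt_add[of 0 0] by simp

lemma M_nmult: "a \<in> M \<Longrightarrow> nmult k a \<in> M"
  by (induction k) (simp_all add: M_zero M_add)

lemma cnt_nmult: "cnt (nmult k a) = k * cnt a"
  by (induction k) (simp_all add: cnt_zero cnt_add)

lemma cnt_ge: "r \<le> cnt a \<Longrightarrow> \<exists>b. a = b + nmult r u"
proof (induction r)
  case (Suc r)
  then obtain b where b: "a = b + nmult r u" by auto
  with Suc.prems have "cnt b > 0" by (simp add: cnt_add cnt_nmult cnt_u)
  then obtain c where "b = c + u" using cnt_pos by blast
  with b have "a = c + nmult (Suc r) u" by (simp add: ac_simps)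
  then show ?case by blast
qed simp

end

text \<open>
  \<open>P\<close> is the polynomial ring over \<open>R\<close> with exponents in \<open>M\<close>, its elements being coefficient functions.
  Addition and multiplication are prescribed on the carrier only, since \<^const>\<open>UP\<close> leaves them
  unspecified elsewhere.
\<close>

locale poly_ring = monomials M u cnt + R: cring R
  for M :: "'e::cancel_comm_monoid_add set" and u cnt and R :: "('a, 'm) ring_scheme" (structure) +
  fixes P :: "('e \<Rightarrow> 'a, 'l) ring_scheme"
  assumes carrier_P: "carrier P =
      {f. range f \<subseteq> carrier R \<and> finite {e. f e \<noteq> \<zero>} \<and> (\<forall>e. f e \<noteq> \<zero> \<longrightarrow> e \<in> M)}"
    and zero_P: "\<zero>\<^bsub>P\<^esub> = (\<lambda>e. \<zero>)"
    and one_P: "\<one>\<^bsub>P\<^esub> = (\<lambda>e. if e = 0 then \<one> else \<zero>)"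
    and add_P: "\<lbrakk>f \<in> carrier P; g \<in> carrier P\<rbrakk> \<Longrightarrow> f \<oplus>\<^bsub>P\<^esub> g = (\<lambda>e. f e \<oplus> g e)"
    and mult_P: "\<lbrakk>f \<in> carrier P; g \<in> carrier P\<rbrakk> \<Longrightarrow>
      (f \<otimes>\<^bsub>P\<^esub> g) e = (\<Oplus>x\<in>{x. fst x + snd x = e}. f (fst x) \<otimes> g (snd x))"
begin

text \<open>
  The monomial with coefficient \<open>c\<close> and exponent \<open>a\<close>.
\<close>

definition mon :: "'a \<Rightarrow> 'e \<Rightarrow> 'e \<Rightarrow> 'a" where
  "mon c a = (\<lambda>e. if e = a then c else \<zero>)"

lemma mon_apply: "mon c a e = (if e = a then c else \<zero>)"
  by (simp add: mon_def)

lemma coeff_closed [simp]: "f \<in> carrier P \<Longrightarrow> f e \<in> carrier R"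
  by (auto simp: carrier_P)

lemma mon_closed [simp]:
  assumes "c \<in> carrier R" "a \<in> M"
  shows "mon c a \<in> carrier P"
proof -
  have "{e. mon c a e \<noteq> \<zero>} \<subseteq> {a}" by (auto simp: mon_def)
  then show ?thesis using assms by (auto simp: carrier_P mon_def)
qed

lemma zero_closed_P: "\<zero>\<^bsub>P\<^esub> \<in> carrier P"
  by (simp add: carrier_P zero_P)

lemma one_P_mon: "\<one>\<^bsub>P\<^esub> = mon \<one> 0"
  by (simp add: one_P mon_def)

lemma add_closed_P:
  assumes "f \<in> carrier P" "g \<in> carrier P"
  shows "f \<oplus>\<^bsub>P\<^esub> g \<in> carrier P"
proof -
  have "{e. f e \<oplus> g e \<noteq> \<zero>} \<subseteq> {e. f e \<noteq> \<zero>} \<union> {e. g e \<noteq> \<zero>}"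
    by auto
  then have "finite {e. f e \<oplus> g e \<noteq> \<zero>}"
    using assms by (elim finite_subset) (auto simp: carrier_P)
  moreover have "e \<in> M" if "f e \<oplus> g e \<noteq> \<zero>" for e
    using that assms coeff_closed[OF assms(2)] unfolding carrier_P by (cases "f e = \<zero>") auto
  moreover have "f e \<oplus> g e \<in> carrier R" for e using assms by simp
  ultimately show ?thesis by (auto simp: add_P[OF assms] carrier_P)
qed

lemma coeff_add: "f \<in> carrier P \<Longrightarrow> g \<in> carrier P \<Longrightarrow> (f \<oplus>\<^bsub>P\<^esub> g) e = f e \<oplus> g e"
  by (simp add: add_P)

lemma mult_closed_P:
  assumes "f \<in> carrier P" "g \<in> carrier P"
  shows "f \<otimes>\<^bsub>P\<^esub> g \<in> carrier P"
proof -
  have ex: "\<exists>a b. e = a + b \<and> f a \<noteq> \<zero> \<and> g b \<noteq> \<zero>" if "(f \<otimes>\<^bsub>P\<^esub> g) e \<noteq> \<zero>" for e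
  proof (rule ccontr)
    assume no: "\<nexists>a b. e = a + b \<and> f a \<noteq> \<zero> \<and> g b \<noteq> \<zero>"
    have "(\<Oplus>x\<in>{x. fst x + snd x = e}. f (fst x) \<otimes> g (snd x)) = \<zero>"
    proof (rule R.add.finprod_one_eqI)
      fix x assume "x \<in> {x. fst x + snd x = e}"
      then have "f (fst x) = \<zero> \<or> g (snd x) = \<zero>" using no by blast
      then show "f (fst x) \<otimes> g (snd x) = \<zero>" using assms by auto
    qed
    then show False using that assms by (simp add: mult_P)
  qed
  have "{e. (f \<otimes>\<^bsub>P\<^esub> g) e \<noteq> \<zero>} \<subseteq> (\<lambda>(a, b). a + b) ` ({e. f e \<noteq> \<zero>} \<times> {e. g e \<noteq> \<zero>})"
    using ex by fastforce
  then have "finite {e. (f \<otimes>\<^bsub>P\<^esub> g) e \<noteq> \<zero>}"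
    using assms by (elim finite_subset) (auto simp: carrier_P)
  moreover have "e \<in> M" if "(f \<otimes>\<^bsub>P\<^esub> g) e \<noteq> \<zero>" for e
    using ex[OF that] assms M_add by (auto simp: carrier_P)
  moreover have "(f \<otimes>\<^bsub>P\<^esub> g) e \<in> carrier R" for e
    using assms by (auto simp: mult_P intro!: R.finsum_closed)
  ultimately show ?thesis by (auto simp: carrier_P)
qed

lemma poly_induct [consumes 1, case_names zero add]:
  assumes f: "f \<in> carrier P"
    and zero: "Q \<zero>\<^bsub>P\<^esub>"
    and step: "\<And>c a f. \<lbrakk>c \<in> carrier R; a \<in> M; f \<in> carrier P; Q f\<rbrakk> \<Longrightarrow> Q (mon c a \<oplus>\<^bsub>P\<^esub> f)"
  shows "Q f"
proof -
  have "finite {e. f e \<noteq> \<zero>}" using f by (simp add: carrier_P)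
  then show ?thesis using f
  proof (induction "{e. f e \<noteq> \<zero>}" arbitrary: f rule: finite_induct)
    case empty
    then have "f = \<zero>\<^bsub>P\<^esub>" by (auto simp: zero_P fun_eq_iff)
    then show ?case using zero by simp
  next
    case (insert a E)
    let ?g = "f(a := \<zero>)"
    have a: "f a \<noteq> \<zero>" using insert.hyps(4) by auto
    have E: "E = {e. ?g e \<noteq> \<zero>}" using insert.hyps(2,4) by (auto simp: set_eq_iff)
    have g: "?g \<in> carrier P"
      using insert.prems insert.hyps(1) unfolding carrier_P mem_Collect_eq E[symmetric]
      by (auto split: if_splits)
    have am: "a \<in> M" using a insert.prems by (auto simp: carrier_P)
    have "f = mon (f a) a \<oplus>\<^bsub>P\<^esub> ?g"
      using am insert.prems g by (subst add_P) (auto simp: mon_apply fun_eq_iff)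
    moreover have "Q ?g" using insert.hyps(3)[OF E g] .
    ultimately show ?case using step[of "f a" a ?g] am g insert.prems by simp
  qed
qed

lemma mon_mult:
  assumes "c \<in> carrier R" "a \<in> M" "g \<in> carrier P"
  shows "(mon c a \<otimes>\<^bsub>P\<^esub> g) (a + b) = c \<otimes> g b"
    and "(\<And>b. e \<noteq> a + b) \<Longrightarrow> (mon c a \<otimes>\<^bsub>P\<^esub> g) e = \<zero>"
proof -
  let ?A = "\<lambda>e. {x::'e \<times> 'e. fst x + snd x = e}"
  have "(mon c a \<otimes>\<^bsub>P\<^esub> g) (a + b) = (\<Oplus>x\<in>?A (a + b). if x = (a, b) then c \<otimes> g (snd x) else \<zero>)"
    using assms by (subst mult_P) (auto intro!: R.finsum_cong' simp: mon_apply)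
  also have "\<dots> = c \<otimes> g (snd (a, b))"
    using assms finite_dec by (intro R.add.finprod_singleton_swap) auto
  finally show "(mon c a \<otimes>\<^bsub>P\<^esub> g) (a + b) = c \<otimes> g b" by simp
  show "(mon c a \<otimes>\<^bsub>P\<^esub> g) e = \<zero>" if "\<And>b. e \<noteq> a + b"
  proof -
    have "mon c a (fst x) \<otimes> g (snd x) = \<zero>" if "x \<in> ?A e" for x
    proof -
      have "fst x \<noteq> a" using that \<open>\<And>b. e \<noteq> a + b\<close>[of "snd x"] by auto
      then show ?thesis using assms by (simp add: mon_apply)
    qed
    then show ?thesis using assms by (subst mult_P) (auto intro!: R.add.finprod_one_eqI)
  qed
qed

lemma mon_mult_mon:
  assumes "c \<in> carrier R" "a \<in> M" "d \<in> carrier R" "b \<in> M"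
  shows "mon c a \<otimes>\<^bsub>P\<^esub> mon d b = mon (c \<otimes> d) (a + b)"
proof
  fix e
  show "(mon c a \<otimes>\<^bsub>P\<^esub> mon d b) e = mon (c \<otimes> d) (a + b) e"
  proof (cases "\<exists>k. e = a + k")
    case True
    then obtain k where e: "e = a + k" by blast
    show ?thesis unfolding e using assms
      by (subst mon_mult(1)) (auto simp: mon_apply)
  next
    case False
    then show ?thesis using assms by (subst mon_mult(2)) (auto simp: mon_apply)
  qed
qed

text \<open>
  Associativity is reduced to monomials by additivity in each factor.
\<close>

lemma cring_P: "cring P"
proof -
  note closed = zero_closed_P add_closed_P mult_closed_P
  have add_assoc: "f \<oplus>\<^bsub>P\<^esub> g \<oplus>\<^bsub>P\<^esub> h = f \<oplus>\<^bsub>P\<^esub> (g \<oplus>\<^bsub>P\<^esub> h)"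
    if "f \<in> carrier P" "g \<in> carrier P" "h \<in> carrier P" for f g h
    using that by (simp add: fun_eq_iff coeff_add closed R.a_assoc)
  have add_comm: "f \<oplus>\<^bsub>P\<^esub> g = g \<oplus>\<^bsub>P\<^esub> f" if "f \<in> carrier P" "g \<in> carrier P" for f g
    using that by (simp add: fun_eq_iff coeff_add R.a_comm)
  have distr: "(f \<oplus>\<^bsub>P\<^esub> g) \<otimes>\<^bsub>P\<^esub> h = f \<otimes>\<^bsub>P\<^esub> h \<oplus>\<^bsub>P\<^esub> g \<otimes>\<^bsub>P\<^esub> h"
    if "f \<in> carrier P" "g \<in> carrier P" "h \<in> carrier P" for f g h
  proof
    fix e
    have "((f \<oplus>\<^bsub>P\<^esub> g) \<otimes>\<^bsub>P\<^esub> h) e = (\<Oplus>x\<in>{x. fst x + snd x = e}. f (fst x) \<otimes> h (snd x) \<oplus> g (fst x) \<otimes> h (snd x))"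
      using that by (simp add: mult_P closed) (auto intro!: R.finsum_cong' simp: coeff_add R.l_distr)
    also have "\<dots> = (f \<otimes>\<^bsub>P\<^esub> h \<oplus>\<^bsub>P\<^esub> g \<otimes>\<^bsub>P\<^esub> h) e"
      using that by (simp add: coeff_add closed mult_P R.finsum_addf)
    finally show "((f \<oplus>\<^bsub>P\<^esub> g) \<otimes>\<^bsub>P\<^esub> h) e = (f \<otimes>\<^bsub>P\<^esub> h \<oplus>\<^bsub>P\<^esub> g \<otimes>\<^bsub>P\<^esub> h) e" .
  qed
  have comm: "f \<otimes>\<^bsub>P\<^esub> g = g \<otimes>\<^bsub>P\<^esub> f" if "f \<in> carrier P" "g \<in> carrier P" for f g
  proof
    fix e :: 'e
    have "{x. fst x + snd x = e} = prod.swap ` {x. fst x + snd x = e}"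
    proof (intro subset_antisym subsetI)
      fix x :: "'e \<times> 'e" assume "x \<in> {x. fst x + snd x = e}"
      then have "prod.swap x \<in> {x. fst x + snd x = e}" by (simp add: add.commute)
      then have "prod.swap (prod.swap x) \<in> prod.swap ` {x. fst x + snd x = e}" by (rule imageI)
      then show "x \<in> prod.swap ` {x. fst x + snd x = e}" by simp
    qed (auto simp: add.commute)
    then have "(f \<otimes>\<^bsub>P\<^esub> g) e = (\<Oplus>x\<in>prod.swap ` {x. fst x + snd x = e}. f (fst x) \<otimes> g (snd x))"
      using that by (simp add: mult_P)
    also have "\<dots> = (\<Oplus>x\<in>{x. fst x + snd x = e}. g (fst x) \<otimes> f (snd x))"
      using that by (subst R.finsum_reindex) (auto simp: R.m_comm)
    finally show "(f \<otimes>\<^bsub>P\<^esub> g) e = (g \<otimes>\<^bsub>P\<^esub> f) e" using that by (simp add: mult_P)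
  qed
  have l_null: "\<zero>\<^bsub>P\<^esub> \<otimes>\<^bsub>P\<^esub> f = \<zero>\<^bsub>P\<^esub>" if "f \<in> carrier P" for f
    using that by (auto simp: fun_eq_iff mult_P closed) (simp add: zero_P)
  have r_null: "f \<otimes>\<^bsub>P\<^esub> \<zero>\<^bsub>P\<^esub> = \<zero>\<^bsub>P\<^esub>" if "f \<in> carrier P" for f
    using comm[OF that closed(1)] l_null[OF that] by simp
  have r_distr: "h \<otimes>\<^bsub>P\<^esub> (f \<oplus>\<^bsub>P\<^esub> g) = h \<otimes>\<^bsub>P\<^esub> f \<oplus>\<^bsub>P\<^esub> h \<otimes>\<^bsub>P\<^esub> g"
    if "f \<in> carrier P" "g \<in> carrier P" "h \<in> carrier P" for f g h
    using that distr[OF that] comm[of h] closed by simp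
  have l_zero: "\<zero>\<^bsub>P\<^esub> \<oplus>\<^bsub>P\<^esub> f = f" if "f \<in> carrier P" for f
    using that by (simp add: fun_eq_iff coeff_add closed) (simp add: zero_P)
  have one: "\<one>\<^bsub>P\<^esub> \<otimes>\<^bsub>P\<^esub> f = f" if "f \<in> carrier P" for f
    using mon_mult(1)[of \<one> 0 f] that by (simp add: one_P_mon M_zero fun_eq_iff)
  have mon3: "mon c a \<otimes>\<^bsub>P\<^esub> mon d b \<otimes>\<^bsub>P\<^esub> h = mon c a \<otimes>\<^bsub>P\<^esub> (mon d b \<otimes>\<^bsub>P\<^esub> h)"
    if "c \<in> carrier R" "a \<in> M" "d \<in> carrier R" "b \<in> M" "h \<in> carrier P" for c a d b h
    using that(5)
  proof (induction rule: poly_induct)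
    case zero
    show ?case using that by (simp add: closed l_null r_null)
  next
    case (add k e g)
    have "mon c a \<otimes>\<^bsub>P\<^esub> mon d b \<otimes>\<^bsub>P\<^esub> (mon k e \<oplus>\<^bsub>P\<^esub> g) =
        mon c a \<otimes>\<^bsub>P\<^esub> mon d b \<otimes>\<^bsub>P\<^esub> mon k e \<oplus>\<^bsub>P\<^esub> mon c a \<otimes>\<^bsub>P\<^esub> mon d b \<otimes>\<^bsub>P\<^esub> g"
      using that add by (simp add: closed distr r_distr)
    also have "mon c a \<otimes>\<^bsub>P\<^esub> mon d b \<otimes>\<^bsub>P\<^esub> mon k e = mon c a \<otimes>\<^bsub>P\<^esub> (mon d b \<otimes>\<^bsub>P\<^esub> mon k e)"
      using that add by (simp add: mon_mult_mon M_add R.m_assoc add.assoc)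
    also have "mon c a \<otimes>\<^bsub>P\<^esub> (mon d b \<otimes>\<^bsub>P\<^esub> mon k e) \<oplus>\<^bsub>P\<^esub> mon c a \<otimes>\<^bsub>P\<^esub> mon d b \<otimes>\<^bsub>P\<^esub> g =
       mon c a \<otimes>\<^bsub>P\<^esub> (mon d b \<otimes>\<^bsub>P\<^esub> (mon k e \<oplus>\<^bsub>P\<^esub> g))"
      using that add by (simp add: closed distr r_distr)
    finally show ?case .
  qed
  have mon2: "mon c a \<otimes>\<^bsub>P\<^esub> g \<otimes>\<^bsub>P\<^esub> h = mon c a \<otimes>\<^bsub>P\<^esub> (g \<otimes>\<^bsub>P\<^esub> h)"
    if "c \<in> carrier R" "a \<in> M" "h \<in> carrier P" "g \<in> carrier P" for c a g h
    using that(4)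
  proof (induction rule: poly_induct)
    case zero
    show ?case using that by (simp add: closed l_null r_null)
  next
    case (add k e g)
    have "mon c a \<otimes>\<^bsub>P\<^esub> (mon k e \<oplus>\<^bsub>P\<^esub> g) \<otimes>\<^bsub>P\<^esub> h =
        mon c a \<otimes>\<^bsub>P\<^esub> mon k e \<otimes>\<^bsub>P\<^esub> h \<oplus>\<^bsub>P\<^esub> mon c a \<otimes>\<^bsub>P\<^esub> g \<otimes>\<^bsub>P\<^esub> h"
      using that add by (simp add: closed distr r_distr)
    also have "\<dots> = mon c a \<otimes>\<^bsub>P\<^esub> (mon k e \<otimes>\<^bsub>P\<^esub> h) \<oplus>\<^bsub>P\<^esub> mon c a \<otimes>\<^bsub>P\<^esub> (g \<otimes>\<^bsub>P\<^esub> h)"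
      using that add by (simp add: mon3)
    also have "\<dots> = mon c a \<otimes>\<^bsub>P\<^esub> ((mon k e \<oplus>\<^bsub>P\<^esub> g) \<otimes>\<^bsub>P\<^esub> h)"
      using that add by (simp add: closed distr r_distr)
    finally show ?case .
  qed
  have assoc: "f \<otimes>\<^bsub>P\<^esub> g \<otimes>\<^bsub>P\<^esub> h = f \<otimes>\<^bsub>P\<^esub> (g \<otimes>\<^bsub>P\<^esub> h)"
    if "f \<in> carrier P" "g \<in> carrier P" "h \<in> carrier P" for f g h
    using that(1)
  proof (induction rule: poly_induct)
    case zero
    show ?case using that by (simp add: closed l_null)
  next
    case (add k e f)
    have "(mon k e \<oplus>\<^bsub>P\<^esub> f) \<otimes>\<^bsub>P\<^esub> g \<otimes>\<^bsub>P\<^esub> h =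
        mon k e \<otimes>\<^bsub>P\<^esub> g \<otimes>\<^bsub>P\<^esub> h \<oplus>\<^bsub>P\<^esub> f \<otimes>\<^bsub>P\<^esub> g \<otimes>\<^bsub>P\<^esub> h"
      using that add by (simp add: distr closed)
    also have "\<dots> = (mon k e \<oplus>\<^bsub>P\<^esub> f) \<otimes>\<^bsub>P\<^esub> (g \<otimes>\<^bsub>P\<^esub> h)"
      using that add by (simp add: mon2 distr closed)
    finally show ?case .
  qed
  have one_closed: "\<one>\<^bsub>P\<^esub> \<in> carrier P" by (simp add: one_P_mon M_zero)
  show ?thesis
  proof (rule cringI)
    show "abelian_group P"
    proof (rule abelian_groupI)
      fix f assume f: "f \<in> carrier P"
      have "\<ominus> f e = \<zero> \<longleftrightarrow> f e = \<zero>" for e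
        using f R.add.inv_eq_1_iff[OF coeff_closed[OF f]] by simp
      moreover have "\<ominus> f e \<in> carrier R" for e using f by simp
      ultimately have "(\<lambda>e. \<ominus> f e) \<in> carrier P"
        using f by (auto simp: carrier_P)
      moreover from f this have "(\<lambda>e. \<ominus> f e) \<oplus>\<^bsub>P\<^esub> f = \<zero>\<^bsub>P\<^esub>"
        by (simp add: add_P zero_P R.l_neg)
      ultimately show "\<exists>g\<in>carrier P. g \<oplus>\<^bsub>P\<^esub> f = \<zero>\<^bsub>P\<^esub>" by blast
    qed (assumption | rule closed add_assoc add_comm l_zero)+
    show "Group.comm_monoid P"
      by (rule comm_monoidI) (assumption | rule mult_closed_P one_closed assoc comm one)+
  qed (rule distr)
qed

end


section \<open>Differential operators\<close>

lemma linear_operatorsD: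
  assumes "D \<in> linear_operators R \<phi> S"
  shows "D \<in> carrier S \<rightarrow>\<^sub>E carrier S"
    and "\<And>x. x \<in> carrier S \<Longrightarrow> D x \<in> carrier S"
    and "\<And>x y. \<lbrakk>x \<in> carrier S; y \<in> carrier S\<rbrakk> \<Longrightarrow> D (x \<oplus>\<^bsub>S\<^esub> y) = D x \<oplus>\<^bsub>S\<^esub> D y"
    and "\<And>a x. \<lbrakk>a \<in> carrier R; x \<in> carrier S\<rbrakk> \<Longrightarrow> D (\<phi> a \<otimes>\<^bsub>S\<^esub> x) = \<phi> a \<otimes>\<^bsub>S\<^esub> D x"
  using assms by (auto simp: linear_operators_def)

lemma diff_operators_linear: "D \<in> diff_operators R \<phi> S r \<Longrightarrow> D \<in> linear_operators R \<phi> S"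
  by (cases r) auto

lemma diff_operators_commutator_0:
  assumes "D \<in> diff_operators R \<phi> S 0" "s \<in> carrier S" "x \<in> carrier S"
  shows "D (s \<otimes>\<^bsub>S\<^esub> x) \<ominus>\<^bsub>S\<^esub> s \<otimes>\<^bsub>S\<^esub> D x = \<zero>\<^bsub>S\<^esub>"
proof -
  have "commutator S D s x = \<zero>\<^bsub>S\<^esub>" using assms by auto
  then show ?thesis using assms by (simp add: commutator_def)
qed

lemma diff_operators_0I:
  assumes "D \<in> linear_operators R \<phi> S"
    and "\<And>s. s \<in> carrier S \<Longrightarrow> commutator S D s = (\<lambda>x\<in>carrier S. \<zero>\<^bsub>S\<^esub>)"
  shows "D \<in> diff_operators R \<phi> S 0"
  unfolding diff_operators.simps using assms by blast

lemma diff_operators_SucI: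
  assumes "D \<in> linear_operators R \<phi> S"
    and "\<And>s. s \<in> carrier S \<Longrightarrow> commutator S D s \<in> diff_operators R \<phi> S r"
  shows "D \<in> diff_operators R \<phi> S (Suc r)"
  unfolding diff_operators.simps using assms by blast

lemma diff_operators_commutator:
  "D \<in> diff_operators R \<phi> S (Suc r) \<Longrightarrow> s \<in> carrier S \<Longrightarrow> commutator S D s \<in> diff_operators R \<phi> S r"
  by simp

context cring
begin

lemma diff_operators_zero:
  assumes \<phi>: "\<And>a. a \<in> carrier A \<Longrightarrow> \<phi> a \<in> carrier R"
  shows "(\<lambda>x\<in>carrier R. \<zero>) \<in> diff_operators A \<phi> R r"
proof -
  have lin: "(\<lambda>x\<in>carrier R. \<zero>) \<in> linear_operators A \<phi> R"
    using \<phi> by (auto simp: linear_operators_def)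
  have com: "commutator R (\<lambda>x\<in>carrier R. \<zero>) s = (\<lambda>x\<in>carrier R. \<zero>)" if "s \<in> carrier R" for s
    using that by (auto simp: commutator_def fun_eq_iff restrict_def)
  show ?thesis
  proof (induction r)
    case 0
    show ?case by (intro diff_operators_0I lin com)
  next
    case (Suc r)
    then show ?case by (intro diff_operators_SucI lin) (simp only: com)
  qed
qed

lemma diff_operators_mono:
  assumes "\<And>a. a \<in> carrier A \<Longrightarrow> \<phi> a \<in> carrier R" "r \<le> r'" "D \<in> diff_operators A \<phi> R r"
  shows "D \<in> diff_operators A \<phi> R r'"
proof -
  have step: "D \<in> diff_operators A \<phi> R (Suc r)" if "D \<in> diff_operators A \<phi> R r" for D r
    using that
  proof (induction r arbitrary: D)
    case 0
    have com: "commutator R D s = (\<lambda>x\<in>carrier R. \<zero>)" if "s \<in> carrier R" for s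
      using 0 that by simp
    show ?case
      by (intro diff_operators_SucI diff_operators_linear[OF 0]) (simp only: com diff_operators_zero[OF assms(1)])
  next
    case (Suc r)
    show ?case
      by (intro diff_operators_SucI diff_operators_linear[OF Suc.prems] Suc.IH)
        (rule diff_operators_commutator[OF Suc.prems])
  qed
  show ?thesis using assms(2,3) by (induction rule: dec_induct) (simp_all only: step)
qed

lemma diff_operators_add:
  assumes "D \<in> diff_operators A \<phi> R r" "E \<in> diff_operators A \<phi> R r"
    and \<phi>: "\<And>a. a \<in> carrier A \<Longrightarrow> \<phi> a \<in> carrier R"
  shows "(\<lambda>x\<in>carrier R. D x \<oplus> E x) \<in> diff_operators A \<phi> R r"
  using assms(1,2)
proof (induction r arbitrary: D E)
  case 0
  note D = linear_operatorsD[OF diff_operators_linear[OF 0(1)]]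
    and E = linear_operatorsD[OF diff_operators_linear[OF 0(2)]]
  have lin: "(\<lambda>x\<in>carrier R. D x \<oplus> E x) \<in> linear_operators A \<phi> R"
    using D E \<phi> by (auto simp: linear_operators_def r_distr a_ac)
  have "D (s \<otimes> x) = s \<otimes> D x" "E (s \<otimes> x) = s \<otimes> E x" if "s \<in> carrier R" "x \<in> carrier R" for s x
    using diff_operators_commutator_0[OF 0(1) that] diff_operators_commutator_0[OF 0(2) that] that D(2) E(2)
    by simp_all
  then have "commutator R (\<lambda>x\<in>carrier R. D x \<oplus> E x) s = (\<lambda>x\<in>carrier R. \<zero>)" if "s \<in> carrier R" for s
    using that D(2) E(2) by (auto simp: commutator_def fun_eq_iff restrict_def r_distr)
  with lin show ?case by (intro diff_operators_0I)
next
  case (Suc r)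
  note D = linear_operatorsD[OF diff_operators_linear[OF Suc.prems(1)]]
    and E = linear_operatorsD[OF diff_operators_linear[OF Suc.prems(2)]]
  have lin: "(\<lambda>x\<in>carrier R. D x \<oplus> E x) \<in> linear_operators A \<phi> R"
    using D E \<phi> by (auto simp: linear_operators_def r_distr a_ac)
  have "commutator R (\<lambda>x\<in>carrier R. D x \<oplus> E x) s =
      (\<lambda>x\<in>carrier R. commutator R D s x \<oplus> commutator R E s x)" if "s \<in> carrier R" for s
    using that D(2) E(2) by (auto simp: commutator_def fun_eq_iff restrict_def r_distr a_minus_def minus_add a_ac)
  moreover have "(\<lambda>x\<in>carrier R. commutator R D s x \<oplus> commutator R E s x) \<in> diff_operators A \<phi> R r"
    if "s \<in> carrier R" for s
    using Suc.prems that by (intro Suc.IH diff_operators_commutator)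
  ultimately show ?case using lin by (intro diff_operators_SucI) (simp_all only:)
qed

lemma diff_operators_smult:
  assumes "D \<in> diff_operators A \<phi> R r" and g: "g \<in> carrier R"
    and \<phi>: "\<And>a. a \<in> carrier A \<Longrightarrow> \<phi> a \<in> carrier R"
  shows "(\<lambda>x\<in>carrier R. g \<otimes> D x) \<in> diff_operators A \<phi> R r"
  using assms(1)
proof (induction r arbitrary: D)
  case 0
  note D = linear_operatorsD[OF diff_operators_linear[OF 0]]
  have lin: "(\<lambda>x\<in>carrier R. g \<otimes> D x) \<in> linear_operators A \<phi> R"
    using D g \<phi> by (auto simp: linear_operators_def r_distr m_lcomm)
  have "D (s \<otimes> x) = s \<otimes> D x" if "s \<in> carrier R" "x \<in> carrier R" for s x
    using diff_operators_commutator_0[OF 0 that] that D(2) by simp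
  then have "commutator R (\<lambda>x\<in>carrier R. g \<otimes> D x) s = (\<lambda>x\<in>carrier R. \<zero>)" if "s \<in> carrier R" for s
    using that D(2) g by (auto simp: commutator_def fun_eq_iff restrict_def m_lcomm)
  with lin show ?case by (intro diff_operators_0I)
next
  case (Suc r)
  note D = linear_operatorsD[OF diff_operators_linear[OF Suc.prems(1)]]
  have lin: "(\<lambda>x\<in>carrier R. g \<otimes> D x) \<in> linear_operators A \<phi> R"
    using D g \<phi> by (auto simp: linear_operators_def r_distr m_lcomm)
  have "commutator R (\<lambda>x\<in>carrier R. g \<otimes> D x) s =
      (\<lambda>x\<in>carrier R. g \<otimes> commutator R D s x)" if "s \<in> carrier R" for s
    using that D(2) g by (auto simp: commutator_def fun_eq_iff restrict_def r_distr a_minus_def r_minus m_lcomm)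
  moreover have "(\<lambda>x\<in>carrier R. g \<otimes> commutator R D s x) \<in> diff_operators A \<phi> R r"
    if "s \<in> carrier R" for s
    using Suc.prems that by (intro Suc.IH diff_operators_commutator)
  ultimately show ?case using lin by (intro diff_operators_SucI) (simp_all only:)
qed

lemma diff_operators_sum:
  assumes "finite I" "\<And>i. i \<in> I \<Longrightarrow> D i \<in> diff_operators A \<phi> R r"
    and \<phi>: "\<And>a. a \<in> carrier A \<Longrightarrow> \<phi> a \<in> carrier R"
  shows "(\<lambda>x\<in>carrier R. \<Oplus>i\<in>I. D i x) \<in> diff_operators A \<phi> R r"
  using assms(1,2)
proof (induction I rule: finite_induct)
  case empty
  show ?case unfolding finsum_empty by (rule diff_operators_zero[OF \<phi>])
next
  case (insert j I)
  have c: "D i x \<in> carrier R" if "i \<in> insert j I" "x \<in> carrier R" for i x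
    using linear_operatorsD(2)[OF diff_operators_linear[OF insert.prems[OF that(1)]] that(2)] .
  have "(\<lambda>x\<in>carrier R. \<Oplus>i\<in>insert j I. D i x) =
      (\<lambda>x\<in>carrier R. D j x \<oplus> (\<lambda>x\<in>carrier R. \<Oplus>i\<in>I. D i x) x)"
    using insert.hyps c by (auto simp: fun_eq_iff restrict_def finsum_insert Pi_def)
  also have "\<dots> \<in> diff_operators A \<phi> R r"
    using insert by (intro diff_operators_add \<phi>) auto
  finally show ?case .
qed

end

text \<open>
  An operator on \<open>S\<close> that corresponds, under an injective ring homomorphism \<open>w\<close>, to a differential
  operator on \<open>L\<close> is a differential operator of the same order.  The scalars need not correspond;
  it is enough that \<open>w\<close> maps scalars of \<open>S\<close> to scalars of \<open>L\<close>.
\<close>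

lemma diff_operators_restrict:
  fixes S (structure) and L (structure)
  assumes S: "cring S" and L: "cring L"
    and w: "w \<in> ring_hom S L" and inj: "inj_on w (carrier S)"
    and \<phi>: "\<And>a. a \<in> carrier A \<Longrightarrow> \<phi> a \<in> carrier S"
    and \<psi>: "\<And>a. a \<in> carrier A \<Longrightarrow> \<exists>b\<in>carrier A. w (\<phi> a) = \<psi> b"
  shows "\<lbrakk>E \<in> diff_operators A \<psi> L r; D \<in> carrier S \<rightarrow>\<^sub>E carrier S;
      \<And>x. x \<in> carrier S \<Longrightarrow> w (D x) = E (w x)\<rbrakk> \<Longrightarrow> D \<in> diff_operators A \<phi> S r"
proof (induction r arbitrary: D E)
  case (0 D E)
  interpret S: cring S by (rule S)
  interpret L: cring L by (rule L)
  interpret ring_hom_cring S L w by unfold_locales (rule w)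
  note E = linear_operatorsD[OF diff_operators_linear[OF 0(1)]]
  have D [simp]: "D x \<in> carrier S" if "x \<in> carrier S" for x using 0(2) that by auto
  have lin: "D \<in> linear_operators A \<phi> S"
    unfolding linear_operators_def
  proof (intro CollectI conjI ballI)
    show "D (x \<oplus>\<^bsub>S\<^esub> y) = D x \<oplus>\<^bsub>S\<^esub> D y" if "x \<in> carrier S" "y \<in> carrier S" for x y
      using that by (intro inj_onD[OF inj]) (simp_all add: 0(3) E(3))
    show "D (\<phi> a \<otimes>\<^bsub>S\<^esub> x) = \<phi> a \<otimes>\<^bsub>S\<^esub> D x" if a: "a \<in> carrier A" and x: "x \<in> carrier S" for a x
    proof -
      obtain b where "b \<in> carrier A" "w (\<phi> a) = \<psi> b" using \<psi>[OF a] by blast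
      then show ?thesis using a x \<phi>[OF a] by (intro inj_onD[OF inj]) (simp_all add: 0(3) E(4))
    qed
  qed (rule 0(2))
  have "commutator S D s = (\<lambda>x\<in>carrier S. \<zero>\<^bsub>S\<^esub>)" if s: "s \<in> carrier S" for s
  proof
    fix x
    show "commutator S D s x = (\<lambda>x\<in>carrier S. \<zero>\<^bsub>S\<^esub>) x"
    proof (cases "x \<in> carrier S")
      case True
      have "w (D (s \<otimes>\<^bsub>S\<^esub> x) \<ominus>\<^bsub>S\<^esub> s \<otimes>\<^bsub>S\<^esub> D x) = E (w s \<otimes>\<^bsub>L\<^esub> w x) \<ominus>\<^bsub>L\<^esub> w s \<otimes>\<^bsub>L\<^esub> E (w x)"
        using True s by (simp add: a_minus_def 0(3))
      also have "\<dots> = w \<zero>\<^bsub>S\<^esub>" using True s diff_operators_commutator_0[OF 0(1)] by simp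
      finally have "D (s \<otimes>\<^bsub>S\<^esub> x) \<ominus>\<^bsub>S\<^esub> s \<otimes>\<^bsub>S\<^esub> D x = \<zero>\<^bsub>S\<^esub>"
        using True s by (intro inj_onD[OF inj]) simp_all
      then show ?thesis using True by (simp add: commutator_def)
    qed (simp add: commutator_def)
  qed
  with lin show ?case by (intro diff_operators_0I)
next
  case (Suc r D E)
  interpret S: cring S by (rule S)
  interpret L: cring L by (rule L)
  interpret ring_hom_cring S L w by unfold_locales (rule w)
  note E = linear_operatorsD[OF diff_operators_linear[OF Suc.prems(1)]]
  have D [simp]: "D x \<in> carrier S" if "x \<in> carrier S" for x using Suc.prems(2) that by auto
  have lin: "D \<in> linear_operators A \<phi> S"
    unfolding linear_operators_def
  proof (intro CollectI conjI ballI)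
    show "D (x \<oplus>\<^bsub>S\<^esub> y) = D x \<oplus>\<^bsub>S\<^esub> D y" if "x \<in> carrier S" "y \<in> carrier S" for x y
      using that by (intro inj_onD[OF inj]) (simp_all add: Suc.prems(3) E(3))
    show "D (\<phi> a \<otimes>\<^bsub>S\<^esub> x) = \<phi> a \<otimes>\<^bsub>S\<^esub> D x" if a: "a \<in> carrier A" and x: "x \<in> carrier S" for a x
    proof -
      obtain b where "b \<in> carrier A" "w (\<phi> a) = \<psi> b" using \<psi>[OF a] by blast
      then show ?thesis using a x \<phi>[OF a] by (intro inj_onD[OF inj]) (simp_all add: Suc.prems(3) E(4))
    qed
  qed (rule Suc.prems(2))
  have "commutator S D s \<in> diff_operators A \<phi> S r" if s: "s \<in> carrier S" for s
  proof (rule Suc.IH)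
    show "commutator L E (w s) \<in> diff_operators A \<psi> L r"
      using Suc.prems(1) s by (intro diff_operators_commutator) simp_all
    show "commutator S D s \<in> carrier S \<rightarrow>\<^sub>E carrier S" using s by (auto simp: commutator_def)
    show "w (commutator S D s x) = commutator L E (w s) (w x)" if "x \<in> carrier S" for x
      using that s by (simp add: commutator_def a_minus_def Suc.prems(3))
  qed
  with lin show ?case by (intro diff_operators_SucI)
qed


section \<open>Divided power derivations\<close>

lemma (in cring) add_pow_sum:
  fixes f :: "'i \<Rightarrow> nat"
  assumes "finite I" "x \<in> carrier R"
  shows "(\<Oplus>i\<in>I. [(f i)] \<cdot> x) = [(sum f I)] \<cdot> x"
  using assms by (induction I rule: finite_induct) (simp_all add: finsum_insert add.nat_pow_mult)

context poly_ring
begin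

sublocale P: cring P
  by (rule cring_P)

lemma coeff_add_pow: "f \<in> carrier P \<Longrightarrow> ([(k::nat)] \<cdot>\<^bsub>P\<^esub> f) e = [k] \<cdot> f e"
  by (induction k) (simp_all add: coeff_add, simp add: zero_P)

lemma mon_power:
  assumes "c \<in> carrier R" "a \<in> M"
  shows "mon c a [^]\<^bsub>P\<^esub> (k::nat) = mon (c [^] k) (nmult k a)"
  using assms by (induction k) (simp_all add: one_P_mon mon_mult_mon M_nmult add.commute)

lemma mon_add: "c \<in> carrier R \<Longrightarrow> d \<in> carrier R \<Longrightarrow> a \<in> M \<Longrightarrow> mon c a \<oplus>\<^bsub>P\<^esub> mon d a = mon (c \<oplus> d) a"
  by (simp add: fun_eq_iff coeff_add mon_apply)

lemma add_pow_mon: "c \<in> carrier R \<Longrightarrow> a \<in> M \<Longrightarrow> [(k::nat)] \<cdot>\<^bsub>P\<^esub> mon c a = mon ([k] \<cdot> c) a"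
  by (simp add: fun_eq_iff coeff_add_pow mon_apply)

lemma const_mult: "c \<in> carrier R \<Longrightarrow> f \<in> carrier P \<Longrightarrow> (mon c 0 \<otimes>\<^bsub>P\<^esub> f) e = c \<otimes> f e"
  using mon_mult(1)[of c 0 f e] by (simp add: M_zero)

text \<open>
  The \<open>r\<close>-th divided power of the derivation with respect to the distinguished variable.
\<close>

definition dpd :: "nat \<Rightarrow> ('e \<Rightarrow> 'a) \<Rightarrow> 'e \<Rightarrow> 'a" where
  "dpd r f = (\<lambda>e. [((cnt e + r) choose r)] \<cdot> f (e + nmult r u))"

lemma dpd_closed [simp]:
  assumes f: "f \<in> carrier P"
  shows "dpd r f \<in> carrier P"
proof -
  have nz: "f (e + nmult r u) \<noteq> \<zero>" if "dpd r f e \<noteq> \<zero>" for e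
    using that by (auto simp: dpd_def)
  have "inj (\<lambda>e. e + nmult r u)" by (simp add: inj_on_def)
  then have "finite ((\<lambda>e. e + nmult r u) -` {e. f e \<noteq> \<zero>})"
    using f by (intro finite_vimageI) (auto simp: carrier_P)
  moreover have "{e. dpd r f e \<noteq> \<zero>} \<subseteq> (\<lambda>e. e + nmult r u) -` {e. f e \<noteq> \<zero>}"
    using nz by auto
  ultimately have "finite {e. dpd r f e \<noteq> \<zero>}" by (rule rev_finite_subset)
  moreover have "e \<in> M" if "dpd r f e \<noteq> \<zero>" for e
    using nz[OF that] f M_add by (auto simp: carrier_P)
  moreover have "dpd r f e \<in> carrier R" for e
    using f by (simp add: dpd_def)
  ultimately show ?thesis by (auto simp: carrier_P)
qed

lemma dpd_add:
  "f \<in> carrier P \<Longrightarrow> g \<in> carrier P \<Longrightarrow> dpd r (f \<oplus>\<^bsub>P\<^esub> g) = dpd r f \<oplus>\<^bsub>P\<^esub> dpd r g"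
  by (simp add: fun_eq_iff coeff_add) (simp add: dpd_def coeff_add R.add.nat_pow_distrib)

lemma dpd_zero: "dpd r \<zero>\<^bsub>P\<^esub> = \<zero>\<^bsub>P\<^esub>"
  by (simp add: dpd_def zero_P)

lemma dpd_const_mult:
  assumes "c \<in> carrier R" "f \<in> carrier P"
  shows "dpd r (mon c 0 \<otimes>\<^bsub>P\<^esub> f) = mon c 0 \<otimes>\<^bsub>P\<^esub> dpd r f"
  using assms by (simp add: fun_eq_iff const_mult) (simp add: dpd_def const_mult R.add_pow_rdistr)

lemma dpd_mon:
  "dpd r (mon c (a + nmult r u)) = mon ([(cnt (a + nmult r u) choose r)] \<cdot> c) a"
  by (auto simp: fun_eq_iff dpd_def mon_apply cnt_add cnt_nmult cnt_u)

lemma dpd_mon_less: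
  assumes "cnt a < r"
  shows "dpd r (mon c a) = \<zero>\<^bsub>P\<^esub>"
proof -
  have "e + nmult r u \<noteq> a" for e
    using assms by (auto simp: cnt_add cnt_nmult cnt_u)
  then show ?thesis by (simp add: fun_eq_iff dpd_def mon_apply zero_P)
qed

lemma coeff_sum: "(\<And>i. i \<in> I \<Longrightarrow> f i \<in> carrier P) \<Longrightarrow> (\<Oplus>\<^bsub>P\<^esub>i\<in>I. f i) e = (\<Oplus>i\<in>I. f i e)"
  by (induction I rule: infinite_finite_induct) (simp_all add: coeff_add P.finsum_insert R.finsum_insert Pi_def, simp_all add: zero_P)

text \<open>
  On monomials the Leibniz rule is Vandermonde's identity.
\<close>

lemma Leibniz_mon:
  assumes c: "c \<in> carrier R" "d \<in> carrier R" and ab: "a \<in> M" "b \<in> M"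
  shows "dpd r (mon c a \<otimes>\<^bsub>P\<^esub> mon d b) = (\<Oplus>\<^bsub>P\<^esub>j\<in>{..r}. dpd j (mon c a) \<otimes>\<^bsub>P\<^esub> dpd (r - j) (mon d b))"
proof
  fix e
  define v where "v = (if e + nmult r u = a + b then c \<otimes> d else \<zero>)"
  have v: "v \<in> carrier R" using c by (simp add: v_def)
  have summand: "(dpd j (mon c a) \<otimes>\<^bsub>P\<^esub> dpd (r - j) (mon d b)) e = [((cnt a choose j) * (cnt b choose (r - j)))] \<cdot> v"
    if j: "j \<le> r" for j
  proof (cases "j \<le> cnt a \<and> r - j \<le> cnt b")
    case True
    obtain a' where a': "a = a' + nmult j u" using True cnt_ge by blast
    obtain b' where b': "b = b' + nmult (r - j) u" using True cnt_ge by blast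
    have M: "a' \<in> M" "b' \<in> M" using ab M_add a' b' by auto
    have ab': "a + b = a' + b' + nmult r u"
      using j nmult_add[of j "r - j" u] by (simp add: a' b' ac_simps)
    have eq: "dpd j (mon c a) \<otimes>\<^bsub>P\<^esub> dpd (r - j) (mon d b) =
        mon ([(cnt a choose j)] \<cdot> c \<otimes> [(cnt b choose (r - j))] \<cdot> d) (a' + b')"
      using c M by (simp add: a' b' dpd_mon mon_mult_mon)
    have "[(cnt a choose j)] \<cdot> c \<otimes> [(cnt b choose (r - j))] \<cdot> d =
        [((cnt a choose j) * (cnt b choose (r - j)))] \<cdot> (c \<otimes> d)"
      using c by (simp add: R.add_pow_ldistr R.add_pow_rdistr R.add.nat_pow_pow mult.commute)
    then show ?thesis unfolding eq v_def ab' by (simp add: mon_apply)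
  next
    case False
    then have "cnt a < j \<or> cnt b < r - j" by auto
    then show ?thesis
    proof
      assume "cnt a < j"
      then show ?thesis using c ab v by (simp add: dpd_mon_less binomial_eq_0) (simp add: zero_P)
    next
      assume "cnt b < r - j"
      then show ?thesis using c ab v by (simp add: dpd_mon_less binomial_eq_0) (simp add: zero_P)
    qed
  qed
  have "(\<Oplus>\<^bsub>P\<^esub>j\<in>{..r}. dpd j (mon c a) \<otimes>\<^bsub>P\<^esub> dpd (r - j) (mon d b)) e =
      (\<Oplus>j\<in>{..r}. (dpd j (mon c a) \<otimes>\<^bsub>P\<^esub> dpd (r - j) (mon d b)) e)"
    using c ab by (intro coeff_sum) simp
  also have "\<dots> = (\<Oplus>j\<in>{..r}. [((cnt a choose j) * (cnt b choose (r - j)))] \<cdot> v)"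
    using summand v by (intro R.finsum_cong') auto
  also have "\<dots> = [((cnt a + cnt b) choose r)] \<cdot> v"
    using v by (simp only: R.add_pow_sum finite_atMost vandermonde)
  also have "\<dots> = dpd r (mon (c \<otimes> d) (a + b)) e"
  proof (cases "e + nmult r u = a + b")
    case True
    have "cnt (a + b) = cnt e + r" unfolding True[symmetric] by (simp add: cnt_add cnt_nmult cnt_u)
    then have "cnt a + cnt b = cnt e + r" by (simp add: cnt_add)
    with True show ?thesis by (simp add: dpd_def mon_apply v_def)
  qed (simp add: dpd_def mon_apply v_def)
  finally show "dpd r (mon c a \<otimes>\<^bsub>P\<^esub> mon d b) e =
      (\<Oplus>\<^bsub>P\<^esub>j\<in>{..r}. dpd j (mon c a) \<otimes>\<^bsub>P\<^esub> dpd (r - j) (mon d b)) e"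
    using c ab by (simp add: mon_mult_mon)
qed

lemma Leibniz:
  assumes "f \<in> carrier P" "g \<in> carrier P"
  shows "dpd r (f \<otimes>\<^bsub>P\<^esub> g) = (\<Oplus>\<^bsub>P\<^esub>j\<in>{..r}. dpd j f \<otimes>\<^bsub>P\<^esub> dpd (r - j) g)"
  using assms(1)
proof (induction rule: poly_induct)
  case zero
  show ?case using assms by (simp add: dpd_zero)
next
  case (add c a f)
  have mon: "dpd r (mon c a \<otimes>\<^bsub>P\<^esub> g) = (\<Oplus>\<^bsub>P\<^esub>j\<in>{..r}. dpd j (mon c a) \<otimes>\<^bsub>P\<^esub> dpd (r - j) g)"
    using assms(2)
  proof (induction rule: poly_induct)
    case zero
    show ?case using add by (simp add: dpd_zero)
  next
    case (add d b g)
    then show ?case using \<open>c \<in> carrier R\<close> \<open>a \<in> M\<close>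
      by (simp add: P.r_distr dpd_add Leibniz_mon P.finsum_addf Pi_def)
  qed
  show ?case using add assms by (simp add: P.l_distr dpd_add mon P.finsum_addf Pi_def)
qed

lemma dpd_0: "f \<in> carrier P \<Longrightarrow> dpd 0 f = f"
  by (simp add: dpd_def fun_eq_iff)

lemma dpd_linear:
  assumes "\<And>a. a \<in> carrier R \<Longrightarrow> \<phi> a = mon a 0"
  shows "(\<lambda>f\<in>carrier P. dpd r f) \<in> linear_operators R \<phi> P"
  using assms by (auto simp: linear_operators_def dpd_add dpd_const_mult M_zero)

text \<open>
  By the Leibniz rule, the commutator of the \<open>r\<close>-th divided power with multiplication by \<open>s\<close> is a
  linear combination of divided powers of lower degree.
\<close>

lemma dpd_diff_operator:
  assumes \<phi>: "\<And>a. a \<in> carrier R \<Longrightarrow> \<phi> a = mon a 0"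
  shows "(\<lambda>f\<in>carrier P. dpd r f) \<in> diff_operators R \<phi> P r"
proof (induction r rule: less_induct)
  case (less r)
  have \<phi>c: "\<phi> a \<in> carrier P" if "a \<in> carrier R" for a
    using that by (simp add: \<phi> M_zero)
  show ?case
  proof (cases r)
    case 0
    have "commutator P (\<lambda>f\<in>carrier P. dpd 0 f) s = (\<lambda>x\<in>carrier P. \<zero>\<^bsub>P\<^esub>)" if "s \<in> carrier P" for s
    proof
      fix x show "commutator P (\<lambda>f\<in>carrier P. dpd 0 f) s x = (\<lambda>x\<in>carrier P. \<zero>\<^bsub>P\<^esub>) x"
        using that by (simp add: commutator_def dpd_0)
    qed
    then show ?thesis unfolding 0 by (intro diff_operators_0I dpd_linear \<phi>)
  next
    case (Suc k)
    have "commutator P (\<lambda>f\<in>carrier P. dpd (Suc k) f) s =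
        (\<lambda>x\<in>carrier P. \<Oplus>\<^bsub>P\<^esub>j\<in>{..k}. (\<lambda>x\<in>carrier P. dpd (Suc j) s \<otimes>\<^bsub>P\<^esub> (\<lambda>f\<in>carrier P. dpd (k - j) f) x) x)"
      if s: "s \<in> carrier P" for s
    proof
      fix x
      show "commutator P (\<lambda>f\<in>carrier P. dpd (Suc k) f) s x =
        (\<lambda>x\<in>carrier P. \<Oplus>\<^bsub>P\<^esub>j\<in>{..k}. (\<lambda>x\<in>carrier P. dpd (Suc j) s \<otimes>\<^bsub>P\<^esub> (\<lambda>f\<in>carrier P. dpd (k - j) f) x) x) x"
      proof (cases "x \<in> carrier P")
        case True
        have "dpd (Suc k) (s \<otimes>\<^bsub>P\<^esub> x) =
            (\<Oplus>\<^bsub>P\<^esub>j\<in>{..k}. dpd (Suc j) s \<otimes>\<^bsub>P\<^esub> dpd (k - j) x) \<oplus>\<^bsub>P\<^esub> s \<otimes>\<^bsub>P\<^esub> dpd (Suc k) x"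
          using True s by (simp add: Leibniz P.finsum_Suc2 Pi_def dpd_0 del: P.finsum_Suc)
        then have "dpd (Suc k) (s \<otimes>\<^bsub>P\<^esub> x) \<ominus>\<^bsub>P\<^esub> s \<otimes>\<^bsub>P\<^esub> dpd (Suc k) x =
            (\<Oplus>\<^bsub>P\<^esub>j\<in>{..k}. dpd (Suc j) s \<otimes>\<^bsub>P\<^esub> dpd (k - j) x)"
          using True s by (simp add: a_minus_def P.a_assoc P.r_neg)
        then show ?thesis using True s by (simp add: commutator_def)
      qed (simp add: commutator_def)
    qed
    moreover have "(\<lambda>x\<in>carrier P. \<Oplus>\<^bsub>P\<^esub>j\<in>{..k}. (\<lambda>x\<in>carrier P. dpd (Suc j) s \<otimes>\<^bsub>P\<^esub> (\<lambda>f\<in>carrier P. dpd (k - j) f) x) x)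
        \<in> diff_operators R \<phi> P k" if s: "s \<in> carrier P" for s
    proof (intro P.diff_operators_sum P.diff_operators_smult \<phi>c)
      fix j assume "j \<in> {..k}"
      show "(\<lambda>f\<in>carrier P. dpd (k - j) f) \<in> diff_operators R \<phi> P k"
        by (rule P.diff_operators_mono[OF \<phi>c diff_le_self[of k j]]) (simp_all add: Suc less.IH)
    qed (use s in auto)
    ultimately show ?thesis unfolding Suc by (intro diff_operators_SucI dpd_linear \<phi>) (simp_all only:)
  qed
qed

end


section \<open>Power congruences in rings with carrier\<close>

lemma ipoly_eval_Var_id: "ipoly_eval tcring Var P = P"
proof (induction P rule: ipoly_induct)
  case (monom e)
  show ?case by (simp add: tc.ipoly_eval_frag_of mon_eval_def prod_Var_power)
qed (simp_all add: tc.ipoly_eval_diff)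

lemma (in ring_hom_cring) hom_ipoly_eval:
  assumes "x \<in> UNIV \<rightarrow> carrier R"
  shows "h (ipoly_eval R x P) = ipoly_eval S (\<lambda>v. h (x v)) P"
proof -
  have "tc_hom S (h \<circ> ipoly_eval R x)"
    by (intro tc_hom.intro tc_hom_axioms.intro ring_hom_trans[OF R.ipoly_eval_hom[OF assms] homh] S.is_cring)
  from tc_hom.h_ipoly_eval[OF this, of Var P] show ?thesis
    using assms by (simp add: ipoly_eval_Var_id R.ipoly_eval_Var)
qed

context cring
begin

text \<open>
  The following congruences are identities between integer polynomials, evaluated.
\<close>

lemma freshman_iterated:
  fixes p m :: nat
  assumes p: "prime p" and ab: "a \<in> carrier R" "b \<in> carrier R"
  obtains q where "q \<in> carrier R" "(a \<oplus> b) [^] (p ^ m) = a [^] (p ^ m) \<oplus> b [^] (p ^ m) \<oplus> [p] \<cdot> q"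
proof -
  define v where "v = (\<lambda>j. if j = (0::nat) then a else b)"
  have v: "v \<in> UNIV \<rightarrow> carrier R" using ab by (simp add: v_def)
  interpret tc_hom R "ipoly_eval R v" by (rule tc_hom_ipoly_eval[OF v])
  obtain q :: "nat ipoly" where
    "(Var 0 + Var 1) ^ (p ^ m) - (Var 0 ^ (p ^ m) + Var 1 ^ (p ^ m)) = of_nat p * q"
    using freshman_dvd_iterated[OF p, of "Var 0 :: nat ipoly" "Var 1" m] by (elim dvdE)
  then have "(Var 0 + Var 1) ^ (p ^ m) = Var 0 ^ (p ^ m) + Var 1 ^ (p ^ m) + of_nat p * q"
    by (simp add: algebra_simps)
  then have "ipoly_eval R v ((Var 0 + Var 1) ^ (p ^ m)) =
      ipoly_eval R v (Var 0 ^ (p ^ m) + Var 1 ^ (p ^ m) + of_nat p * q)" by simp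
  then show ?thesis
    using that[of "ipoly_eval R v q"] by (simp add: h_power h_add h_of_nat_mult ipoly_eval_Var[OF v]) (simp add: v_def)
qed

lemma rgh_cong_mod:
  assumes a: "a \<in> UNIV \<rightarrow> carrier R" and b: "b \<in> UNIV \<rightarrow> carrier R"
  obtains q where "q \<in> carrier R"
    "rgh R p (\<lambda>i. a i \<oplus> [p] \<cdot> b i) m = rgh R p a m \<oplus> [(p ^ Suc m)] \<cdot> q"
proof -
  define v where "v = case_sum a b"
  have v: "v \<in> UNIV \<rightarrow> carrier R" using a b by (auto simp: v_def Pi_iff split: sum.splits)
  interpret tc_hom R "ipoly_eval R v" by (rule tc_hom_ipoly_eval[OF v])
  let ?X = "\<lambda>i. Var (Inl i) :: (nat + nat) ipoly"
  have "of_nat (p ^ Suc m) dvd gh p (\<lambda>i. ?X i + of_nat p * Var (Inr i)) m - gh p ?X m"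
    by (rule gh_cong) simp
  then obtain q where "gh p (\<lambda>i. ?X i + of_nat p * Var (Inr i)) m - gh p ?X m = of_nat (p ^ Suc m) * q"
    by (elim dvdE)
  then have "gh p (\<lambda>i. ?X i + of_nat p * Var (Inr i)) m = gh p ?X m + of_nat (p ^ Suc m) * q"
    by (simp add: algebra_simps)
  then have "ipoly_eval R v (gh p (\<lambda>i. ?X i + of_nat p * Var (Inr i)) m) =
      ipoly_eval R v (gh p ?X m + of_nat (p ^ Suc m) * q)" by simp
  then show ?thesis
    using that[of "ipoly_eval R v q"] v
    by (simp add: h_add h_of_nat_mult h_gh ipoly_eval_Var del: of_nat_power power_Suc) (simp add: v_def)
qed

text \<open>
  If the entries before the \<open>i\<close>-th vanish, the ghost component is \<open>p ^ i\<close> times a power of the \<open>i\<close>-th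
  entry, up to a multiple of \<open>p ^ Suc i\<close>.
\<close>

lemma rgh_leading:
  assumes p: "p > 0" and a: "a \<in> UNIV \<rightarrow> carrier R" and i: "i \<le> m"
  obtains q where "q \<in> carrier R"
    "rgh R p (\<lambda>j. if j < i then \<zero> else a j) m = [(p ^ i)] \<cdot> (a i [^] (p ^ (m - i)) \<oplus> [p] \<cdot> q)"
proof -
  interpret tc_hom R "ipoly_eval R a" by (rule tc_hom_ipoly_eval[OF a])
  let ?Z = "\<lambda>j. if j < i then 0 else Var j :: nat ipoly"
  have "gh p ?Z m - of_nat (p ^ i) * Var i ^ (p ^ (m - i)) =
      (\<Sum>j\<in>{..m} - {i}. of_nat (p ^ j) * ?Z j ^ (p ^ (m - j)))"
    using i by (simp add: gh_def sum.remove[of "{..m}" i])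
  also have "of_nat (p ^ Suc i) dvd \<dots>"
  proof (rule dvd_sum)
    fix j assume j: "j \<in> {..m} - {i}"
    show "of_nat (p ^ Suc i) dvd of_nat (p ^ j) * ?Z j ^ (p ^ (m - j))"
    proof (cases "j < i")
      case True
      then show ?thesis using p by (simp add: zero_power)
    next
      case False
      then have "Suc i \<le> j" using j by auto
      then have "of_nat (p ^ Suc i) dvd (of_nat (p ^ j) :: nat ipoly)"
        by (simp add: le_imp_power_dvd del: power_Suc)
      then show ?thesis by (rule dvd_mult2)
    qed
  qed
  finally obtain q where "gh p ?Z m - of_nat (p ^ i) * Var i ^ (p ^ (m - i)) = of_nat (p ^ Suc i) * q"
    by (elim dvdE)
  then have "gh p ?Z m = of_nat (p ^ i) * (Var i ^ (p ^ (m - i)) + of_nat p * q)"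
    by (simp add: algebra_simps)
  then have "ipoly_eval R a (gh p ?Z m) = ipoly_eval R a (of_nat (p ^ i) * (Var i ^ (p ^ (m - i)) + of_nat p * q))"
    by simp
  moreover have "(\<lambda>j. ipoly_eval R a (?Z j)) = (\<lambda>j. if j < i then \<zero> else a j)"
    by (simp add: fun_eq_iff h_zero ipoly_eval_Var[OF a])
  ultimately show ?thesis
    using that[of "ipoly_eval R a q"] a
    by (simp add: h_add h_power h_of_nat_mult h_gh ipoly_eval_Var del: of_nat_power)
qed

lemma rgh_single:
  assumes p: "p > 0" and a: "a \<in> carrier R" and i: "i \<le> m"
  shows "rgh R p (\<lambda>j. if j = i then a else \<zero>) m = [(p ^ i)] \<cdot> (a [^] (p ^ (m - i)))"
proof -
  have v: "(\<lambda>_::nat. a) \<in> UNIV \<rightarrow> carrier R" using a by simp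
  interpret tc_hom R "ipoly_eval R (\<lambda>_::nat. a)" by (rule tc_hom_ipoly_eval[OF v])
  have "ipoly_eval R (\<lambda>_::nat. a) (gh p (\<lambda>j. if j = i then Var 0 else 0) m) =
     ipoly_eval R (\<lambda>_::nat. a) (of_nat (p ^ i) * Var 0 ^ (p ^ (m - i)))"
    by (simp add: gh_single[OF p i])
  moreover have "(\<lambda>j. ipoly_eval R (\<lambda>_::nat. a) (if j = i then Var 0 else 0)) = (\<lambda>j. if j = i then a else \<zero>)"
    by (simp add: fun_eq_iff h_zero ipoly_eval_Var[OF v])
  ultimately show ?thesis
    by (simp add: h_power h_of_nat_mult h_gh ipoly_eval_Var[OF v] del: of_nat_power)
qed

lemma rgh_closed: "a \<in> {..m} \<rightarrow> carrier R \<Longrightarrow> rgh R p a m \<in> carrier R"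
  unfolding rgh_def by (intro finsum_closed) auto

lemma rgh_eq:
  assumes "b \<in> {..m} \<rightarrow> carrier R" "\<And>i. i \<le> m \<Longrightarrow> a i = b i"
  shows "rgh R p a m = rgh R p b m"
  unfolding rgh_def using assms by (intro finsum_cong') auto

end


section \<open>The ring homomorphism to the lift\<close>

text \<open>
  \<open>B\<close> is a perfect algebra over the field with \<open>p\<close> elements, \<open>S\<close> a polynomial ring over \<open>B\<close> and \<open>L\<close> its
  lift, the polynomial ring over the Witt vectors \<open>W\<close> of \<open>B\<close> in the same variables.  \<open>WS\<close> denotes the
  Witt vectors of \<open>S\<close>.
\<close>

locale witt_lift =
  S: poly_ring M u cnt B S + L: poly_ring M u cnt "witt p n B" L
  for p n :: nat and M :: "'e::cancel_comm_monoid_add set" and u cnt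
    and B :: "('a, 'm) ring_scheme" and S :: "('e \<Rightarrow> 'a, 'l) ring_scheme"
    and L :: "('e \<Rightarrow> nat \<Rightarrow> 'a, 'k) ring_scheme" +
  assumes p: "prime p" and perfect: "perfect_Fp_algebra p B"
begin

abbreviation "W \<equiv> witt p n B"
abbreviation "WS \<equiv> witt p n S"

lemma p0: "p > 0"
  using p prime_gt_0_nat by blast

lemma char_B: "[p] \<cdot>\<^bsub>B\<^esub> \<one>\<^bsub>B\<^esub> = \<zero>\<^bsub>B\<^esub>"
  using perfect by (simp add: perfect_Fp_algebra_def)

lemma p_power_0: "(0::nat) < p ^ m"
  using p0 by simp

lemma B_root:
  assumes "a \<in> carrier B"
  obtains b where "b \<in> carrier B" "b [^]\<^bsub>B\<^esub> (p ^ m) = a"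
proof -
  have "\<exists>b\<in>carrier B. b [^]\<^bsub>B\<^esub> (p ^ m) = a"
    using assms
  proof (induction m arbitrary: a)
    case (Suc m)
    have "a \<in> (\<lambda>x. x [^]\<^bsub>B\<^esub> p) ` carrier B"
      using perfect Suc.prems by (simp add: perfect_Fp_algebra_def bij_betw_def)
    then obtain c where c: "c \<in> carrier B" "a = c [^]\<^bsub>B\<^esub> p" by blast
    obtain b where b: "b \<in> carrier B" "b [^]\<^bsub>B\<^esub> (p ^ m) = c" using Suc.IH[OF c(1)] by blast
    have "b [^]\<^bsub>B\<^esub> (p ^ Suc m) = (b [^]\<^bsub>B\<^esub> (p ^ m)) [^]\<^bsub>B\<^esub> p"
      using b(1) by (simp add: S.R.nat_pow_pow mult.commute)
    with b c show ?case by (intro bexI[of _ b]) (simp_all only:)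
  qed simp
  then show ?thesis using that by blast
qed

lemma B_power_eq_0:
  assumes "a \<in> carrier B" "a [^]\<^bsub>B\<^esub> (p ^ m) = \<zero>\<^bsub>B\<^esub>"
  shows "a = \<zero>\<^bsub>B\<^esub>"
  using assms
proof (induction m arbitrary: a)
  case (Suc m)
  have inj: "inj_on (\<lambda>x. x [^]\<^bsub>B\<^esub> p) (carrier B)"
    using perfect by (simp add: perfect_Fp_algebra_def bij_betw_def)
  have "(a [^]\<^bsub>B\<^esub> p) [^]\<^bsub>B\<^esub> (p ^ m) = \<zero>\<^bsub>B\<^esub>"
    using Suc.prems by (simp add: S.R.nat_pow_pow)
  then have "a [^]\<^bsub>B\<^esub> p = \<zero>\<^bsub>B\<^esub>" using Suc by simp
  also have "\<dots> = \<zero>\<^bsub>B\<^esub> [^]\<^bsub>B\<^esub> p" using p0 by (simp add: S.R.nat_pow_zero)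
  finally have eq: "a [^]\<^bsub>B\<^esub> p = \<zero>\<^bsub>B\<^esub> [^]\<^bsub>B\<^esub> p" .
  show ?case by (rule inj_onD[OF inj eq]) (use Suc.prems in simp_all)
qed simp

lemma W_p_power:
  "x \<in> carrier W \<Longrightarrow> [(p ^ k)] \<cdot>\<^bsub>W\<^esub> x = (\<lambda>i\<in>{..n}. if i < k then \<zero>\<^bsub>B\<^esub> else x (i - k) [^]\<^bsub>B\<^esub> (p ^ k))"
  by (rule S.R.witt_add_pow_p_power[OF p char_B])

lemma W_coeff_closed: "x \<in> carrier W \<Longrightarrow> i \<le> n \<Longrightarrow> x i \<in> carrier B"
  by (auto simp: carrier_witt)

lemma W_zero: "\<zero>\<^bsub>W\<^esub> = (\<lambda>i\<in>{..n}. \<zero>\<^bsub>B\<^esub>)"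
  by (simp add: witt_def)

text \<open>
  Because \<open>B\<close> is perfect, the kernel of the map that takes the entry with index \<open>0\<close> is generated by \<open>p\<close>.
\<close>

lemma W_dvd_p:
  assumes x: "x \<in> carrier W" "x 0 = \<zero>\<^bsub>B\<^esub>"
  shows "\<exists>y\<in>carrier W. x = [p] \<cdot>\<^bsub>W\<^esub> y"
proof -
  have "\<exists>b. b \<in> carrier B \<and> (Suc i \<le> n \<longrightarrow> b [^]\<^bsub>B\<^esub> p = x (Suc i))" for i
  proof (cases "Suc i \<le> n")
    case True
    obtain b where "b \<in> carrier B" "b [^]\<^bsub>B\<^esub> (p ^ 1) = x (Suc i)"
      using B_root[OF W_coeff_closed[OF x(1) True]] .
    then show ?thesis by auto
  qed auto
  then obtain y where y: "\<And>i. y i \<in> carrier B" "\<And>i. Suc i \<le> n \<Longrightarrow> y i [^]\<^bsub>B\<^esub> p = x (Suc i)"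
    by metis
  let ?y = "\<lambda>i\<in>{..n}. y i"
  have yW: "?y \<in> carrier W" using y by (auto simp: carrier_witt)
  have "[p] \<cdot>\<^bsub>W\<^esub> ?y = (\<lambda>i\<in>{..n}. case i of 0 \<Rightarrow> \<zero>\<^bsub>B\<^esub> | Suc j \<Rightarrow> ?y j [^]\<^bsub>B\<^esub> p)"
    by (rule S.R.witt_add_pow_p[OF p char_B yW])
  also have "\<dots> = x"
  proof
    fix i show "(\<lambda>i\<in>{..n}. case i of 0 \<Rightarrow> \<zero>\<^bsub>B\<^esub> | Suc j \<Rightarrow> ?y j [^]\<^bsub>B\<^esub> p) i = x i"
      using x y(2) by (cases i) (auto simp: carrier_witt PiE_def extensional_def)
  qed
  finally show ?thesis using yW by metis
qed

lemma W_p_top: "x \<in> carrier W \<Longrightarrow> [(p ^ Suc n)] \<cdot>\<^bsub>W\<^esub> x = \<zero>\<^bsub>W\<^esub>"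
  by (subst W_p_power) (auto simp: W_zero fun_eq_iff restrict_def)

text \<open>
  For \<open>k \<le> n\<close>, multiplication by \<open>p ^ k\<close> loses no information modulo \<open>p\<close>.
\<close>

lemma W_p_cancel:
  assumes "x \<in> carrier W" "y \<in> carrier W" "k \<le> n" "[(p ^ k)] \<cdot>\<^bsub>W\<^esub> x = [(p ^ Suc k)] \<cdot>\<^bsub>W\<^esub> y"
  shows "x 0 = \<zero>\<^bsub>B\<^esub>"
proof -
  have "([(p ^ k)] \<cdot>\<^bsub>W\<^esub> x) k = ([(p ^ Suc k)] \<cdot>\<^bsub>W\<^esub> y) k" using assms by simp
  then have "x 0 [^]\<^bsub>B\<^esub> (p ^ k) = \<zero>\<^bsub>B\<^esub>"
    unfolding W_p_power[OF assms(1)] W_p_power[OF assms(2)] using assms(3) by simp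
  then show ?thesis using B_power_eq_0 W_coeff_closed[OF assms(1)] by blast
qed

interpretation W0: ring_hom_cring W B "\<lambda>x. x 0"
  by unfold_locales (rule S.R.witt_zeroth_hom[OF p])

lemma reduction_closed:
  assumes f: "f \<in> carrier L"
  shows "reduction f \<in> carrier S"
proof -
  have nz: "f e \<noteq> \<zero>\<^bsub>W\<^esub>" if "reduction f e \<noteq> \<zero>\<^bsub>B\<^esub>" for e
    using that by (auto simp: reduction_def W_zero)
  have "{e. reduction f e \<noteq> \<zero>\<^bsub>B\<^esub>} \<subseteq> {e. f e \<noteq> \<zero>\<^bsub>W\<^esub>}" using nz by auto
  then have "finite {e. reduction f e \<noteq> \<zero>\<^bsub>B\<^esub>}"
    using f by (elim finite_subset) (simp add: L.carrier_P)
  moreover have "reduction f e \<in> carrier B" for e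
    using f by (auto simp: reduction_def intro: W_coeff_closed)
  ultimately show ?thesis using nz f by (auto simp: S.carrier_P L.carrier_P)
qed

lemma reduction_hom: "reduction \<in> ring_hom L S"
proof (rule ring_hom_memI)
  fix f g assume fg: "f \<in> carrier L" "g \<in> carrier L"
  show "reduction f \<in> carrier S" using fg(1) by (rule reduction_closed)
  show "reduction (f \<otimes>\<^bsub>L\<^esub> g) = reduction f \<otimes>\<^bsub>S\<^esub> reduction g"
  proof
    fix e
    have "reduction (f \<otimes>\<^bsub>L\<^esub> g) e = (\<Oplus>\<^bsub>W\<^esub>x\<in>{x. fst x + snd x = e}. f (fst x) \<otimes>\<^bsub>W\<^esub> g (snd x)) 0"
      using fg by (simp add: reduction_def L.mult_P)
    also have "\<dots> = (\<Oplus>\<^bsub>B\<^esub>x\<in>{x. fst x + snd x = e}. f (fst x) 0 \<otimes>\<^bsub>B\<^esub> g (snd x) 0)"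
      using fg by (subst W0.hom_finsum) (auto intro!: S.R.finsum_cong')
    finally show "reduction (f \<otimes>\<^bsub>L\<^esub> g) e = (reduction f \<otimes>\<^bsub>S\<^esub> reduction g) e"
      using fg reduction_closed by (simp add: S.mult_P) (simp add: reduction_def)
  qed
  show "reduction (f \<oplus>\<^bsub>L\<^esub> g) = reduction f \<oplus>\<^bsub>S\<^esub> reduction g"
  proof
    fix e show "reduction (f \<oplus>\<^bsub>L\<^esub> g) e = (reduction f \<oplus>\<^bsub>S\<^esub> reduction g) e"
      using fg reduction_closed by (simp add: S.coeff_add) (simp add: reduction_def L.coeff_add)
  qed
next
  show "reduction \<one>\<^bsub>L\<^esub> = \<one>\<^bsub>S\<^esub>"
    by (simp add: reduction_def L.one_P S.one_P fun_eq_iff)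
qed

sublocale red: ring_hom_cring L S reduction
  by unfold_locales (rule reduction_hom)

lemma L_dvd_p:
  assumes f: "f \<in> carrier L" and z: "reduction f = \<zero>\<^bsub>S\<^esub>"
  obtains h where "h \<in> carrier L" "f = [p] \<cdot>\<^bsub>L\<^esub> h"
proof -
  have "\<exists>y\<in>carrier W. f e = [p] \<cdot>\<^bsub>W\<^esub> y" for e
    using f fun_cong[OF z, of e] by (intro W_dvd_p) (simp_all add: reduction_def S.zero_P)
  then obtain y where y: "\<And>e. y e \<in> carrier W" "\<And>e. f e = [p] \<cdot>\<^bsub>W\<^esub> y e" by metis
  define h where "h = (\<lambda>e. if f e = \<zero>\<^bsub>W\<^esub> then \<zero>\<^bsub>W\<^esub> else y e)"
  have "{e. h e \<noteq> \<zero>\<^bsub>W\<^esub>} \<subseteq> {e. f e \<noteq> \<zero>\<^bsub>W\<^esub>}" by (auto simp: h_def)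
  then have "finite {e. h e \<noteq> \<zero>\<^bsub>W\<^esub>}"
    using f by (elim finite_subset) (simp add: L.carrier_P)
  moreover have "h e \<in> carrier W" for e using y by (simp add: h_def)
  moreover have "e \<in> M" if "h e \<noteq> \<zero>\<^bsub>W\<^esub>" for e
    using that f by (auto simp: h_def L.carrier_P split: if_splits)
  ultimately have hL: "h \<in> carrier L" by (auto simp: L.carrier_P)
  have "f e = ([p] \<cdot>\<^bsub>L\<^esub> h) e" for e
    using y(2)[of e] by (simp add: L.coeff_add_pow[OF hL]) (simp add: h_def)
  then show ?thesis using that hL by blast
qed

lemma reduction_p: "f \<in> carrier L \<Longrightarrow> reduction ([p] \<cdot>\<^bsub>L\<^esub> f) = \<zero>\<^bsub>S\<^esub>"
proof
  fix e assume f: "f \<in> carrier L"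
  have "([p] \<cdot>\<^bsub>W\<^esub> f e) 0 = \<zero>\<^bsub>B\<^esub>"
    using W_p_power[of "f e" 1] f by simp
  then show "reduction ([p] \<cdot>\<^bsub>L\<^esub> f) e = \<zero>\<^bsub>S\<^esub> e"
    using f by (simp add: reduction_def L.coeff_add_pow S.zero_P)
qed

lemma reduction_eq:
  assumes fg: "f \<in> carrier L" "g \<in> carrier L" and eq: "reduction f = reduction g"
  obtains h where "h \<in> carrier L" "f = g \<oplus>\<^bsub>L\<^esub> [p] \<cdot>\<^bsub>L\<^esub> h"
proof -
  have "reduction (f \<ominus>\<^bsub>L\<^esub> g) = \<zero>\<^bsub>S\<^esub>"
    using fg eq by (simp add: a_minus_def S.P.r_neg)
  then obtain h where h: "h \<in> carrier L" "f \<ominus>\<^bsub>L\<^esub> g = [p] \<cdot>\<^bsub>L\<^esub> h"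
    using L_dvd_p[of "f \<ominus>\<^bsub>L\<^esub> g"] fg by auto
  have "f = g \<oplus>\<^bsub>L\<^esub> (f \<ominus>\<^bsub>L\<^esub> g)"
    using fg by (simp add: a_minus_def L.P.a_lcomm L.P.r_neg)
  then show ?thesis using that h by simp
qed

lemma L_p_top: "f \<in> carrier L \<Longrightarrow> [(p ^ Suc n)] \<cdot>\<^bsub>L\<^esub> f = \<zero>\<^bsub>L\<^esub>"
  by (rule ext) (simp add: L.coeff_add_pow W_p_top L.zero_P del: power_Suc)

lemma L_p_cancel:
  assumes "f \<in> carrier L" "g \<in> carrier L" "k \<le> n" "[(p ^ k)] \<cdot>\<^bsub>L\<^esub> f = [(p ^ Suc k)] \<cdot>\<^bsub>L\<^esub> g"
  shows "reduction f = \<zero>\<^bsub>S\<^esub>"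
proof
  fix e
  have "([(p ^ k)] \<cdot>\<^bsub>L\<^esub> f) e = ([(p ^ Suc k)] \<cdot>\<^bsub>L\<^esub> g) e" using assms(4) by simp
  then have "[(p ^ k)] \<cdot>\<^bsub>W\<^esub> f e = [(p ^ Suc k)] \<cdot>\<^bsub>W\<^esub> g e"
    using assms(1,2) by (simp add: L.coeff_add_pow del: power_Suc)
  then show "reduction f e = \<zero>\<^bsub>S\<^esub> e"
    using W_p_cancel[of "f e" "g e" k] assms(1-3) by (simp add: reduction_def S.zero_P del: power_Suc)
qed

lemma lift_exists:
  assumes s: "s \<in> carrier S"
  obtains g where "g \<in> carrier L" "reduction g = s"
proof -
  define g where "g = (\<lambda>e. \<lambda>i\<in>{..n}. if i = 0 then s e else \<zero>\<^bsub>B\<^esub>)"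
  have nz: "s e \<noteq> \<zero>\<^bsub>B\<^esub>" if "g e \<noteq> \<zero>\<^bsub>W\<^esub>" for e
  proof
    assume "s e = \<zero>\<^bsub>B\<^esub>"
    then have "g e = \<zero>\<^bsub>W\<^esub>" by (auto simp: g_def W_zero fun_eq_iff restrict_def)
    with that show False by simp
  qed
  then have "{e. g e \<noteq> \<zero>\<^bsub>W\<^esub>} \<subseteq> {e. s e \<noteq> \<zero>\<^bsub>B\<^esub>}" by auto
  then have "finite {e. g e \<noteq> \<zero>\<^bsub>W\<^esub>}"
    using s by (elim finite_subset) (simp add: S.carrier_P)
  moreover have "g e \<in> carrier W" for e using s by (auto simp: g_def carrier_witt)
  ultimately have "g \<in> carrier L" using nz s by (auto simp: L.carrier_P S.carrier_P)
  moreover have "reduction g = s" by (simp add: reduction_def g_def fun_eq_iff)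
  ultimately show ?thesis using that by blast
qed

lemma char_S: "f \<in> carrier S \<Longrightarrow> [p] \<cdot>\<^bsub>S\<^esub> f = \<zero>\<^bsub>S\<^esub>"
proof
  fix e assume f: "f \<in> carrier S"
  have "[p] \<cdot>\<^bsub>B\<^esub> f e = ([p] \<cdot>\<^bsub>B\<^esub> \<one>\<^bsub>B\<^esub>) \<otimes>\<^bsub>B\<^esub> f e"
    using f by (simp add: S.R.add_pow_ldistr)
  then show "([p] \<cdot>\<^bsub>S\<^esub> f) e = \<zero>\<^bsub>S\<^esub> e"
    using f by (simp add: S.coeff_add_pow char_B S.zero_P)
qed

lemma char_B_all: "a \<in> carrier B \<Longrightarrow> [p] \<cdot>\<^bsub>B\<^esub> a = \<zero>\<^bsub>B\<^esub>"
  using S.R.add_pow_ldistr[of "\<one>\<^bsub>B\<^esub>" a p] by (simp add: char_B)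

text \<open>
  Additivity of Frobenius on \<open>S\<close>, read off on coefficients; it makes \<open>S\<close> reduced.
\<close>

lemma S_coeff_power:
  assumes "f \<in> carrier S"
  shows "(f [^]\<^bsub>S\<^esub> (p ^ m)) (nmult (p ^ m) e) = f e [^]\<^bsub>B\<^esub> (p ^ m)"
  using assms
proof (induction rule: S.poly_induct)
  case zero
  have "\<zero>\<^bsub>S\<^esub> [^]\<^bsub>S\<^esub> (p ^ m) = \<zero>\<^bsub>S\<^esub>" using p_power_0 by (intro S.P.nat_pow_zero) simp
  moreover have "\<zero>\<^bsub>B\<^esub> [^]\<^bsub>B\<^esub> (p ^ m) = \<zero>\<^bsub>B\<^esub>" using p_power_0 by (intro S.R.nat_pow_zero) simp
  ultimately show ?case by (simp add: S.zero_P)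
next
  case (add c a f)
  have mon: "S.mon c a \<in> carrier S" using add by simp
  obtain q where "q \<in> carrier S" "(S.mon c a \<oplus>\<^bsub>S\<^esub> f) [^]\<^bsub>S\<^esub> (p ^ m) =
      S.mon c a [^]\<^bsub>S\<^esub> (p ^ m) \<oplus>\<^bsub>S\<^esub> f [^]\<^bsub>S\<^esub> (p ^ m) \<oplus>\<^bsub>S\<^esub> [p] \<cdot>\<^bsub>S\<^esub> q"
    using S.P.freshman_iterated[OF p mon add(3)] .
  then have eq: "(S.mon c a \<oplus>\<^bsub>S\<^esub> f) [^]\<^bsub>S\<^esub> (p ^ m) = S.mon c a [^]\<^bsub>S\<^esub> (p ^ m) \<oplus>\<^bsub>S\<^esub> f [^]\<^bsub>S\<^esub> (p ^ m)"
    using mon add by (simp add: char_S)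
  obtain r where "r \<in> carrier B" "(S.mon c a e \<oplus>\<^bsub>B\<^esub> f e) [^]\<^bsub>B\<^esub> (p ^ m) =
      S.mon c a e [^]\<^bsub>B\<^esub> (p ^ m) \<oplus>\<^bsub>B\<^esub> f e [^]\<^bsub>B\<^esub> (p ^ m) \<oplus>\<^bsub>B\<^esub> [p] \<cdot>\<^bsub>B\<^esub> r"
    using S.R.freshman_iterated[OF p S.coeff_closed[OF mon] S.coeff_closed[OF add(3)]] .
  then have eqB: "(S.mon c a e \<oplus>\<^bsub>B\<^esub> f e) [^]\<^bsub>B\<^esub> (p ^ m) =
      S.mon c a e [^]\<^bsub>B\<^esub> (p ^ m) \<oplus>\<^bsub>B\<^esub> f e [^]\<^bsub>B\<^esub> (p ^ m)"
    using S.coeff_closed[OF mon] S.coeff_closed[OF add(3)] by (simp add: char_B_all)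
  have "(S.mon c a [^]\<^bsub>S\<^esub> (p ^ m)) (nmult (p ^ m) e) = S.mon c a e [^]\<^bsub>B\<^esub> (p ^ m)"
  proof (cases "e = a")
    case True
    then show ?thesis using add by (simp add: S.mon_power S.mon_apply)
  next
    case False
    then have "nmult (p ^ m) e \<noteq> nmult (p ^ m) a" using S.nmult_inj[OF p_power_0] by blast
    moreover have "\<zero>\<^bsub>B\<^esub> [^]\<^bsub>B\<^esub> (p ^ m) = \<zero>\<^bsub>B\<^esub>" using p_power_0 by (intro S.R.nat_pow_zero) simp
    ultimately show ?thesis using add False by (simp add: S.mon_power S.mon_apply)
  qed
  then show ?case unfolding eq S.coeff_add[OF mon add(3), of e] eqB
    using add mon by (subst S.coeff_add) simp_all
qed

lemma S_power_eq_0: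
  assumes "f \<in> carrier S" "f [^]\<^bsub>S\<^esub> (p ^ m) = \<zero>\<^bsub>S\<^esub>"
  shows "f = \<zero>\<^bsub>S\<^esub>"
proof
  fix e
  have "f e [^]\<^bsub>B\<^esub> (p ^ m) = \<zero>\<^bsub>B\<^esub>"
    using S_coeff_power[OF assms(1), of m e] assms(2) by (simp add: S.zero_P)
  then show "f e = \<zero>\<^bsub>S\<^esub> e" using B_power_eq_0 assms(1) by (simp add: S.zero_P)
qed

end

context witt_lift
begin

sublocale WS: cring "witt p n S" by (rule S.P.cring_witt[OF p])

abbreviation "wt \<equiv> w_tilde p n L"

text \<open>
  The value of \<^const>\<open>w_tilde\<close> does not depend on the lifts: a change of the lifts by multiples of \<open>p\<close>
  changes it by a multiple of \<open>p ^ Suc n\<close>, which is zero in \<open>L\<close>.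
\<close>

lemma w_tilde_eq_rgh:
  assumes x: "x \<in> carrier WS" and a: "\<And>i. i \<le> n \<Longrightarrow> a i \<in> carrier L"
    and red: "\<And>i. i \<le> n \<Longrightarrow> reduction (a i) = x i"
  shows "wt x = rgh L p a n"
proof -
  define b where "b = (\<lambda>i. SOME g. g \<in> carrier L \<and> reduction g = x i)"
  have b: "b i \<in> carrier L \<and> reduction (b i) = x i" if "i \<le> n" for i
    unfolding b_def by (rule someI[where x = "a i"]) (use a red that in blast)
  have "wt x = rgh L p b n"
    by (simp add: w_tilde_def rgh_def b_def)
  have "\<exists>h. h \<in> carrier L \<and> (i \<le> n \<longrightarrow> b i = a i \<oplus>\<^bsub>L\<^esub> [p] \<cdot>\<^bsub>L\<^esub> h)" for i
  proof (cases "i \<le> n")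
    case True
    have "b i \<in> carrier L" "a i \<in> carrier L" "reduction (b i) = reduction (a i)"
      using b[OF True] a[OF True] red[OF True] by simp_all
    then obtain h where "h \<in> carrier L" "b i = a i \<oplus>\<^bsub>L\<^esub> [p] \<cdot>\<^bsub>L\<^esub> h"
      by (rule reduction_eq)
    then show ?thesis by blast
  next
    case False
    then show ?thesis using L.P.zero_closed by blast
  qed
  then obtain h where h: "\<And>i. h i \<in> carrier L" "\<And>i. i \<le> n \<Longrightarrow> b i = a i \<oplus>\<^bsub>L\<^esub> [p] \<cdot>\<^bsub>L\<^esub> h i"
    by metis
  define a' where "a' = (\<lambda>i. if i \<le> n then a i else \<zero>\<^bsub>L\<^esub>)"
  have a': "a' \<in> UNIV \<rightarrow> carrier L" using a by (auto simp: a'_def)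
  have h': "h \<in> UNIV \<rightarrow> carrier L" using h by simp
  obtain q where "q \<in> carrier L"
    "rgh L p (\<lambda>i. a' i \<oplus>\<^bsub>L\<^esub> [p] \<cdot>\<^bsub>L\<^esub> h i) n = rgh L p a' n \<oplus>\<^bsub>L\<^esub> [(p ^ Suc n)] \<cdot>\<^bsub>L\<^esub> q"
    using L.P.rgh_cong_mod[OF a' h', of p n] .
  then have "rgh L p (\<lambda>i. a' i \<oplus>\<^bsub>L\<^esub> [p] \<cdot>\<^bsub>L\<^esub> h i) n = rgh L p a' n"
    using a' by (simp add: L_p_top L.P.rgh_closed Pi_iff del: power_Suc)
  moreover have "rgh L p b n = rgh L p (\<lambda>i. a' i \<oplus>\<^bsub>L\<^esub> [p] \<cdot>\<^bsub>L\<^esub> h i) n"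
    using a' h a by (intro L.P.rgh_eq) (auto simp: a'_def)
  moreover have "rgh L p a n = rgh L p a' n"
    using a by (intro L.P.rgh_eq) (auto simp: a'_def)
  ultimately show ?thesis using \<open>wt x = rgh L p b n\<close> by simp
qed

lemma lifts_exist:
  assumes x: "x \<in> carrier WS"
  shows "\<exists>a. a \<in> UNIV \<rightarrow> carrier L \<and> (\<forall>i\<le>n. reduction (a i) = x i) \<and>
    (\<forall>i. x i = \<zero>\<^bsub>S\<^esub> \<longrightarrow> a i = \<zero>\<^bsub>L\<^esub>)"
proof -
  have "\<exists>g. g \<in> carrier L \<and> (i \<le> n \<longrightarrow> reduction g = x i) \<and> (x i = \<zero>\<^bsub>S\<^esub> \<longrightarrow> g = \<zero>\<^bsub>L\<^esub>)" for i
  proof (cases "x i = \<zero>\<^bsub>S\<^esub> \<or> \<not> i \<le> n")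
    case True
    then show ?thesis by (intro exI[of _ "\<zero>\<^bsub>L\<^esub>"]) auto
  next
    case False
    then have "x i \<in> carrier S" using x by (auto simp: carrier_witt)
    then show ?thesis using False lift_exists by metis
  qed
  then obtain a where "\<And>i. a i \<in> carrier L \<and> (i \<le> n \<longrightarrow> reduction (a i) = x i) \<and> (x i = \<zero>\<^bsub>S\<^esub> \<longrightarrow> a i = \<zero>\<^bsub>L\<^esub>)"
    by metis
  then show ?thesis by (intro exI[of _ a]) auto
qed

lemma w_tilde_closed: "x \<in> carrier WS \<Longrightarrow> wt x \<in> carrier L"
proof -
  assume x: "x \<in> carrier WS"
  obtain a where a: "a \<in> UNIV \<rightarrow> carrier L" "\<forall>i\<le>n. reduction (a i) = x i"
    "\<forall>i. x i = \<zero>\<^bsub>S\<^esub> \<longrightarrow> a i = \<zero>\<^bsub>L\<^esub>"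
    using lifts_exist[OF x] by blast
  have "wt x = rgh L p a n" using a by (intro w_tilde_eq_rgh x) auto
  then show "wt x \<in> carrier L" using a by (auto intro!: L.P.rgh_closed)
qed

lemma reduction_ipoly_eval:
  assumes a: "a \<in> UNIV \<rightarrow> carrier L" "\<forall>i\<le>n. reduction (a i) = x i"
    and b: "b \<in> UNIV \<rightarrow> carrier L" "\<forall>i\<le>n. reduction (b i) = y i"
    and P: "P \<in> ipoly_over (Inl ` {..i} \<union> Inr ` {..i})" "i \<le> n"
  shows "reduction (ipoly_eval L (case_sum a b) P) = ipoly_eval S (case_sum x y) P"
proof -
  have ab: "case_sum a b \<in> UNIV \<rightarrow> carrier L"
    using a b by (auto simp: Pi_iff split: sum.splits)
  have "ipoly_eval S (case_sum x y) P = ipoly_eval S (\<lambda>v. reduction (case_sum a b v)) P"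
    using P(2) a b ab by (intro S.P.ipoly_eval_cong[OF P(1)]) auto
  then show ?thesis by (simp add: red.hom_ipoly_eval[OF ab])
qed

text \<open>
  The Witt polynomials in lifts of the entries are lifts of the entries of the sum and of the product.
\<close>

lemma w_tilde_hom: "wt \<in> ring_hom WS L"
proof (rule ring_hom_memI)
  fix x y assume x: "x \<in> carrier WS" and y: "y \<in> carrier WS"
  show "wt x \<in> carrier L" by (rule w_tilde_closed[OF x])
  obtain a where a: "a \<in> UNIV \<rightarrow> carrier L" "\<forall>i\<le>n. reduction (a i) = x i"
    "\<forall>i. x i = \<zero>\<^bsub>S\<^esub> \<longrightarrow> a i = \<zero>\<^bsub>L\<^esub>"
    using lifts_exist[OF x] by blast
  obtain b where b: "b \<in> UNIV \<rightarrow> carrier L" "\<forall>i\<le>n. reduction (b i) = y i"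
    "\<forall>i. y i = \<zero>\<^bsub>S\<^esub> \<longrightarrow> b i = \<zero>\<^bsub>L\<^esub>"
    using lifts_exist[OF y] by blast
  have ab: "case_sum a b \<in> UNIV \<rightarrow> carrier L"
    using a b by (auto simp: Pi_iff split: sum.splits)
  have wx: "wt x = rgh L p a n" using a by (intro w_tilde_eq_rgh x) auto
  have wy: "wt y = rgh L p b n" using b by (intro w_tilde_eq_rgh y) auto
  have "wt (x \<otimes>\<^bsub>WS\<^esub> y) = rgh L p (\<lambda>i. ipoly_eval L (case_sum a b) (witt_prod_poly p i)) n"
  proof (rule w_tilde_eq_rgh)
    show "x \<otimes>\<^bsub>WS\<^esub> y \<in> carrier WS" using x y by simp
    fix i assume i: "i \<le> n"
    show "reduction (ipoly_eval L (case_sum a b) (witt_prod_poly p i)) = (x \<otimes>\<^bsub>WS\<^esub> y) i"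
      using i by (simp add: reduction_ipoly_eval[OF a(1,2) b(1,2) witt_polys_over(2)[OF p] i] witt_def eval_int_mpoly_eq)
  qed (use ab in simp)
  then show "wt (x \<otimes>\<^bsub>WS\<^esub> y) = wt x \<otimes>\<^bsub>L\<^esub> wt y"
    by (simp add: wx wy L.P.rgh_witt_polys[OF p a(1) b(1)])
  have "wt (x \<oplus>\<^bsub>WS\<^esub> y) = rgh L p (\<lambda>i. ipoly_eval L (case_sum a b) (witt_sum_poly p i)) n"
  proof (rule w_tilde_eq_rgh)
    show "x \<oplus>\<^bsub>WS\<^esub> y \<in> carrier WS" using x y by simp
    fix i assume i: "i \<le> n"
    show "reduction (ipoly_eval L (case_sum a b) (witt_sum_poly p i)) = (x \<oplus>\<^bsub>WS\<^esub> y) i"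
      using i by (simp add: reduction_ipoly_eval[OF a(1,2) b(1,2) witt_polys_over(1)[OF p] i] witt_def eval_int_mpoly_eq)
  qed (use ab in simp)
  then show "wt (x \<oplus>\<^bsub>WS\<^esub> y) = wt x \<oplus>\<^bsub>L\<^esub> wt y"
    by (simp add: wx wy L.P.rgh_witt_polys[OF p a(1) b(1)])
next
  have "wt \<one>\<^bsub>WS\<^esub> = rgh L p (\<lambda>j. if j = 0 then \<one>\<^bsub>L\<^esub> else \<zero>\<^bsub>L\<^esub>) n"
    by (rule w_tilde_eq_rgh) (auto simp: witt_def)
  also have "\<dots> = \<one>\<^bsub>L\<^esub>" using L.P.rgh_single[OF p0, of "\<one>\<^bsub>L\<^esub>" 0 n] by simp
  finally show "wt \<one>\<^bsub>WS\<^esub> = \<one>\<^bsub>L\<^esub>" .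
qed

sublocale wt: ring_hom_cring "witt p n S" L "w_tilde p n L"
  by unfold_locales (rule w_tilde_hom)


section \<open>Injectivity\<close>

lemma w_tilde_leading:
  assumes x: "x \<in> carrier WS" and z: "\<And>j. j < i \<Longrightarrow> x j = \<zero>\<^bsub>S\<^esub>" and i: "i \<le> n"
  obtains a q where "a \<in> carrier L" "q \<in> carrier L" "reduction a = x i"
    "wt x = [(p ^ i)] \<cdot>\<^bsub>L\<^esub> (a [^]\<^bsub>L\<^esub> (p ^ (n - i)) \<oplus>\<^bsub>L\<^esub> [p] \<cdot>\<^bsub>L\<^esub> q)"
proof -
  obtain a where a: "a \<in> UNIV \<rightarrow> carrier L" "\<forall>i\<le>n. reduction (a i) = x i"
    "\<forall>i. x i = \<zero>\<^bsub>S\<^esub> \<longrightarrow> a i = \<zero>\<^bsub>L\<^esub>"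
    using lifts_exist[OF x] by blast
  have "wt x = rgh L p (\<lambda>j. if j < i then \<zero>\<^bsub>L\<^esub> else a j) n"
    using a z by (intro w_tilde_eq_rgh x) auto
  moreover obtain q where "q \<in> carrier L" "rgh L p (\<lambda>j. if j < i then \<zero>\<^bsub>L\<^esub> else a j) n =
      [(p ^ i)] \<cdot>\<^bsub>L\<^esub> (a i [^]\<^bsub>L\<^esub> (p ^ (n - i)) \<oplus>\<^bsub>L\<^esub> [p] \<cdot>\<^bsub>L\<^esub> q)"
    using L.P.rgh_leading[OF p0 a(1) i] .
  ultimately show ?thesis using a i by (intro that[of "a i" q]) auto
qed

lemma w_tilde_div_next:
  assumes x: "x \<in> carrier WS" and z: "\<And>j. j < i \<Longrightarrow> x j = \<zero>\<^bsub>S\<^esub>" and i: "i \<le> n"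
    and g: "g \<in> carrier L" "wt x = [(p ^ Suc i)] \<cdot>\<^bsub>L\<^esub> g"
  shows "x i = \<zero>\<^bsub>S\<^esub>"
proof -
  obtain a q where a: "a \<in> carrier L" "q \<in> carrier L" "reduction a = x i"
    "wt x = [(p ^ i)] \<cdot>\<^bsub>L\<^esub> (a [^]\<^bsub>L\<^esub> (p ^ (n - i)) \<oplus>\<^bsub>L\<^esub> [p] \<cdot>\<^bsub>L\<^esub> q)"
    using w_tilde_leading[OF x z i] .
  have "reduction (a [^]\<^bsub>L\<^esub> (p ^ (n - i)) \<oplus>\<^bsub>L\<^esub> [p] \<cdot>\<^bsub>L\<^esub> q) = \<zero>\<^bsub>S\<^esub>"
    using a g i by (intro L_p_cancel[of _ g i]) auto
  moreover have "reduction (a [^]\<^bsub>L\<^esub> (k::nat)) = reduction a [^]\<^bsub>S\<^esub> k" for k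
    using a(1) by (induction k) simp_all
  ultimately have "x i [^]\<^bsub>S\<^esub> (p ^ (n - i)) = \<zero>\<^bsub>S\<^esub>"
    using a red.hom_closed[OF a(1)] by (simp add: reduction_p)
  then show ?thesis using S_power_eq_0 red.hom_closed[OF a(1)] a(3) by metis
qed

text \<open>
  If the value is divisible by \<open>p ^ m\<close>, the entries before the \<open>m\<close>-th vanish.  The case \<open>m = Suc n\<close> is
  injectivity.
\<close>

lemma w_tilde_div:
  assumes x: "x \<in> carrier WS" and m: "m \<le> Suc n"
    and g: "g \<in> carrier L" "wt x = [(p ^ m)] \<cdot>\<^bsub>L\<^esub> g"
  shows "j < m \<Longrightarrow> x j = \<zero>\<^bsub>S\<^esub>"
proof (induction j rule: less_induct)
  case (less j)
  have "p ^ m = p ^ (m - Suc j) * p ^ Suc j"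
    using less.prems by (simp del: power_Suc flip: power_add)
  then have eq: "wt x = [(p ^ Suc j)] \<cdot>\<^bsub>L\<^esub> ([(p ^ (m - Suc j))] \<cdot>\<^bsub>L\<^esub> g)"
    using g by (simp add: L.P.add.nat_pow_pow del: power_Suc)
  show ?case
    by (rule w_tilde_div_next[OF x _ _ _ eq]) (use less m g in auto)
qed

lemma w_tilde_eq_zero:
  assumes x: "x \<in> carrier WS" and "wt x = \<zero>\<^bsub>L\<^esub>"
  shows "x = \<zero>\<^bsub>WS\<^esub>"
proof
  fix i
  have "x j = \<zero>\<^bsub>S\<^esub>" if "j < Suc n" for j
    using that assms(2) by (intro w_tilde_div[OF x, of "Suc n" "\<zero>\<^bsub>L\<^esub>"]) (auto simp: L.P.add.nat_pow_one)
  then show "x i = \<zero>\<^bsub>WS\<^esub> i"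
    using x by (auto simp: witt_def PiE_def extensional_def)
qed

lemma w_tilde_inj: "inj_on wt (carrier WS)"
proof (rule inj_onI)
  fix x y assume xy: "x \<in> carrier WS" "y \<in> carrier WS" "wt x = wt y"
  then have "wt (x \<ominus>\<^bsub>WS\<^esub> y) = \<zero>\<^bsub>L\<^esub>"
    by (simp add: a_minus_def L.P.r_neg)
  then have "x \<ominus>\<^bsub>WS\<^esub> y = \<zero>\<^bsub>WS\<^esub>" using xy by (intro w_tilde_eq_zero) auto
  then show "x = y" using xy by simp
qed


section \<open>The image of the homomorphism\<close>

text \<open>
  The additive span of the monomials with a coefficient divisible by \<open>p ^ i\<close> and an exponent divisible
  by \<open>p ^ (n - i)\<close>, for some \<open>i \<le> n\<close>.
\<close>

inductive_set span :: "('e \<Rightarrow> nat \<Rightarrow> 'a) set" where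
  zero: "\<zero>\<^bsub>L\<^esub> \<in> span"
| add: "\<lbrakk>i \<le> n; c \<in> carrier W; e \<in> M; g \<in> span\<rbrakk> \<Longrightarrow>
    [(p ^ i)] \<cdot>\<^bsub>L\<^esub> L.mon c (nmult (p ^ (n - i)) e) \<oplus>\<^bsub>L\<^esub> g \<in> span"

lemma span_closed: "g \<in> span \<Longrightarrow> g \<in> carrier L"
  by (induction rule: span.induct) (auto simp: S.M_nmult)

lemma span_add: "f \<in> span \<Longrightarrow> g \<in> span \<Longrightarrow> f \<oplus>\<^bsub>L\<^esub> g \<in> span"
proof (induction rule: span.induct)
  case zero
  then show ?case by (simp add: span_closed)
next
  case (add i c e f)
  then have "[(p ^ i)] \<cdot>\<^bsub>L\<^esub> L.mon c (nmult (p ^ (n - i)) e) \<oplus>\<^bsub>L\<^esub> (f \<oplus>\<^bsub>L\<^esub> g) \<in> span"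
    by (intro span.add) auto
  then show ?case using add by (simp add: L.P.a_assoc span_closed S.M_nmult)
qed

lemma span_generator:
  assumes "i \<le> n" "c \<in> carrier W" "e \<in> M"
  shows "[(p ^ i)] \<cdot>\<^bsub>L\<^esub> L.mon c (nmult (p ^ (n - i)) e) \<in> span"
  using span.add[OF assms span.zero] assms by (simp add: S.M_nmult)

lemma image_add: "f \<in> wt ` carrier WS \<Longrightarrow> g \<in> wt ` carrier WS \<Longrightarrow> f \<oplus>\<^bsub>L\<^esub> g \<in> wt ` carrier WS"
proof (elim imageE)
  fix x y assume "f = wt x" "x \<in> carrier WS" "g = wt y" "y \<in> carrier WS"
  then have "f \<oplus>\<^bsub>L\<^esub> g = wt (x \<oplus>\<^bsub>WS\<^esub> y)" "x \<oplus>\<^bsub>WS\<^esub> y \<in> carrier WS" by simp_all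
  then show ?thesis by blast
qed

text \<open>
  By downward induction on \<open>i\<close>.  Up to a multiple of \<open>p\<close>, the coefficient is a \<open>p ^ (n - i)\<close>-th power,
  since \<open>B\<close> is perfect; for such a coefficient the element comes from a Witt vector with a single
  nonzero entry.  Truncated subtraction makes the case \<open>i = Suc n\<close> meaningful: the element is zero.
\<close>

lemma generator_in_image:
  assumes "i \<le> Suc n" "c \<in> carrier W" "e \<in> M"
  shows "[(p ^ i)] \<cdot>\<^bsub>L\<^esub> L.mon c (nmult (p ^ (n - i)) e) \<in> wt ` carrier WS"
  using assms
proof (induction i arbitrary: c e rule: inc_induct)
  case base
  have "L.mon c (nmult (p ^ (n - Suc n)) e) \<in> carrier L" using base by (simp add: S.M_nmult)
  then have "[(p ^ Suc n)] \<cdot>\<^bsub>L\<^esub> L.mon c (nmult (p ^ (n - Suc n)) e) = wt \<zero>\<^bsub>WS\<^esub>"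
    by (simp add: L_p_top del: power_Suc)
  then show ?case by blast
next
  case (step i)
  then have i: "i \<le> n" and c: "c \<in> carrier W" and e: "e \<in> M" by auto
  obtain b where b: "b \<in> carrier B" "b [^]\<^bsub>B\<^esub> (p ^ (n - i)) = c 0"
    using B_root[OF W_coeff_closed[OF c, of 0]] by auto
  define b' where "b' = (\<lambda>i\<in>{..n}. if i = 0 then b else \<zero>\<^bsub>B\<^esub>)"
  have b': "b' \<in> carrier W" "b' 0 = b" using b by (auto simp: b'_def carrier_witt)
  interpret W0: ring_hom_cring W B "\<lambda>x. x 0"
    by unfold_locales (rule S.R.witt_zeroth_hom[OF p])
  have "(b' [^]\<^bsub>W\<^esub> k) 0 = b [^]\<^bsub>B\<^esub> k" for k :: nat
    using b' by (induction k) simp_all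
  then have "(c \<ominus>\<^bsub>W\<^esub> b' [^]\<^bsub>W\<^esub> (p ^ (n - i))) 0 = \<zero>\<^bsub>B\<^esub>"
    using b b' c W_coeff_closed[OF c, of 0] by (simp add: a_minus_def S.R.r_neg)
  then obtain d where d: "d \<in> carrier W" "c \<ominus>\<^bsub>W\<^esub> b' [^]\<^bsub>W\<^esub> (p ^ (n - i)) = [p] \<cdot>\<^bsub>W\<^esub> d"
    using W_dvd_p[of "c \<ominus>\<^bsub>W\<^esub> b' [^]\<^bsub>W\<^esub> (p ^ (n - i))"] b' c by auto
  have cd: "c = b' [^]\<^bsub>W\<^esub> (p ^ (n - i)) \<oplus>\<^bsub>W\<^esub> [p] \<cdot>\<^bsub>W\<^esub> d"
    using c b' by (simp add: a_minus_def L.R.a_lcomm L.R.r_neg flip: d(2))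
  \<comment> \<open>The Witt vector with single nonzero entry accounts for the summand that is a power.\<close>
  let ?x = "\<lambda>j\<in>{..n}. if j = i then S.mon b e else \<zero>\<^bsub>S\<^esub>"
  have x: "?x \<in> carrier WS" using b e by (auto simp: carrier_witt)
  have red: "reduction (L.mon b' e) = S.mon b e"
    using b'(2) by (auto simp: reduction_def fun_eq_iff L.mon_apply S.mon_apply W_zero)
  have "wt ?x = rgh L p (\<lambda>j. if j = i then L.mon b' e else \<zero>\<^bsub>L\<^esub>) n"
    using b' e red by (intro w_tilde_eq_rgh x) auto
  also have "\<dots> = [(p ^ i)] \<cdot>\<^bsub>L\<^esub> (L.mon b' e [^]\<^bsub>L\<^esub> (p ^ (n - i)))"
    using b' e i by (intro L.P.rgh_single p0) auto
  also have "L.mon b' e [^]\<^bsub>L\<^esub> (p ^ (n - i)) = L.mon (b' [^]\<^bsub>W\<^esub> (p ^ (n - i))) (nmult (p ^ (n - i)) e)"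
    using b' e by (simp add: L.mon_power)
  finally have wx: "wt ?x = [(p ^ i)] \<cdot>\<^bsub>L\<^esub> L.mon (b' [^]\<^bsub>W\<^esub> (p ^ (n - i))) (nmult (p ^ (n - i)) e)" .
  have rest: "[(p ^ i)] \<cdot>\<^bsub>L\<^esub> L.mon ([p] \<cdot>\<^bsub>W\<^esub> d) (nmult (p ^ (n - i)) e) \<in> wt ` carrier WS"
  proof (cases "i = n")
    case True
    have "[(p ^ i)] \<cdot>\<^bsub>L\<^esub> L.mon ([p] \<cdot>\<^bsub>W\<^esub> d) (nmult (p ^ (n - i)) e) =
        [(p ^ Suc i)] \<cdot>\<^bsub>L\<^esub> L.mon d (nmult (p ^ (n - i)) e)"
      using d e by (simp add: L.add_pow_mon S.M_nmult L.R.add.nat_pow_pow)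
    then show ?thesis using step.IH[of d e] d e True by simp
  next
    case False
    then have ni: "n - i = Suc (n - Suc i)" using i by simp
    have "nmult (p ^ (n - i)) e = nmult (p ^ (n - Suc i)) (nmult p e)"
      unfolding ni power_Suc2 nmult_mult ..
    then have "[(p ^ i)] \<cdot>\<^bsub>L\<^esub> L.mon ([p] \<cdot>\<^bsub>W\<^esub> d) (nmult (p ^ (n - i)) e) =
        [(p ^ Suc i)] \<cdot>\<^bsub>L\<^esub> L.mon d (nmult (p ^ (n - Suc i)) (nmult p e))"
      using d e by (simp add: L.add_pow_mon S.M_nmult L.R.add.nat_pow_pow)
    then show ?thesis using step.IH[of d "nmult p e"] d e S.M_nmult by simp
  qed
  have "[(p ^ i)] \<cdot>\<^bsub>L\<^esub> L.mon c (nmult (p ^ (n - i)) e) =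
      [(p ^ i)] \<cdot>\<^bsub>L\<^esub> L.mon (b' [^]\<^bsub>W\<^esub> (p ^ (n - i))) (nmult (p ^ (n - i)) e) \<oplus>\<^bsub>L\<^esub>
      [(p ^ i)] \<cdot>\<^bsub>L\<^esub> L.mon ([p] \<cdot>\<^bsub>W\<^esub> d) (nmult (p ^ (n - i)) e)"
    using b' d e by (subst cd) (simp add: S.M_nmult L.P.add.nat_pow_distrib flip: L.mon_add)
  also have "\<dots> \<in> wt ` carrier WS" using rest x unfolding wx[symmetric] by (intro image_add) auto
  finally show ?case .
qed

lemma span_subset_image: "span \<subseteq> wt ` carrier WS"
proof
  fix g assume "g \<in> span"
  then show "g \<in> wt ` carrier WS"
  proof (induction rule: span.induct)
    case zero
    have "\<zero>\<^bsub>L\<^esub> = wt \<zero>\<^bsub>WS\<^esub>" by simp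
    then show ?case by blast
  next
    case (add i c e g)
    then show ?case by (intro image_add generator_in_image) auto
  qed
qed

text \<open>
  Modulo \<open>p\<close>, the \<open>p ^ (n - i)\<close>-th power of a polynomial is the sum of the powers of its monomials.
\<close>

lemma power_mod_p_in_span:
  assumes a: "a \<in> carrier L" and i: "i \<le> n"
  shows "\<exists>g\<in>carrier L. \<exists>q\<in>carrier L. [(p ^ i)] \<cdot>\<^bsub>L\<^esub> g \<in> span \<and>
    a [^]\<^bsub>L\<^esub> (p ^ (n - i)) = g \<oplus>\<^bsub>L\<^esub> [p] \<cdot>\<^bsub>L\<^esub> q"
  using a
proof (induction rule: L.poly_induct)
  case zero
  have "\<zero>\<^bsub>L\<^esub> [^]\<^bsub>L\<^esub> (p ^ (n - i)) = \<zero>\<^bsub>L\<^esub> \<oplus>\<^bsub>L\<^esub> [p] \<cdot>\<^bsub>L\<^esub> \<zero>\<^bsub>L\<^esub>"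
    using p0 by (subst L.P.nat_pow_zero) simp_all
  then show ?case using span.zero
    by (intro bexI[of _ "\<zero>\<^bsub>L\<^esub>"]) (auto simp: L.P.add.nat_pow_one)
next
  case (add c e f)
  then obtain g q where g: "g \<in> carrier L" "q \<in> carrier L" "[(p ^ i)] \<cdot>\<^bsub>L\<^esub> g \<in> span"
    "f [^]\<^bsub>L\<^esub> (p ^ (n - i)) = g \<oplus>\<^bsub>L\<^esub> [p] \<cdot>\<^bsub>L\<^esub> q" by blast
  have mon: "L.mon c e \<in> carrier L" using add by simp
  obtain r where r: "r \<in> carrier L" "(L.mon c e \<oplus>\<^bsub>L\<^esub> f) [^]\<^bsub>L\<^esub> (p ^ (n - i)) =
      L.mon c e [^]\<^bsub>L\<^esub> (p ^ (n - i)) \<oplus>\<^bsub>L\<^esub> f [^]\<^bsub>L\<^esub> (p ^ (n - i)) \<oplus>\<^bsub>L\<^esub> [p] \<cdot>\<^bsub>L\<^esub> r"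
    using L.P.freshman_iterated[OF p mon add(3)] .
  let ?m = "L.mon (c [^]\<^bsub>W\<^esub> (p ^ (n - i))) (nmult (p ^ (n - i)) e)"
  have m: "?m \<in> carrier L" using add by (simp add: S.M_nmult)
  have "[(p ^ i)] \<cdot>\<^bsub>L\<^esub> (?m \<oplus>\<^bsub>L\<^esub> g) = [(p ^ i)] \<cdot>\<^bsub>L\<^esub> ?m \<oplus>\<^bsub>L\<^esub> [(p ^ i)] \<cdot>\<^bsub>L\<^esub> g"
    using m g by (simp add: L.P.add.nat_pow_distrib)
  also have "\<dots> \<in> span" using add g i by (intro span.add) auto
  finally have "[(p ^ i)] \<cdot>\<^bsub>L\<^esub> (?m \<oplus>\<^bsub>L\<^esub> g) \<in> span" .
  moreover have "(L.mon c e \<oplus>\<^bsub>L\<^esub> f) [^]\<^bsub>L\<^esub> (p ^ (n - i)) = (?m \<oplus>\<^bsub>L\<^esub> g) \<oplus>\<^bsub>L\<^esub> [p] \<cdot>\<^bsub>L\<^esub> (q \<oplus>\<^bsub>L\<^esub> r)"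
    using r g m add by (simp add: L.mon_power L.P.add.nat_pow_distrib L.P.a_assoc)
  ultimately show ?case using m g r by (intro bexI[of _ "?m \<oplus>\<^bsub>L\<^esub> g"] bexI[of _ "q \<oplus>\<^bsub>L\<^esub> r"] conjI) auto
qed

text \<open>
  By downward induction on \<open>i\<close>: subtracting a Witt vector whose image is the leading part, which lies
  in the span, leaves a Witt vector with one more vanishing entry.
\<close>

lemma w_tilde_in_span:
  assumes "i \<le> Suc n" "x \<in> carrier WS" "\<And>j. j < i \<Longrightarrow> x j = \<zero>\<^bsub>S\<^esub>"
  shows "wt x \<in> span"
  using assms
proof (induction i arbitrary: x rule: inc_induct)
  case base
  have "x = \<zero>\<^bsub>WS\<^esub>"
  proof
    fix i show "x i = \<zero>\<^bsub>WS\<^esub> i"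
      using base by (cases "i \<le> n") (auto simp: witt_def PiE_def extensional_def)
  qed
  then show ?case using span.zero by simp
next
  case (step i)
  then have i: "i \<le> n" by simp
  obtain a q where a: "a \<in> carrier L" "q \<in> carrier L" "reduction a = x i"
    "wt x = [(p ^ i)] \<cdot>\<^bsub>L\<^esub> (a [^]\<^bsub>L\<^esub> (p ^ (n - i)) \<oplus>\<^bsub>L\<^esub> [p] \<cdot>\<^bsub>L\<^esub> q)"
    using w_tilde_leading[OF step.prems(1,2) i] .
  obtain g r where g: "g \<in> carrier L" "r \<in> carrier L" "[(p ^ i)] \<cdot>\<^bsub>L\<^esub> g \<in> span"
    "a [^]\<^bsub>L\<^esub> (p ^ (n - i)) = g \<oplus>\<^bsub>L\<^esub> [p] \<cdot>\<^bsub>L\<^esub> r"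
    using power_mod_p_in_span[OF a(1) i] by blast
  have "[(p ^ i)] \<cdot>\<^bsub>L\<^esub> g \<in> wt ` carrier WS"
    using g(3) span_subset_image by blast
  then obtain z where z: "z \<in> carrier WS" "[(p ^ i)] \<cdot>\<^bsub>L\<^esub> g = wt z"
    by (elim imageE)
  have eq: "wt x = [(p ^ i)] \<cdot>\<^bsub>L\<^esub> g \<oplus>\<^bsub>L\<^esub> [(p ^ Suc i)] \<cdot>\<^bsub>L\<^esub> (r \<oplus>\<^bsub>L\<^esub> q)"
  proof -
    have "wt x = [(p ^ i)] \<cdot>\<^bsub>L\<^esub> (g \<oplus>\<^bsub>L\<^esub> [p] \<cdot>\<^bsub>L\<^esub> (r \<oplus>\<^bsub>L\<^esub> q))"
      using a g by (simp add: L.P.add.nat_pow_distrib L.P.a_assoc)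
    also have "\<dots> = [(p ^ i)] \<cdot>\<^bsub>L\<^esub> g \<oplus>\<^bsub>L\<^esub> [(p ^ i)] \<cdot>\<^bsub>L\<^esub> ([p] \<cdot>\<^bsub>L\<^esub> (r \<oplus>\<^bsub>L\<^esub> q))"
      using a g by (intro L.P.add.nat_pow_distrib) auto
    also have "[(p ^ i)] \<cdot>\<^bsub>L\<^esub> ([p] \<cdot>\<^bsub>L\<^esub> (r \<oplus>\<^bsub>L\<^esub> q)) = [(p ^ Suc i)] \<cdot>\<^bsub>L\<^esub> (r \<oplus>\<^bsub>L\<^esub> q)"
      using a g by (subst L.P.add.nat_pow_pow) auto
    finally show ?thesis .
  qed
  let ?y = "x \<ominus>\<^bsub>WS\<^esub> z"
  have y: "?y \<in> carrier WS" using z step.prems by simp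
  have "wt ?y = wt x \<ominus>\<^bsub>L\<^esub> wt z" using z step.prems by (simp add: a_minus_def)
  also have "\<dots> = [(p ^ Suc i)] \<cdot>\<^bsub>L\<^esub> (r \<oplus>\<^bsub>L\<^esub> q)"
    unfolding eq z(2)[symmetric] using a g
    by (simp add: a_minus_def L.P.a_ac L.P.r_neg2 del: power_Suc)
  finally have wy: "wt ?y = [(p ^ Suc i)] \<cdot>\<^bsub>L\<^esub> (r \<oplus>\<^bsub>L\<^esub> q)" .
  have "?y j = \<zero>\<^bsub>S\<^esub>" if "j < Suc i" for j
    using that i a g by (intro w_tilde_div[OF y _ _ wy]) auto
  then have "wt ?y \<in> span" using y by (intro step.IH) auto
  then have "[(p ^ i)] \<cdot>\<^bsub>L\<^esub> g \<oplus>\<^bsub>L\<^esub> wt ?y \<in> span" using g(3) by (intro span_add)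
  then show ?case by (simp only: wy eq)
qed

lemma image_eq_span: "wt ` carrier WS = span"
proof
  show "wt ` carrier WS \<subseteq> span" using w_tilde_in_span[of 0] by auto
qed (rule span_subset_image)

end

section \<open>Stability of the image under the divided power derivations\<close>

text \<open>
  The absorption identity \<open>r * (s choose r) = s * ((s - 1) choose (r - 1))\<close> lets \<open>p ^ N\<close> be split
  between \<open>r\<close> and the binomial coefficient.
\<close>

lemma prime_power_dvd_binomial:
  assumes p: "prime (p::nat)" and N: "p ^ N dvd s"
  obtains k where "k \<le> N" "p ^ k dvd r" "p ^ (N - k) dvd (s choose r)"
proof -
  \<comment> \<open>The exponent \<open>k\<close> is \<open>N\<close> or the valuation of \<open>r\<close>, whichever is smaller.\<close>
  have "gcd r (p ^ N) dvd p ^ N" by simp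
  then obtain k where k: "k \<le> N" "gcd r (p ^ N) = p ^ k"
    using divides_primepow_nat[OF p] by blast
  have "p ^ (N - k) dvd (s choose r)"
  proof (cases "r = 0")
    case True
    then have "p ^ k = p ^ N" using k by simp
    then have "k = N" using prime_gt_1_nat[OF p] by simp
    then show ?thesis by simp
  next
    case False
    have pN: "p ^ N = p ^ k * p ^ (N - k)" using k by (simp flip: power_add)
    obtain r' where r': "r = p ^ k * r'" using k(2) by (metis dvdE gcd_dvd1)
    have "r * (s choose r) = s * ((s - 1) choose (r - 1))"
      using False by (intro times_binomial_minus1_eq) simp
    then have "p ^ k * p ^ (N - k) dvd p ^ k * (r' * (s choose r))"
      using N unfolding pN r' by (metis dvd_mult2 mult.assoc)
    then have "p ^ (N - k) dvd r' * (s choose r)"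
      using prime_gt_0_nat[OF p] by (simp only: nat_mult_dvd_cancel_disj) simp
    moreover have "coprime (p ^ (N - k)) r'"
    proof -
      have "p ^ k * gcd r' (p ^ (N - k)) = p ^ k * 1"
        using k(2) unfolding r' pN by (simp add: gcd_mult_distrib_nat)
      then show ?thesis using prime_gt_0_nat[OF p] by (simp add: coprime_iff_gcd_eq_1 gcd.commute)
    qed
    ultimately show ?thesis by (simp add: coprime_dvd_mult_right_iff)
  qed
  moreover have "p ^ k dvd r" using k(2) by (metis gcd_dvd1)
  ultimately show ?thesis using that k by blast
qed

lemma (in ring_hom_cring) hom_rgh:
  assumes "Z \<in> {..m} \<rightarrow> carrier R"
  shows "h (rgh R p Z m) = rgh S p (\<lambda>i. h (Z i)) m"
proof -
  have pow: "h (x [^] (k::nat)) = h x [^]\<^bsub>S\<^esub> k" if "x \<in> carrier R" for x k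
    using that by (induction k) simp_all
  have add: "h ([k] \<cdot> x) = [k] \<cdot>\<^bsub>S\<^esub> h x" if "x \<in> carrier R" for x and k :: nat
    using that by (induction k) simp_all
  show ?thesis unfolding rgh_def using assms
    by (subst hom_finsum) (auto intro!: S.finsum_cong' simp: add pow Pi_iff)
qed

context witt_lift
begin

text \<open>
  The exponent loses divisibility by \<open>p\<close> exactly as far as \<open>r\<close> is not divisible by \<open>p ^ (n - i)\<close>, and
  the binomial coefficient makes up for it.
\<close>

lemma dpd_generator_in_span:
  assumes i: "i \<le> n" and c: "c \<in> carrier W" and e: "e \<in> M"
  shows "L.dpd r ([(p ^ i)] \<cdot>\<^bsub>L\<^esub> L.mon c (nmult (p ^ (n - i)) e)) \<in> span"
proof (cases "cnt (nmult (p ^ (n - i)) e) < r")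
  case True
  then show ?thesis using assms
    by (simp add: L.add_pow_mon S.M_nmult L.dpd_mon_less span.zero)
next
  case False
  define E where "E = nmult (p ^ (n - i)) e"
  have "p ^ (n - i) dvd cnt E" by (simp add: E_def S.cnt_nmult)
  then obtain k where k: "k \<le> n - i" "p ^ k dvd r" "p ^ (n - i - k) dvd (cnt E choose r)"
    using prime_power_dvd_binomial[OF p] by blast
  obtain r' where r': "r = p ^ k * r'" using k(2) by (elim dvdE)
  obtain m where m: "cnt E choose r = p ^ (n - i - k) * m" using k(3) by (elim dvdE)
  have E: "E = nmult (p ^ k) (nmult (p ^ (n - i - k)) e)"
  proof -
    have "p ^ (n - i) = p ^ k * p ^ (n - i - k)"
      unfolding power_add[symmetric] le_add_diff_inverse[OF k(1)] ..
    then show ?thesis unfolding E_def by (simp only: nmult_mult)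
  qed
  have "cnt E = p ^ k * cnt (nmult (p ^ (n - i - k)) e)"
    by (subst E) (rule S.cnt_nmult)
  moreover have "r \<le> cnt E" using False by (simp only: E_def not_less)
  ultimately have "p ^ k * r' \<le> p ^ k * cnt (nmult (p ^ (n - i - k)) e)"
    by (simp only: r')
  then have "r' \<le> cnt (nmult (p ^ (n - i - k)) e)"
    using p0 by simp
  then obtain b where b: "nmult (p ^ (n - i - k)) e = b + nmult r' u"
    using S.cnt_ge by blast
  have "b + nmult r' u \<in> M" using e S.M_nmult by (simp flip: b)
  then have bM: "b \<in> M" using S.M_add by blast
  have Eb: "E = nmult (p ^ k) b + nmult r u"
    unfolding E b nmult_add_right r' nmult_mult ..
  have i': "i + (n - i - k) = n - k" "n - (n - k) = k" using k(1) i by auto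
  have "L.dpd r ([(p ^ i)] \<cdot>\<^bsub>L\<^esub> L.mon c E) = L.dpd r (L.mon ([(p ^ i)] \<cdot>\<^bsub>W\<^esub> c) E)"
    using c e by (simp add: L.add_pow_mon S.M_nmult E_def)
  also have "\<dots> = L.mon ([(cnt E choose r)] \<cdot>\<^bsub>W\<^esub> ([(p ^ i)] \<cdot>\<^bsub>W\<^esub> c)) (nmult (p ^ k) b)"
    unfolding Eb by (rule L.dpd_mon)
  also have "[(cnt E choose r)] \<cdot>\<^bsub>W\<^esub> ([(p ^ i)] \<cdot>\<^bsub>W\<^esub> c) = [(p ^ (n - k))] \<cdot>\<^bsub>W\<^esub> ([m] \<cdot>\<^bsub>W\<^esub> c)"
    unfolding m using c by (simp add: L.R.add.nat_pow_pow i'(1)[symmetric] power_add ac_simps)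
  also have "L.mon \<dots> (nmult (p ^ k) b) = [(p ^ (n - k))] \<cdot>\<^bsub>L\<^esub> L.mon ([m] \<cdot>\<^bsub>W\<^esub> c) (nmult (p ^ (n - (n - k))) b)"
    unfolding i'(2) using c bM by (simp add: L.add_pow_mon S.M_nmult)
  also have "\<dots> \<in> span" using c bM by (intro span_generator) auto
  finally show ?thesis unfolding E_def .
qed

lemma dpd_span: "g \<in> span \<Longrightarrow> L.dpd r g \<in> span"
proof (induction rule: span.induct)
  case zero
  then show ?case by (simp add: L.dpd_zero span.zero)
next
  case (add i c e g)
  then show ?case
    by (simp add: L.dpd_add span_closed S.M_nmult span_add dpd_generator_in_span)
qed

text \<open>
  The image of a constant Witt vector is a constant polynomial.
\<close>

lemma w_tilde_const:
  assumes a: "a \<in> carrier W" and cst: "\<And>a. a \<in> carrier B \<Longrightarrow> cst a = S.mon a 0"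
  shows "witt_map n cst a \<in> carrier WS" "\<exists>b\<in>carrier W. wt (witt_map n cst a) = L.mon b 0"
proof -
  show c: "witt_map n cst a \<in> carrier WS"
    using a cst W_coeff_closed[OF a] by (auto simp: witt_map_def carrier_witt S.M_zero)
  define \<alpha> where "\<alpha> = (\<lambda>i. \<lambda>j\<in>{..n}. if j = 0 then a i else \<zero>\<^bsub>B\<^esub>)"
  have \<alpha>: "\<alpha> i \<in> carrier W" if "i \<le> n" for i
    using W_coeff_closed[OF a that] by (auto simp: \<alpha>_def carrier_witt)
  have "(\<lambda>c. L.mon c 0) \<in> ring_hom W L"
    by (rule ring_hom_memI) (simp_all add: L.mon_add L.mon_mult_mon S.M_zero L.one_P_mon)
  then interpret K: ring_hom_cring W L "\<lambda>c. L.mon c 0" by unfold_locales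
  have "wt (witt_map n cst a) = rgh L p (\<lambda>i. L.mon (\<alpha> i) 0) n"
  proof (rule w_tilde_eq_rgh[OF c])
    fix i assume i: "i \<le> n"
    show "L.mon (\<alpha> i) 0 \<in> carrier L" using \<alpha>[OF i] by (simp add: S.M_zero)
    show "reduction (L.mon (\<alpha> i) 0) = witt_map n cst a i"
      using i cst[OF W_coeff_closed[OF a i]]
      by (auto simp: witt_map_def reduction_def fun_eq_iff L.mon_apply S.mon_apply W_zero \<alpha>_def)
  qed
  also have "\<dots> = L.mon (rgh W p \<alpha> n) 0" using \<alpha> by (subst K.hom_rgh) auto
  finally have "wt (witt_map n cst a) = L.mon (rgh W p \<alpha> n) 0" .
  moreover have "rgh W p \<alpha> n \<in> carrier W" using \<alpha> by (intro L.R.rgh_closed) auto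
  ultimately show "\<exists>b\<in>carrier W. wt (witt_map n cst a) = L.mon b 0" by blast
qed

text \<open>
  The image is stable under the divided power derivation, which can therefore be transported to \<open>WS\<close>.
  Uniqueness is injectivity.
\<close>

lemma ex1_witt_dpd:
  assumes cst: "\<And>a. a \<in> carrier B \<Longrightarrow> cst a = S.mon a 0"
  shows "\<exists>!D. D \<in> diff_operators W (witt_map n cst) WS r \<and>
    (\<forall>x\<in>carrier WS. wt (D x) = L.dpd r (wt x))"
proof -
  define D where "D = (\<lambda>x\<in>carrier WS. inv_into (carrier WS) wt (L.dpd r (wt x)))"
  have im: "L.dpd r (wt x) \<in> wt ` carrier WS" if "x \<in> carrier WS" for x
    using that dpd_span image_eq_span by blast
  have D: "D x \<in> carrier WS" "wt (D x) = L.dpd r (wt x)" if "x \<in> carrier WS" for x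
    using inv_into_into[OF im[OF that]] f_inv_into_f[OF im[OF that]] that by (simp_all add: D_def)
  show ?thesis
  proof (rule ex1I[of _ D], intro conjI ballI)
    show "D \<in> diff_operators W (witt_map n cst) WS r"
    proof (rule diff_operators_restrict[OF WS.is_cring L.P.is_cring w_tilde_hom w_tilde_inj])
      show "(\<lambda>f\<in>carrier L. L.dpd r f) \<in> diff_operators W (\<lambda>a. L.mon a 0) L r"
        by (rule L.dpd_diff_operator) (rule refl)
      show "D \<in> carrier WS \<rightarrow>\<^sub>E carrier WS"
        using D(1) by (auto simp: D_def)
      show "wt (D x) = (\<lambda>f\<in>carrier L. L.dpd r f) (wt x)" if "x \<in> carrier WS" for x
        using D(2) that by simp
    qed (use w_tilde_const[OF _ cst] in auto)
    show "wt (D x) = L.dpd r (wt x)" if "x \<in> carrier WS" for x by (rule D(2)[OF that])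
  next
    fix E assume E: "E \<in> diff_operators W (witt_map n cst) WS r \<and>
      (\<forall>x\<in>carrier WS. wt (E x) = L.dpd r (wt x))"
    then have "E \<in> carrier WS \<rightarrow>\<^sub>E carrier WS"
      using diff_operators_linear linear_operatorsD(1) by blast
    moreover have "D \<in> carrier WS \<rightarrow>\<^sub>E carrier WS" using D(1) by (auto simp: D_def)
    moreover have "E x = D x" if "x \<in> carrier WS" for x
      using E D that calculation by (intro inj_onD[OF w_tilde_inj]) auto
    ultimately show "E = D" by (rule PiE_ext)
  qed
qed

end


section \<open>Polynomials in one and in several variables\<close>

lemma nmult_nat: "nmult k (a::nat) = k * a"
  by (induction k) simp_all

lemma count_nmult: "count (nmult k e) i = k * count e i"
  by (induction k) simp_all

lemma nmult_single: "nmult k {#i#} = replicate_mset k i"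
  by (induction k) simp_all

lemma decompositions_nat: "{x. fst x + snd x = (s::nat)} = (\<lambda>i. (i, s - i)) ` {..s}"
  by force

lemma decompositions_mset:
  "{x. fst x + snd x = (e::'i multiset)} = (\<lambda>e'. (e', e - e')) ` {e'. e' \<subseteq># e}"
  by (force simp: image_iff subset_mset.add_diff_inverse)

lemma finite_subset_mset: "finite {e'. e' \<subseteq># (e::'i multiset)}"
proof (induction e)
  case (add i e)
  have "{e'. e' \<subseteq># add_mset i e} \<subseteq> {e'. e' \<subseteq># e} \<union> add_mset i ` {e'. e' \<subseteq># e}"
  proof
    fix e' assume e': "e' \<in> {e'. e' \<subseteq># add_mset i e}"
    show "e' \<in> {e'. e' \<subseteq># e} \<union> add_mset i ` {e'. e' \<subseteq># e}"
    proof (cases "i \<in># e'")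
      case True
      then obtain f where "e' = add_mset i f" by (metis insert_DiffM)
      then show ?thesis using e' by auto
    next
      case False
      then show ?thesis using e' by (metis (no_types, lifting) CollectD CollectI UnI1 add_mset_remove_trivial diff_single_trivial subset_eq_diff_conv add_mset_add_single)
    qed
  qed
  then show ?case using add by (meson finite_UnI finite_imageI finite_subset)
qed simp

lemma monomials_nat: "monomials UNIV (1::nat) (\<lambda>s. s)"
proof
  show "finite {x. fst x + snd x = s}" for s :: nat
    unfolding decompositions_nat by simp
  show "\<exists>b. a = b + 1" if "0 < a" for a :: nat
    using that by (intro exI[of _ "a - 1"]) simp
qed (auto simp: nmult_nat)

lemma monomials_mset:
  assumes "i \<in> I"
  shows "monomials {e. set_mset e \<subseteq> I} {#i#} (\<lambda>e. count e i)"
proof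
  show "finite {x. fst x + snd x = e}" for e :: "'a multiset"
    unfolding decompositions_mset by (simp add: finite_subset_mset)
  show "\<exists>b. a = b + {#i#}" if "0 < count a i" for a
    using that by (intro exI[of _ "a - {#i#}"]) simp
  show "a = b" if "k > 0" "nmult k a = nmult k b" for k and a b :: "'a multiset"
  proof (rule multiset_eqI)
    fix j
    have "k * count a j = k * count b j" using that(2) by (simp flip: count_nmult)
    then show "count a j = count b j" using that(1) by simp
  qed
qed (use assms in auto)

lemma (in cring) poly_ring_UP: "poly_ring UNIV 1 (\<lambda>s. s) R (UP R)"
proof (intro poly_ring.intro monomials_nat is_cring poly_ring_axioms.intro)
  have "(\<exists>m. bound \<zero> m f) \<longleftrightarrow> finite {s. f s \<noteq> \<zero>}" for f :: "nat \<Rightarrow> 'a"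
  proof
    assume "\<exists>m. bound \<zero> m f"
    then obtain m where "\<And>s. m < s \<Longrightarrow> f s = \<zero>" by (metis bound.bound)
    then have "{s. f s \<noteq> \<zero>} \<subseteq> {..m}" by (auto simp: not_less[symmetric])
    then show "finite {s. f s \<noteq> \<zero>}" by (rule finite_subset) simp
  next
    assume "finite {s. f s \<noteq> \<zero>}"
    then obtain m where "\<And>s. f s \<noteq> \<zero> \<Longrightarrow> s \<le> m"
      by (metis (mono_tags, lifting) finite_nat_set_iff_bounded_le mem_Collect_eq)
    then show "\<exists>m. bound \<zero> m f" by (intro exI[of _ m] bound.intro) (metis not_less)
  qed
  then show "carrier (UP R) = {f. range f \<subseteq> carrier R \<and> finite {e. f e \<noteq> \<zero>} \<and> (\<forall>e. f e \<noteq> \<zero> \<longrightarrow> e \<in> UNIV)}"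
    by (auto simp: UP_def up_def)
  fix f g e assume fg: "f \<in> carrier (UP R)" "g \<in> carrier (UP R)"
  then have c: "f i \<in> carrier R" "g i \<in> carrier R" for i
    by (auto simp: UP_def up_def)
  have "(\<Oplus>x\<in>{x. fst x + snd x = e}. f (fst x) \<otimes> g (snd x)) = (\<Oplus>i\<in>{..e}. f i \<otimes> g (e - i))"
    unfolding decompositions_nat using c by (subst finsum_reindex) (auto simp: inj_on_def)
  then show "(f \<otimes>\<^bsub>UP R\<^esub> g) e = (\<Oplus>x\<in>{x. fst x + snd x = e}. f (fst x) \<otimes> g (snd x))"
    using fg by (simp add: UP_def)
qed (auto simp: UP_def)

lemma (in cring) poly_ring_MP:
  assumes "i \<in> I"
  shows "poly_ring {e. set_mset e \<subseteq> I} {#i#} (\<lambda>e. count e i) R (MP R I)"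
proof (intro poly_ring.intro monomials_mset assms is_cring poly_ring_axioms.intro)
  fix f g e assume fg: "f \<in> carrier (MP R I)" "g \<in> carrier (MP R I)"
  then have c: "f i \<in> carrier R" "g i \<in> carrier R" for i
    by (auto simp: MP_def)
  have "(\<Oplus>x\<in>{x. fst x + snd x = e}. f (fst x) \<otimes> g (snd x)) = (\<Oplus>e'\<in>{e'. e' \<subseteq># e}. f e' \<otimes> g (e - e'))"
    unfolding decompositions_mset using c by (subst finsum_reindex) (auto simp: inj_on_def)
  then show "(f \<otimes>\<^bsub>MP R I\<^esub> g) e = (\<Oplus>x\<in>{x. fst x + snd x = e}. f (fst x) \<otimes> g (snd x))"
    by (simp add: MP_def)
qed (auto simp: MP_def)

section \<open>The operators on Witt vectors\<close>

theorem proposition5p3: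
  fixes p n :: nat
    and B :: "('b, 'm) ring_scheme"
    and k :: "('k, 'l) ring_scheme"
  assumes "prime p"
  shows
    "(perfect_Fp_algebra p B \<longrightarrow>
       (\<forall>r. \<exists>!D. D \<in> diff_operators (witt p n B) (witt_map n (UP_const B)) (witt p n (UP B)) r \<and>
          (\<forall>x\<in>carrier (witt p n (UP B)).
             w_tilde p n (UP (witt p n B)) (D x) =
             UP_dpd (witt p n B) r (w_tilde p n (UP (witt p n B)) x))))
     \<and>
     (\<forall>d::nat. field k \<and> perfect_Fp_algebra p k \<and> d \<ge> 1 \<longrightarrow>
       (\<forall>r. \<forall>i\<in>{1..d}.
          \<exists>!D. D \<in> diff_operators (witt p n k) (witt_map n (MP_const k)) (witt p n (MP k {1..d})) r \<and>
          (\<forall>x\<in>carrier (witt p n (MP k {1..d})).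
             w_tilde p n (MP (witt p n k) {1..d}) (D x) =
             MP_dpd (witt p n k) i r (w_tilde p n (MP (witt p n k) {1..d}) x))))"
proof (intro conjI impI allI ballI)
  fix r
  assume perfect: "perfect_Fp_algebra p B"
  then interpret B: cring B by (simp add: perfect_Fp_algebra_def)
  interpret W: cring "witt p n B" by (rule B.cring_witt[OF assms])
  interpret S: poly_ring UNIV 1 "\<lambda>s. s" B "UP B" by (rule B.poly_ring_UP)
  interpret L: poly_ring UNIV 1 "\<lambda>s. s" "witt p n B" "UP (witt p n B)" by (rule W.poly_ring_UP)
  interpret witt_lift p n UNIV 1 "\<lambda>s. s" B "UP B" "UP (witt p n B)"
    by unfold_locales (rule assms perfect)+
  have "UP_const B a = S.mon a 0" if "a \<in> carrier B" for a
    using that by (simp add: UP_const_def UP_def S.mon_def fun_eq_iff)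
  moreover have "UP_dpd (witt p n B) r = L.dpd r"
    by (intro ext) (simp only: UP_dpd_def L.dpd_def nmult_nat mult_1_right)
  ultimately show "\<exists>!D. D \<in> diff_operators (witt p n B) (witt_map n (UP_const B)) (witt p n (UP B)) r \<and>
          (\<forall>x\<in>carrier (witt p n (UP B)).
             w_tilde p n (UP (witt p n B)) (D x) =
             UP_dpd (witt p n B) r (w_tilde p n (UP (witt p n B)) x))"
    by (simp only: ex1_witt_dpd)
next
  fix d r i :: nat
  assume k: "field k \<and> perfect_Fp_algebra p k \<and> d \<ge> 1" and i: "i \<in> {1..d}"
  then have perfect: "perfect_Fp_algebra p k" by simp
  then interpret B: cring k by (simp add: perfect_Fp_algebra_def)
  let ?M = "{e. set_mset e \<subseteq> {1..d}}"
  interpret W: cring "witt p n k" by (rule B.cring_witt[OF assms])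
  interpret S: poly_ring ?M "{#i#}" "\<lambda>e. count e i" k "MP k {1..d}" by (rule B.poly_ring_MP[OF i])
  interpret L: poly_ring ?M "{#i#}" "\<lambda>e. count e i" "witt p n k" "MP (witt p n k) {1..d}"
    by (rule W.poly_ring_MP[OF i])
  interpret witt_lift p n ?M "{#i#}" "\<lambda>e. count e i" k "MP k {1..d}" "MP (witt p n k) {1..d}"
    by unfold_locales (rule assms perfect)+
  have "MP_const k a = S.mon a 0" for a
    by (simp add: MP_const_def S.mon_def fun_eq_iff)
  moreover have "MP_dpd (witt p n k) i r = L.dpd r"
    by (simp add: MP_dpd_def L.dpd_def fun_eq_iff nmult_single)
  ultimately show "\<exists>!D. D \<in> diff_operators (witt p n k) (witt_map n (MP_const k)) (witt p n (MP k {1..d})) r \<and>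
          (\<forall>x\<in>carrier (witt p n (MP k {1..d})).
             w_tilde p n (MP (witt p n k) {1..d}) (D x) =
             MP_dpd (witt p n k) i r (w_tilde p n (MP (witt p n k) {1..d}) x))"
    by (simp only: ex1_witt_dpd)
qed

end
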